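(* Suppose that $\{(G_i,c_i)\}_{i\in I}$ are circularly-ordered groups ($I$ nonempty), $H$ is a group and for each $i\in I$, $\phi_i:H\to G_i$ is an injective homomorphism with image $H_i\subset G_i$. Suppose further that for each $i\in I$ the induced map $\phi_i^*:H^1(G_i;\mathbb{Z})\to H^1(H;\mathbb{Z})$ is surjective. If there exist cohomologically constant normal families $\mathcal{R}_i\subset\mathrm{CO}(G_i)$ such that $c_i\in\mathcal{R}_i$ for all $i\in I$ and the collections $\{c_i\}_{i\in I}$ and $\{\mathcal{R}_i\}_{i\in I}$ are compatible with $\{\phi_i\}_{i\in I}$, then there is a circular ordering $c$ on the free product with amalgamation $*_{i\in I}G_i\,(H_i\stackrel{\phi_i}{\cong}H)$ extending each of the $c_i$.
   Context: A circular ordering of a group $G$ is a function $c:G^3\to\{0,\pm1\}$ such that: $c(a_1,a_2,a_3)=0$ if and only if $a_i=a_j$ for some $i\ne j$; $c(a_2,a_3,a_4)-c(a_1,a_3,a_4)+c(a_1,a_2,a_4)-c(a_1,a_2,a_3)=0$ for all $a_1,\dots,a_4\in G$; and $c(ga_1,ga_2,ga_3)=c(a_1,a_2,a_3)$ for all $g,a_1,a_2,a_3\in G$. $\mathrm{CO}(G)$ is the set of all circular orderings of $G$. $H^1(G;\mathbb{Z})=\mathrm{Hom}(G,\mathbb{Z})$, and $\phi_i^*$ on $H^1$ is precomposition with $\phi_i$. For an injective homomorphism $\phi:H\to G$ and $c\in\mathrm{CO}(G)$, the pullback $\phi^*c\in\mathrm{CO}(H)$ is $\phi^*c(h_1,h_2,h_3)=c(\phi(h_1),\phi(h_2),\phi(h_3))$;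 for $S\subset\mathrm{CO}(G)$, $\phi^*S=\{\phi^*c:c\in S\}$. For $c\in\mathrm{CO}(G)$ and $h\in G$, $c^h\in\mathrm{CO}(G)$ is $c^h(g_1,g_2,g_3)=c(g_1h,g_2h,g_3h)$. A normal family is a set $\mathcal{N}\subset\mathrm{CO}(G)$ with $c^h\in\mathcal{N}$ for all $c\in\mathcal{N}$, $h\in G$. For $c\in\mathrm{CO}(G)$, $f_c:G^2\to\mathbb{Z}$ is the (inhomogeneous) 2-cocycle with $f_c(a,b)=0$ if $a=id$ or $b=id$ or $c(id,a,ab)=1$, and $f_c(a,b)=1$ if $ab=id$ with $a\ne id$, or $c(id,ab,a)=1$; $[f_c]\in H^2(G;\mathbb{Z})$ is its class. A set $S\subset\mathrm{CO}(G)$ is cohomologically constant if $[f_c]=[f_{c'}]$ for all $c,c'\in S$. The collection $\{c_i\}_{i\in I}$ is compatible with $\{\phi_i\}_{i\in I}$ if $\phi_i^*c_i=\phi_j^*c_j$ for all $i,j\in I$; sets $S_i\subset\mathrm{CO}(G_i)$ are compatible with $\{\phi_i\}_{i\in I}$ if $\phi_i^*S_i=\phi_j^*S_j$ for all $i,j\in I$. $*_{i\in I}G_i\,(H_i\stackrel{\phi_i}{\cong}H)$ denotes the free product of the $G_i$ amalgamated by identifying $\phi_i(h)$ with $\phi_j(h)$ for all $h\in H$, $i,j\in I$. Each $G_i$ is regarded as a subgroup, and an ordering of the amalgam extends $c_i$ if it restricts to $c_i$ on $G_i$. *)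

theory Defs
  imports "HOL-Algebra.Algebra"
begin

section \<open>Circular orderings\<close>

text \<open>Functions on \<open>G\<^sup>3\<close> are represented by extensional functions on \<open>carrier G\<close> cubed, so
  that equality of HOL functions is equality of functions on \<open>G\<^sup>3\<close>.\<close>

definition circ_orders :: "('a, 'm) monoid_scheme \<Rightarrow> ('a \<times> 'a \<times> 'a \<Rightarrow> int) set" where
  "circ_orders G =
    {c \<in> carrier G \<times> carrier G \<times> carrier G \<rightarrow>\<^sub>E {-1, 0, 1}.
      (\<forall>a1 \<in> carrier G. \<forall>a2 \<in> carrier G. \<forall>a3 \<in> carrier G.
         c (a1, a2, a3) = 0 \<longleftrightarrow> a1 = a2 \<or> a1 = a3 \<or> a2 = a3) \<and>
      (\<forall>a1 \<in> carrier G. \<forall>a2 \<in> carrier G. \<forall>a3 \<in> carrier G. \<forall>a4 \<in> carrier G.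
         c (a2, a3, a4) - c (a1, a3, a4) + c (a1, a2, a4) - c (a1, a2, a3) = 0) \<and>
      (\<forall>g \<in> carrier G. \<forall>a1 \<in> carrier G. \<forall>a2 \<in> carrier G. \<forall>a3 \<in> carrier G.
         c (g \<otimes>\<^bsub>G\<^esub> a1, g \<otimes>\<^bsub>G\<^esub> a2, g \<otimes>\<^bsub>G\<^esub> a3) = c (a1, a2, a3))}"

definition pullback :: "('h, 'n) monoid_scheme \<Rightarrow> ('h \<Rightarrow> 'a) \<Rightarrow> ('a \<times> 'a \<times> 'a \<Rightarrow> int)
    \<Rightarrow> ('h \<times> 'h \<times> 'h \<Rightarrow> int)" where
  "pullback H \<phi> c =
    (\<lambda>(h1, h2, h3) \<in> carrier H \<times> carrier H \<times> carrier H. c (\<phi> h1, \<phi> h2, \<phi> h3))"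

definition right_translate :: "('a, 'm) monoid_scheme \<Rightarrow> 'a \<Rightarrow> ('a \<times> 'a \<times> 'a \<Rightarrow> int)
    \<Rightarrow> ('a \<times> 'a \<times> 'a \<Rightarrow> int)" where
  "right_translate G h c =
    (\<lambda>(g1, g2, g3) \<in> carrier G \<times> carrier G \<times> carrier G.
       c (g1 \<otimes>\<^bsub>G\<^esub> h, g2 \<otimes>\<^bsub>G\<^esub> h, g3 \<otimes>\<^bsub>G\<^esub> h))"

definition normal_family :: "('a, 'm) monoid_scheme \<Rightarrow> ('a \<times> 'a \<times> 'a \<Rightarrow> int) set \<Rightarrow> bool" where
  "normal_family G N \<longleftrightarrow>
    N \<subseteq> circ_orders G \<and> (\<forall>c \<in> N. \<forall>h \<in> carrier G. right_translate G h c \<in> N)"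

definition compatible_orders :: "'i set \<Rightarrow> ('h, 'n) monoid_scheme \<Rightarrow> ('i \<Rightarrow> 'h \<Rightarrow> 'a)
    \<Rightarrow> ('i \<Rightarrow> 'a \<times> 'a \<times> 'a \<Rightarrow> int) \<Rightarrow> bool" where
  "compatible_orders I H \<phi> c \<longleftrightarrow>
    (\<forall>i \<in> I. \<forall>j \<in> I. pullback H (\<phi> i) (c i) = pullback H (\<phi> j) (c j))"

definition compatible_families :: "'i set \<Rightarrow> ('h, 'n) monoid_scheme \<Rightarrow> ('i \<Rightarrow> 'h \<Rightarrow> 'a)
    \<Rightarrow> ('i \<Rightarrow> ('a \<times> 'a \<times> 'a \<Rightarrow> int) set) \<Rightarrow> bool" where
  "compatible_families I H \<phi> S \<longleftrightarrow>
    (\<forall>i \<in> I. \<forall>j \<in> I. pullback H (\<phi> i) ` S i = pullback H (\<phi> j) ` S j)"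


section \<open>Integral cohomology in degrees one and two\<close>

definition H1 :: "('a, 'm) monoid_scheme \<Rightarrow> ('a \<Rightarrow> int) set" where
  "H1 G = hom G integer_group \<inter> extensional (carrier G)"

definition H1_map :: "('h, 'n) monoid_scheme \<Rightarrow> ('h \<Rightarrow> 'a) \<Rightarrow> ('a \<Rightarrow> int) \<Rightarrow> ('h \<Rightarrow> int)" where
  "H1_map H \<phi> \<psi> = compose (carrier H) \<psi> \<phi>"

text \<open>The group of inhomogeneous 2-cocycles \<open>Z\<^sup>2(G;\<int>)\<close> (trivial action), written as a
  multiplicative record as in \<^theory>\<open>HOL-Algebra.Group\<close>, and its subgroup of coboundaries
  \<open>(\<delta>u)(a,b) = u(b) - u(ab) + u(a)\<close>.\<close>

definition Z2 :: "('a, 'm) monoid_scheme \<Rightarrow> ('a \<times> 'a \<Rightarrow> int) monoid" where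
  "Z2 G =
    \<lparr>carrier = {f \<in> extensional (carrier G \<times> carrier G).
       \<forall>x \<in> carrier G. \<forall>y \<in> carrier G. \<forall>z \<in> carrier G.
         f (y, z) - f (x \<otimes>\<^bsub>G\<^esub> y, z) + f (x, y \<otimes>\<^bsub>G\<^esub> z) - f (x, y) = 0},
     monoid.mult = (\<lambda>f g. \<lambda>p \<in> carrier G \<times> carrier G. f p + g p),
     one = (\<lambda>p \<in> carrier G \<times> carrier G. 0)\<rparr>"

definition B2 :: "('a, 'm) monoid_scheme \<Rightarrow> ('a \<times> 'a \<Rightarrow> int) set" where
  "B2 G =
    {\<lambda>(a, b) \<in> carrier G \<times> carrier G. u b - u (a \<otimes>\<^bsub>G\<^esub> b) + u a | u. True}"

definition H2 :: "('a, 'm) monoid_scheme \<Rightarrow> ('a \<times> 'a \<Rightarrow> int) set monoid" where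
  "H2 G = Z2 G Mod B2 G"

definition H2_class :: "('a, 'm) monoid_scheme \<Rightarrow> ('a \<times> 'a \<Rightarrow> int) \<Rightarrow> ('a \<times> 'a \<Rightarrow> int) set" where
  "H2_class G f = B2 G #>\<^bsub>Z2 G\<^esub> f"

text \<open>The last branch below is never reached when \<open>c\<close> is a circular ordering, see
  \<open>euler_cocycle_cases\<close>.\<close>

definition euler_cocycle :: "('a, 'm) monoid_scheme \<Rightarrow> ('a \<times> 'a \<times> 'a \<Rightarrow> int) \<Rightarrow> ('a \<times> 'a \<Rightarrow> int)" where
  "euler_cocycle G c =
    (\<lambda>(a, b) \<in> carrier G \<times> carrier G.
       if a = \<one>\<^bsub>G\<^esub> \<or> b = \<one>\<^bsub>G\<^esub> \<or> c (\<one>\<^bsub>G\<^esub>, a, a \<otimes>\<^bsub>G\<^esub> b) = 1 then 0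
       else if (a \<otimes>\<^bsub>G\<^esub> b = \<one>\<^bsub>G\<^esub> \<and> a \<noteq> \<one>\<^bsub>G\<^esub>) \<or> c (\<one>\<^bsub>G\<^esub>, a \<otimes>\<^bsub>G\<^esub> b, a) = 1 then 1
       else undefined)"

definition cohom_constant :: "('a, 'm) monoid_scheme \<Rightarrow> ('a \<times> 'a \<times> 'a \<Rightarrow> int) set \<Rightarrow> bool" where
  "cohom_constant G S \<longleftrightarrow>
    (\<forall>c \<in> S. \<forall>c' \<in> S. H2_class G (euler_cocycle G c) = H2_class G (euler_cocycle G c'))"

lemma Z2_iff:
  "f \<in> carrier (Z2 G) \<longleftrightarrow> f \<in> extensional (carrier G \<times> carrier G) \<and>
    (\<forall>x \<in> carrier G. \<forall>y \<in> carrier G. \<forall>z \<in> carrier G.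
       f (y, z) - f (x \<otimes>\<^bsub>G\<^esub> y, z) + f (x, y \<otimes>\<^bsub>G\<^esub> z) - f (x, y) = 0)"
  by (simp add: Z2_def)

lemma Z2_ops:
  "f \<otimes>\<^bsub>Z2 G\<^esub> g = (\<lambda>p \<in> carrier G \<times> carrier G. f p + g p)"
  "\<one>\<^bsub>Z2 G\<^esub> = (\<lambda>p \<in> carrier G \<times> carrier G. 0)"
  by (simp_all add: Z2_def)

lemma Z2_comm_group:
  assumes "group G"
  shows "comm_group (Z2 G)"
proof -
  interpret group G by fact
  show ?thesis
  proof (rule comm_groupI)
    fix f g assume f: "f \<in> carrier (Z2 G)" and g: "g \<in> carrier (Z2 G)"
    show "f \<otimes>\<^bsub>Z2 G\<^esub> g \<in> carrier (Z2 G)"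
      unfolding Z2_iff
    proof (intro conjI ballI)
      fix x y z assume "x \<in> carrier G" "y \<in> carrier G" "z \<in> carrier G"
      moreover from this have "f (y, z) - f (x \<otimes>\<^bsub>G\<^esub> y, z) + f (x, y \<otimes>\<^bsub>G\<^esub> z) - f (x, y) = 0"
        "g (y, z) - g (x \<otimes>\<^bsub>G\<^esub> y, z) + g (x, y \<otimes>\<^bsub>G\<^esub> z) - g (x, y) = 0"
        using f g unfolding Z2_iff by blast+
      ultimately show "(f \<otimes>\<^bsub>Z2 G\<^esub> g) (y, z) - (f \<otimes>\<^bsub>Z2 G\<^esub> g) (x \<otimes>\<^bsub>G\<^esub> y, z)
          + (f \<otimes>\<^bsub>Z2 G\<^esub> g) (x, y \<otimes>\<^bsub>G\<^esub> z) - (f \<otimes>\<^bsub>Z2 G\<^esub> g) (x, y) = 0"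
        by (simp add: Z2_ops)
    qed (simp add: Z2_ops)
  next
    fix f assume f: "f \<in> carrier (Z2 G)"
    define g where "g = (\<lambda>p \<in> carrier G \<times> carrier G. - f p)"
    have "g \<in> carrier (Z2 G)"
      unfolding Z2_iff
    proof (intro conjI ballI)
      fix x y z assume "x \<in> carrier G" "y \<in> carrier G" "z \<in> carrier G"
      moreover from this have "f (y, z) - f (x \<otimes>\<^bsub>G\<^esub> y, z) + f (x, y \<otimes>\<^bsub>G\<^esub> z) - f (x, y) = 0"
        using f unfolding Z2_iff by blast
      ultimately show "g (y, z) - g (x \<otimes>\<^bsub>G\<^esub> y, z) + g (x, y \<otimes>\<^bsub>G\<^esub> z) - g (x, y) = 0"
        by (simp add: g_def)
    qed (simp add: g_def)
    moreover have "g \<otimes>\<^bsub>Z2 G\<^esub> f = \<one>\<^bsub>Z2 G\<^esub>"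
      by (auto simp: Z2_ops g_def fun_eq_iff)
    ultimately show "\<exists>g \<in> carrier (Z2 G). g \<otimes>\<^bsub>Z2 G\<^esub> f = \<one>\<^bsub>Z2 G\<^esub>" by blast
  next
    show "\<one>\<^bsub>Z2 G\<^esub> \<in> carrier (Z2 G)" unfolding Z2_iff by (simp add: Z2_ops)
  next
    fix f assume "f \<in> carrier (Z2 G)"
    then have "f \<in> extensional (carrier G \<times> carrier G)" unfolding Z2_iff by blast
    then show "\<one>\<^bsub>Z2 G\<^esub> \<otimes>\<^bsub>Z2 G\<^esub> f = f"
      by (auto simp: Z2_ops fun_eq_iff extensional_def)
  qed (auto simp: Z2_ops fun_eq_iff)
qed

lemma B2_normal:
  fixes G (structure)
  assumes "group G"
  shows "B2 G \<lhd> Z2 G"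
proof -
  interpret group G by fact
  interpret Z: comm_group "Z2 G" by (rule Z2_comm_group) fact
  have sub: "B2 G \<subseteq> carrier (Z2 G)"
    by (auto simp: B2_def Z2_iff m_assoc)
  have "subgroup (B2 G) (Z2 G)"
  proof (rule Z.subgroupI[OF sub])
    show "B2 G \<noteq> {}" by (auto simp: B2_def)
  next
    fix f assume "f \<in> B2 G"
    then obtain u where f: "f = (\<lambda>(a, b) \<in> carrier G \<times> carrier G. u b - u (a \<otimes> b) + u a)"
      by (auto simp: B2_def)
    define g where "g = (\<lambda>(a, b) \<in> carrier G \<times> carrier G. (- u b) - (- u (a \<otimes> b)) + (- u a))"
    have g: "g \<in> B2 G" unfolding B2_def g_def by (rule CollectI) (rule exI[of _ "\<lambda>x. - u x"], simp)
    have "g \<otimes>\<^bsub>Z2 G\<^esub> f = \<one>\<^bsub>Z2 G\<^esub>"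
      by (auto simp: Z2_ops f g_def fun_eq_iff)
    then have "inv\<^bsub>Z2 G\<^esub> f = g"
      by (rule Z.inv_equality) (use g sub \<open>f \<in> B2 G\<close> in blast)+
    then show "inv\<^bsub>Z2 G\<^esub> f \<in> B2 G" using g by simp
  next
    fix f g assume "f \<in> B2 G" "g \<in> B2 G"
    then obtain u v where f: "f = (\<lambda>(a, b) \<in> carrier G \<times> carrier G. u b - u (a \<otimes> b) + u a)"
      and g: "g = (\<lambda>(a, b) \<in> carrier G \<times> carrier G. v b - v (a \<otimes> b) + v a)"
      by (auto simp: B2_def)
    show "f \<otimes>\<^bsub>Z2 G\<^esub> g \<in> B2 G"
      unfolding B2_def
      by (rule CollectI, rule exI[of _ "\<lambda>x. u x + v x"]) (auto simp: Z2_ops f g fun_eq_iff)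
  qed
  then show ?thesis by (rule Z.subgroup_imp_normal)
qed

lemma circ_order_zero:
  assumes "c \<in> circ_orders G" "x \<in> carrier G" "y \<in> carrier G" "z \<in> carrier G"
  shows "c (x, y, z) = 0 \<longleftrightarrow> x = y \<or> x = z \<or> y = z"
  using assms unfolding circ_orders_def by blast

lemma circ_order_values:
  assumes "c \<in> circ_orders G" "x \<in> carrier G" "y \<in> carrier G" "z \<in> carrier G"
  shows "c (x, y, z) = -1 \<or> c (x, y, z) = 0 \<or> c (x, y, z) = 1"
proof -
  have "c \<in> carrier G \<times> carrier G \<times> carrier G \<rightarrow>\<^sub>E {-1, 0, 1}"
    using assms(1) unfolding circ_orders_def by (elim CollectE conjE)
  moreover have "(x, y, z) \<in> carrier G \<times> carrier G \<times> carrier G" using assms by simp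
  ultimately have "c (x, y, z) \<in> {-1, 0, 1}" by (rule PiE_mem)
  then show ?thesis by simp
qed

lemma circ_order_cocycle:
  assumes "c \<in> circ_orders G" "x \<in> carrier G" "y \<in> carrier G" "z \<in> carrier G" "w \<in> carrier G"
  shows "c (y, z, w) - c (x, z, w) + c (x, y, w) - c (x, y, z) = 0"
  using assms unfolding circ_orders_def by blast

lemma circ_order_swap:
  assumes "c \<in> circ_orders G" "x \<in> carrier G" "y \<in> carrier G" "z \<in> carrier G"
  shows "c (x, z, y) = - c (x, y, z)"
  using circ_order_cocycle[OF assms(1,2,3,4,3)] circ_order_zero[OF assms(1,3,4,3)]
    circ_order_zero[OF assms(1,2,3,3)] by simp

lemma euler_cocycle_cases:
  fixes G (structure)
  assumes "group G" "c \<in> circ_orders G" "a \<in> carrier G" "b \<in> carrier G"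
  shows "euler_cocycle G c (a, b) =
    (if a = \<one>\<^bsub>G\<^esub> \<or> b = \<one>\<^bsub>G\<^esub> \<or> c (\<one>\<^bsub>G\<^esub>, a, a \<otimes>\<^bsub>G\<^esub> b) = 1 then 0 else 1)"
proof -
  interpret group G by fact
  have "c (\<one>, a, a \<otimes> b) = -1 \<or> c (\<one>, a, a \<otimes> b) = 0 \<or> c (\<one>, a, a \<otimes> b) = 1"
    using circ_order_values assms by (metis m_closed one_closed)
  moreover have "c (\<one>, a \<otimes> b, a) = - c (\<one>, a, a \<otimes> b)"
    using circ_order_swap assms by (metis m_closed one_closed)
  moreover have "c (\<one>, a, a \<otimes> b) = 0 \<longleftrightarrow> \<one> = a \<or> \<one> = a \<otimes> b \<or> a = a \<otimes> b"
    using circ_order_zero assms by (metis m_closed one_closed)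
  moreover have "a = a \<otimes> b \<longleftrightarrow> b = \<one>"
    using l_cancel_one' assms(3,4) by simp
  ultimately consider
    "a = \<one> \<or> b = \<one> \<or> c (\<one>, a, a \<otimes> b) = 1"
    | "\<not> (a = \<one> \<or> b = \<one> \<or> c (\<one>, a, a \<otimes> b) = 1)" "a \<otimes> b = \<one> \<and> a \<noteq> \<one> \<or> c (\<one>, a \<otimes> b, a) = 1"
    by fastforce
  moreover have "(a, b) \<in> carrier G \<times> carrier G" using assms by simp
  ultimately show ?thesis
    unfolding euler_cocycle_def by cases (simp_all only: restrict_apply split if_True if_False)
qed

lemma euler_cocycle_closed:
  fixes G (structure)
  assumes "group G" "c \<in> circ_orders G"
  shows "euler_cocycle G c \<in> carrier (Z2 G)"
proof -
  interpret group G by fact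
  define F where "F x y z = (if x = y \<or> y = z \<or> c (x, y, z) = 1 then 0 else 1 :: int)" for x y z
  have inv: "c (g \<otimes> x, g \<otimes> y, g \<otimes> z) = c (x, y, z)"
    if "g \<in> carrier G" "x \<in> carrier G" "y \<in> carrier G" "z \<in> carrier G" for g x y z
    using assms(2) that unfolding circ_orders_def by blast
  have eF: "euler_cocycle G c (a, b) = F (g) (g \<otimes> a) (g \<otimes> (a \<otimes> b))"
    if "a \<in> carrier G" "b \<in> carrier G" "g \<in> carrier G" for a b g
    using that inv[of g \<one> a "a \<otimes> b"] euler_cocycle_cases[OF assms that(1,2)]
    by (auto simp: F_def)
  have F: "F y z w - F x z w + F x y w - F x y z = 0"
    if xyzw: "x \<in> carrier G" "y \<in> carrier G" "z \<in> carrier G" "w \<in> carrier G" for x y z w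
  proof -
    note val = circ_order_values[OF assms(2)] and zero = circ_order_zero[OF assms(2)]
      and cocyc = circ_order_cocycle[OF assms(2)] and swap = circ_order_swap[OF assms(2)]
    have rot: "c (q, r, p) = c (p, q, r)"
      if "p \<in> carrier G" "q \<in> carrier G" "r \<in> carrier G" for p q r
      using cocyc[of p q r p] zero[of p r p] zero[of p q p] that by simp
    have F_swap: "F p r q = 1 - F p q r" and F_rot: "F q r p = F p q r"
      if "p \<in> carrier G" "q \<in> carrier G" "r \<in> carrier G" "p \<noteq> q" "q \<noteq> r" "p \<noteq> r" for p q r
      using that val[of p q r] zero[of p q r] swap[of p q r] rot[of p q r]
      by (auto simp: F_def)
    have F_gen: "2 * F p q r = 1 - c (p, q, r)"
      if "p \<in> carrier G" "q \<in> carrier G" "r \<in> carrier G" "p \<noteq> q" "q \<noteq> r" "p \<noteq> r" for p q r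
      using that val[of p q r] zero[of p q r] by (auto simp: F_def)
    have F_deg: "F p p q = 0" "F p q q = 0" for p q by (simp_all add: F_def)
    have F_pqp: "F p q p = 1" if "p \<in> carrier G" "q \<in> carrier G" "p \<noteq> q" for p q
      using that zero[of p q p] by (simp add: F_def)
    consider "x = y" | "y = z" | "z = w" | "x \<noteq> y" "y \<noteq> z" "z \<noteq> w" "x = z" "y = w"
      | "x \<noteq> y" "y \<noteq> z" "z \<noteq> w" "x = z" "y \<noteq> w"
      | "x \<noteq> y" "y \<noteq> z" "z \<noteq> w" "x \<noteq> z" "y = w"
      | "x \<noteq> y" "y \<noteq> z" "z \<noteq> w" "x \<noteq> z" "y \<noteq> w" "x = w"
      | "x \<noteq> y" "y \<noteq> z" "z \<noteq> w" "x \<noteq> z" "y \<noteq> w" "x \<noteq> w"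
      by blast
    then show ?thesis
    proof cases
      case 4
      then show ?thesis using xyzw by (simp add: F_deg F_pqp)
    next
      case 5
      then show ?thesis
        using xyzw F_swap[of x y w] F_rot[of y x w] F_rot[of x w y] by (simp add: F_deg F_pqp)
    next
      case 6
      then show ?thesis using xyzw F_swap[of x y z] by (simp add: F_deg F_pqp)
    next
      case 7
      then show ?thesis using xyzw F_rot[of x y z] by (simp add: F_pqp)
    next
      case 8
      then have "2 * (F y z w - F x z w + F x y w - F x y z) = 0"
        using xyzw cocyc[OF xyzw] F_gen[of y z w] F_gen[of x z w] F_gen[of x y w] F_gen[of x y z]
        by simp
      then show ?thesis by simp
    qed (simp_all add: F_deg)
  qed
  have "euler_cocycle G c (y, z) - euler_cocycle G c (x \<otimes> y, z) + euler_cocycle G c (x, y \<otimes> z)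
      - euler_cocycle G c (x, y) = 0"
    if "x \<in> carrier G" "y \<in> carrier G" "z \<in> carrier G" for x y z
    using that F[of \<one> x "x \<otimes> y" "x \<otimes> (y \<otimes> z)"]
      eF[of y z x] eF[of "x \<otimes> y" z \<one>] eF[of x "y \<otimes> z" \<one>] eF[of x y \<one>]
    by (simp add: m_assoc)
  moreover have "euler_cocycle G c \<in> extensional (carrier G \<times> carrier G)"
    by (simp add: euler_cocycle_def)
  ultimately show ?thesis unfolding Z2_iff by blast
qed

lemma H2_class_closed:
  assumes "group G" "c \<in> circ_orders G"
  shows "H2_class G (euler_cocycle G c) \<in> carrier (H2 G)"
  using euler_cocycle_closed[OF assms] by (auto simp: H2_class_def H2_def FactGroup_def RCOSETS_def)


section \<open>Free products with amalgamation\<close>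

text \<open>The amalgam of the groups \<open>G i\<close> (\<open>i \<in> I\<close>) along the maps \<open>\<phi> i\<close> from \<open>H\<close> is the group of
  words in the disjoint union of the carriers, modulo the congruence generated by the relations
  of the \<open>G i\<close> and by \<open>\<phi> i x = \<phi> j x\<close>.  Inverses exist since each letter \<open>(i, g)\<close> is inverse to
  \<open>(i, inv g)\<close>.\<close>

definition amalg_words :: "'i set \<Rightarrow> ('i \<Rightarrow> ('a, 'm) monoid_scheme) \<Rightarrow> ('i \<times> 'a) list set" where
  "amalg_words I G = lists (SIGMA i:I. carrier (G i))"

inductive amalg_eq :: "'i set \<Rightarrow> ('i \<Rightarrow> ('a, 'm) monoid_scheme) \<Rightarrow> ('h, 'n) monoid_scheme
    \<Rightarrow> ('i \<Rightarrow> 'h \<Rightarrow> 'a) \<Rightarrow> ('i \<times> 'a) list \<Rightarrow> ('i \<times> 'a) list \<Rightarrow> bool"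
  for I G H \<phi> where
  refl: "w \<in> amalg_words I G \<Longrightarrow> amalg_eq I G H \<phi> w w"
| sym: "amalg_eq I G H \<phi> v w \<Longrightarrow> amalg_eq I G H \<phi> w v"
| trans: "amalg_eq I G H \<phi> u v \<Longrightarrow> amalg_eq I G H \<phi> v w \<Longrightarrow> amalg_eq I G H \<phi> u w"
| mult: "u \<in> amalg_words I G \<Longrightarrow> v \<in> amalg_words I G \<Longrightarrow> i \<in> I \<Longrightarrow>
    g \<in> carrier (G i) \<Longrightarrow> h \<in> carrier (G i) \<Longrightarrow>
    amalg_eq I G H \<phi> (u @ [(i, g), (i, h)] @ v) (u @ [(i, g \<otimes>\<^bsub>G i\<^esub> h)] @ v)"
| one: "u \<in> amalg_words I G \<Longrightarrow> v \<in> amalg_words I G \<Longrightarrow> i \<in> I \<Longrightarrow>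
    amalg_eq I G H \<phi> (u @ [(i, \<one>\<^bsub>G i\<^esub>)] @ v) (u @ v)"
| amalg: "u \<in> amalg_words I G \<Longrightarrow> v \<in> amalg_words I G \<Longrightarrow> i \<in> I \<Longrightarrow> j \<in> I \<Longrightarrow>
    x \<in> carrier H \<Longrightarrow>
    amalg_eq I G H \<phi> (u @ [(i, \<phi> i x)] @ v) (u @ [(j, \<phi> j x)] @ v)"

definition amalg_rel :: "'i set \<Rightarrow> ('i \<Rightarrow> ('a, 'm) monoid_scheme) \<Rightarrow> ('h, 'n) monoid_scheme
    \<Rightarrow> ('i \<Rightarrow> 'h \<Rightarrow> 'a) \<Rightarrow> (('i \<times> 'a) list \<times> ('i \<times> 'a) list) set" where
  "amalg_rel I G H \<phi> = {(v, w). amalg_eq I G H \<phi> v w}"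

definition amalg_product :: "'i set \<Rightarrow> ('i \<Rightarrow> ('a, 'm) monoid_scheme) \<Rightarrow> ('h, 'n) monoid_scheme
    \<Rightarrow> ('i \<Rightarrow> 'h \<Rightarrow> 'a) \<Rightarrow> ('i \<times> 'a) list set monoid" where
  "amalg_product I G H \<phi> =
    \<lparr>carrier = amalg_words I G // amalg_rel I G H \<phi>,
     monoid.mult = (\<lambda>A B. \<Union>v \<in> A. \<Union>w \<in> B. amalg_rel I G H \<phi> `` {v @ w}),
     one = amalg_rel I G H \<phi> `` {[]}\<rparr>"

definition amalg_incl :: "'i set \<Rightarrow> ('i \<Rightarrow> ('a, 'm) monoid_scheme) \<Rightarrow> ('h, 'n) monoid_scheme
    \<Rightarrow> ('i \<Rightarrow> 'h \<Rightarrow> 'a) \<Rightarrow> 'i \<Rightarrow> 'a \<Rightarrow> ('i \<times> 'a) list set" where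
  "amalg_incl I G H \<phi> i g = amalg_rel I G H \<phi> `` {[(i, g)]}"

locale amalg_data =
  fixes I :: "'i set" and G :: "'i \<Rightarrow> ('a, 'm) monoid_scheme"
    and H :: "('h, 'n) monoid_scheme" and \<phi> :: "'i \<Rightarrow> 'h \<Rightarrow> 'a"
  assumes grp: "\<And>i. i \<in> I \<Longrightarrow> group (G i)"
    and hom: "\<And>i. i \<in> I \<Longrightarrow> \<phi> i \<in> hom H (G i)"
begin

abbreviation "W \<equiv> amalg_words I G"
abbreviation "eqv \<equiv> amalg_eq I G H \<phi>"
abbreviation "R \<equiv> amalg_rel I G H \<phi>"
abbreviation "P \<equiv> amalg_product I G H \<phi>"
abbreviation "\<iota> \<equiv> amalg_incl I G H \<phi>"

lemma words_simps [simp]: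
  "[] \<in> W" "u @ v \<in> W \<longleftrightarrow> u \<in> W \<and> v \<in> W"
  "(i, g) # v \<in> W \<longleftrightarrow> i \<in> I \<and> g \<in> carrier (G i) \<and> v \<in> W"
  by (auto simp: amalg_words_def)

lemma phi_closed [simp]: "i \<in> I \<Longrightarrow> x \<in> carrier H \<Longrightarrow> \<phi> i x \<in> carrier (G i)"
  using hom by (auto simp: hom_def)

lemma amalg_eq_words:
  assumes "eqv v w"
  shows "v \<in> W \<and> w \<in> W"
  using assms
  by induction (auto intro: monoid.m_closed monoid.one_closed dest: grp group.is_monoid)

lemma amalg_eq_context:
  assumes "eqv v w" "p \<in> W" "q \<in> W"
  shows "eqv (p @ v @ q) (p @ w @ q)"
  using assms
proof (induction)
  case (refl w)
  then show ?case by (auto intro: amalg_eq.refl)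
next
  case (sym v w)
  then show ?case by (auto intro: amalg_eq.sym)
next
  case (trans u v w)
  then show ?case by (metis amalg_eq.trans)
next
  case (mult u v i g h)
  then show ?case using amalg_eq.mult[of "p @ u" I G "v @ q" i g h H \<phi>] by simp
next
  case (one u v i)
  then show ?case using amalg_eq.one[of "p @ u" I G "v @ q" i H \<phi>] by simp
next
  case (amalg u v i j x)
  then show ?case using amalg_eq.amalg[of "p @ u" I G "v @ q" i j x H \<phi>] by simp
qed

lemma amalg_eq_append:
  assumes "eqv v v'" "eqv w w'"
  shows "eqv (v @ w) (v' @ w')"
proof (rule amalg_eq.trans)
  show "eqv (v @ w) (v' @ w)"
    using amalg_eq_context[OF assms(1), of "[]" w] amalg_eq_words[OF assms(2)] by simp
  show "eqv (v' @ w) (v' @ w')"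
    using amalg_eq_context[OF assms(2), of v' "[]"] amalg_eq_words[OF assms(1)] by simp
qed

lemma equiv_R: "equiv W R"
proof (rule equivI)
  show "R \<subseteq> W \<times> W" using amalg_eq_words by (auto simp: amalg_rel_def)
  show "refl_on W R" by (auto simp: refl_on_def amalg_rel_def amalg_eq.refl)
  show "Relation.sym R" by (auto simp: sym_def amalg_rel_def intro: amalg_eq.sym)
  show "Relation.trans R" unfolding trans_def amalg_rel_def by (auto intro: amalg_eq.trans)
qed

lemma class_eq: "v \<in> W \<Longrightarrow> w \<in> W \<Longrightarrow> R `` {v} = R `` {w} \<longleftrightarrow> eqv v w"
  using eq_equiv_class_iff[OF equiv_R, of v w] by (simp add: amalg_rel_def)

lemma carrier_P: "carrier P = (\<lambda>w. R `` {w}) ` W"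
  by (auto simp: amalg_product_def quotient_def)

lemma class_closed: "w \<in> W \<Longrightarrow> R `` {w} \<in> carrier P"
  by (auto simp: carrier_P)

lemma one_P: "\<one>\<^bsub>P\<^esub> = R `` {[]}"
  by (simp add: amalg_product_def)

lemma mult_P:
  assumes "v \<in> W" "w \<in> W"
  shows "R `` {v} \<otimes>\<^bsub>P\<^esub> R `` {w} = R `` {v @ w}"
proof -
  have "(\<Union>x \<in> R `` {v}. \<Union>y \<in> R `` {w}. R `` {x @ y}) = R `` {v @ w}"
  proof (rule UN_equiv_class2[OF equiv_R equiv_R _ assms])
    show "congruent2 R R (\<lambda>x y. R `` {x @ y})"
    proof (rule congruent2I')
      fix x x' y y' assume "(x, x') \<in> R" "(y, y') \<in> R"
      then have "(x @ y, x' @ y') \<in> R"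
        using amalg_eq_append by (simp add: amalg_rel_def)
      then show "R `` {x @ y} = R `` {x' @ y'}"
        by (rule equiv_class_eq[OF equiv_R])
    qed
  qed
  then show ?thesis by (simp add: amalg_product_def)
qed

lemma group_P: "group P"
proof (rule groupI)
  fix x assume "x \<in> carrier P"
  then obtain w where w: "w \<in> W" and x: "x = R `` {w}" by (auto simp: carrier_P)
  have "\<exists>v \<in> W. eqv (v @ w) []"
    using w
  proof (induction w)
    case Nil
    then show ?case by (intro bexI[of _ "[]"]) (auto intro: amalg_eq.refl)
  next
    case (Cons l w)
    obtain i g where l: "l = (i, g)" by (cases l)
    with Cons.prems have i: "i \<in> I" and g: "g \<in> carrier (G i)" and w: "w \<in> W" by auto
    interpret Gi: group "G i" using i by (rule grp)
    obtain v where v: "v \<in> W" "eqv (v @ w) []" using Cons.IH w by auto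
    let ?g = "inv\<^bsub>G i\<^esub> g"
    have "eqv (v @ [(i, ?g), (i, g)] @ w) (v @ [(i, \<one>\<^bsub>G i\<^esub>)] @ w)"
      using amalg_eq.mult[of v I G w i ?g g H \<phi>] v w i g by simp
    moreover have "eqv (v @ [(i, \<one>\<^bsub>G i\<^esub>)] @ w) (v @ w)"
      using amalg_eq.one[of v I G w i H \<phi>] v w i by simp
    ultimately have "eqv (v @ [(i, ?g), (i, g)] @ w) []"
      using v amalg_eq.trans by metis
    then show ?case using v i g l by (intro bexI[of _ "v @ [(i, ?g)]"]) auto
  qed
  then obtain v where v: "v \<in> W" "eqv (v @ w) []" by auto
  then have "R `` {v} \<otimes>\<^bsub>P\<^esub> x = \<one>\<^bsub>P\<^esub>"
    using w by (simp add: x mult_P one_P class_eq)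
  then show "\<exists>y \<in> carrier P. y \<otimes>\<^bsub>P\<^esub> x = \<one>\<^bsub>P\<^esub>"
    using class_closed v by blast
qed (auto simp: carrier_P one_P mult_P)

lemma incl_hom:
  assumes i: "i \<in> I"
  shows "\<iota> i \<in> hom (G i) P"
proof (rule homI)
  fix g assume "g \<in> carrier (G i)"
  then show "\<iota> i g \<in> carrier P" using i by (simp add: amalg_incl_def class_closed)
next
  interpret Gi: group "G i" using i by (rule grp)
  fix g h assume gh: "g \<in> carrier (G i)" "h \<in> carrier (G i)"
  have "eqv [(i, g), (i, h)] [(i, g \<otimes>\<^bsub>G i\<^esub> h)]"
    using amalg_eq.mult[of "[]" I G "[]" i g h H \<phi>] gh i by simp
  then have "R `` {[(i, g), (i, h)]} = R `` {[(i, g \<otimes>\<^bsub>G i\<^esub> h)]}"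
    using gh i by (subst class_eq) auto
  then show "\<iota> i (g \<otimes>\<^bsub>G i\<^esub> h) = \<iota> i g \<otimes>\<^bsub>P\<^esub> \<iota> i h"
    using gh i by (simp add: amalg_incl_def mult_P)
qed

lemma incl_amalg: "i \<in> I \<Longrightarrow> j \<in> I \<Longrightarrow> x \<in> carrier H \<Longrightarrow> \<iota> i (\<phi> i x) = \<iota> j (\<phi> j x)"
  using amalg_eq.amalg[of "[]" I G "[]" i j x H \<phi>]
  by (simp add: amalg_incl_def class_eq)

lemma universal_property:
  assumes K: "group K"
    and f: "\<And>i. i \<in> I \<Longrightarrow> f i \<in> hom (G i) K"
    and ff: "\<And>i j x. i \<in> I \<Longrightarrow> j \<in> I \<Longrightarrow> x \<in> carrier H \<Longrightarrow> f i (\<phi> i x) = f j (\<phi> j x)"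
  shows "\<exists>!F. F \<in> hom P K \<inter> extensional (carrier P) \<and>
    (\<forall>i \<in> I. \<forall>g \<in> carrier (G i). F (\<iota> i g) = f i g)"
proof -
  interpret K: group K by fact
  interpret P: group P by (rule group_P)
  define ev where "ev w = foldr (\<lambda>(i, g) k. f i g \<otimes>\<^bsub>K\<^esub> k) w \<one>\<^bsub>K\<^esub>" for w
  have f_closed [simp]: "f i g \<in> carrier K" if "i \<in> I" "g \<in> carrier (G i)" for i g
    using f that by (auto simp: hom_def)
  have ev_simps [simp]: "ev [] = \<one>\<^bsub>K\<^esub>" "ev ((i, g) # w) = f i g \<otimes>\<^bsub>K\<^esub> ev w" for i g w
    by (simp_all add: ev_def)
  have ev_closed [simp]: "ev w \<in> carrier K" if "w \<in> W" for w
    using that by (induction w) auto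
  have ev_append: "ev (v @ w) = ev v \<otimes>\<^bsub>K\<^esub> ev w" if "v \<in> W" "w \<in> W" for v w
    using that by (induction v) (auto simp: K.m_assoc)
  have ev_eq: "ev v = ev w" if "eqv v w" for v w
    using that
  proof induction
    case (mult u v i g h)
    then have "f i (g \<otimes>\<^bsub>G i\<^esub> h) = f i g \<otimes>\<^bsub>K\<^esub> f i h" using f by (auto simp: hom_def)
    with mult show ?case
      by (simp add: ev_append K.m_assoc group.is_monoid[OF grp] monoid.m_closed)
  next
    case (one u v i)
    then have "f i \<one>\<^bsub>G i\<^esub> = \<one>\<^bsub>K\<^esub>" using f grp K by (metis hom_one)
    with one show ?case
      by (simp add: ev_append group.is_monoid[OF grp] monoid.one_closed)
  next
    case (amalg u v i j x)
    then show ?case using ff[of i j x] by (simp add: ev_append)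
  qed auto
  define F where "F = (\<lambda>A \<in> carrier P. ev (SOME w. w \<in> A))"
  have F: "F (R `` {w}) = ev w" if "w \<in> W" for w
  proof -
    have "w \<in> R `` {w}" using equiv_class_self[OF equiv_R that] .
    then have "(SOME v. v \<in> R `` {w}) \<in> R `` {w}" by (rule someI)
    then have "eqv w (SOME v. v \<in> R `` {w})" by (simp add: amalg_rel_def)
    then show ?thesis using ev_eq that class_closed by (simp add: F_def)
  qed
  show ?thesis
  proof (rule ex1I[of _ F])
    show "F \<in> hom P K \<inter> extensional (carrier P) \<and>
        (\<forall>i \<in> I. \<forall>g \<in> carrier (G i). F (\<iota> i g) = f i g)"
      by (auto simp: hom_def carrier_P F mult_P ev_append amalg_incl_def)
        (simp add: F_def flip: carrier_P)
  next
    fix F' assume F': "F' \<in> hom P K \<inter> extensional (carrier P) \<and>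
        (\<forall>i \<in> I. \<forall>g \<in> carrier (G i). F' (\<iota> i g) = f i g)"
    have "F' (R `` {w}) = ev w" if "w \<in> W" for w
      using that
    proof (induction w)
      case Nil
      then show ?case using F' P.is_group K hom_one[of F' P K] by (simp add: one_P)
    next
      case (Cons l w)
      obtain i g where l: "l = (i, g)" by (cases l)
      with Cons.prems have i: "i \<in> I" and g: "g \<in> carrier (G i)" and w: "w \<in> W" by auto
      have "R `` {l # w} = \<iota> i g \<otimes>\<^bsub>P\<^esub> R `` {w}"
        using i g w l by (simp add: amalg_incl_def mult_P)
      moreover have "\<iota> i g \<in> carrier P" "R `` {w} \<in> carrier P"
        using i g w by (auto simp: amalg_incl_def class_closed)
      ultimately show ?case using F' Cons.IH i g w l by (auto simp: hom_def)
    qed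
    then show "F' = F"
      using F F' by (intro extensionalityI[of _ "carrier P"]) (auto simp: F_def carrier_P)
  qed
qed

end

end

theory Submission
  imports Defs
begin

text \<open>Circular orders on a group \<open>G\<close> are left orders on central extensions of \<open>G\<close> by \<open>\<int>\<close> in which the
  central generator is positive and cofinal.  For a circular order \<open>c\<close>, the extension is the one
  given by the Euler cocycle of \<open>c\<close>, and the positive elements are the \<open>(a, n) \<noteq> (\<one>, 0)\<close> with
  \<open>0 \<le> n\<close>.  If the Euler cocycle of \<open>d\<close> is \<open>f - \<delta>u\<close>, then \<open>d\<close> becomes a left order on the extension
  given by \<open>f\<close>: take the \<open>(a, n) \<noteq> (\<one>, 0)\<close> with \<open>0 \<le> n + u a\<close> (\<open>positive_cone_lifted\<close>).  So a
  cohomologically constant family of circular orders on \<open>G i\<close> is realised by left orders on one and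
  the same extension \<open>E i\<close>, and if the family is normal then all these left orders together are
  closed under conjugation (\<open>conj_lifted_cone\<close>).  Since the \<open>c i\<close> agree on \<open>H\<close>, all extensions
  restrict to one extension of \<open>H\<close>.  Two left orders on the latter with the same circular order
  below differ by a homomorphism \<open>H \<rightarrow> \<int>\<close>; as it extends to \<open>G j\<close>, the restrictions to \<open>H\<close> of the
  families of left orders on the \<open>E i\<close> agree (\<open>lifted_families_compatible\<close>).

  This reduces the claim to left orders, where it is the theorem of Bludov and Glass: compatible
  left orders that belong to compatible, conjugation-closed families extend to the amalgam
  (\<open>amalgam_positive_cone\<close>).  The central generator stays positive and cofinal in the amalgam of the
  \<open>E i\<close>, the quotient by it is the amalgam of the \<open>G i\<close> (\<open>projection\<close>), and a left order induces
  a circular order on such a quotient (\<open>circ_order_quotient\<close>).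

  The theorem of Bludov and Glass is proved by ordering the set \<open>\<Omega>\<close> of normal forms, on which the
  amalgam acts simply transitively, so that every \<open>G i\<close> acts by order automorphisms.  Beforehand
  every point \<open>x\<close> is given a label for every \<open>i\<close>, a positive cone on \<open>G i\<close> from the family: the
  labels are equivariant and agree on \<open>H\<close>, and at the base point they are the given cones
  (\<open>tail_label\<close>).  The order is built by adding the orbits of the \<open>G i\<close> one after the other.  When a
  \<open>G j\<close>-orbit \<open>O\<close> is added, it meets the points present so far in a single \<open>H\<close>-orbit \<open>A\<close>.  Let \<open>S\<close>
  be the union of the \<open>G j\<close>-orbits present so far.  The position of \<open>g x\<close> relative to \<open>S\<close>, for \<open>x\<close>
  in \<open>A\<close>, is forced: its cut in \<open>S\<close> is the translate by \<open>g\<close> of the cut of \<open>x\<close>.  Points of \<open>O\<close> with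
  the same cut are compared by the label.  This does not change the order on \<open>A\<close> because of an
  invariant of the construction: if \<open>h\<close> in \<open>H\<close> does not change the cut of \<open>x\<close> in the set of the
  points older than \<open>x\<close>, then \<open>x\<close> and \<open>h x\<close> are ordered as the label of \<open>x\<close> says.  The orbits are
  added in an order for which \<open>S\<close> contains all points older than \<open>A\<close>, so that the invariant
  applies.  At last the new points are placed as low as possible relative to the other points
  present (\<open>glue\<close>), which is a choice that commutes with \<open>H\<close>.\<close>

section \<open>Positive cones and glued linear orders\<close>

text \<open>The order belonging to a cone \<open>Q\<close> is \<open>x < y\<close> iff the product of the inverse of \<open>x\<close> with \<open>y\<close>
  lies in \<open>Q\<close>; it is invariant under left multiplication. That no element is positive together
  with its inverse follows from the other conditions.\<close>
definition positive_cone :: "('a, 'm) monoid_scheme \<Rightarrow> 'a set \<Rightarrow> bool" where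
  "positive_cone G Q \<longleftrightarrow> Q \<subseteq> carrier G \<and> \<one>\<^bsub>G\<^esub> \<notin> Q \<and>
    (\<forall>x \<in> Q. \<forall>y \<in> Q. x \<otimes>\<^bsub>G\<^esub> y \<in> Q) \<and>
    (\<forall>x \<in> carrier G. x \<noteq> \<one>\<^bsub>G\<^esub> \<longrightarrow> x \<in> Q \<or> inv\<^bsub>G\<^esub> x \<in> Q)"

definition conj_cone :: "('a, 'm) monoid_scheme \<Rightarrow> 'a \<Rightarrow> 'a set \<Rightarrow> 'a set" where
  "conj_cone G g Q = {x \<in> carrier G. inv\<^bsub>G\<^esub> g \<otimes>\<^bsub>G\<^esub> x \<otimes>\<^bsub>G\<^esub> g \<in> Q}"

text \<open>Orders are predicates that are only looked at on a given set, so that restricting an order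
  leaves the predicate as it is.\<close>
definition linear_on :: "'p set \<Rightarrow> ('p \<Rightarrow> 'p \<Rightarrow> bool) \<Rightarrow> bool" where
  "linear_on U R \<longleftrightarrow> (\<forall>x \<in> U. \<not> R x x) \<and>
    (\<forall>x \<in> U. \<forall>y \<in> U. \<forall>z \<in> U. R x y \<longrightarrow> R y z \<longrightarrow> R x z) \<and>
    (\<forall>x \<in> U. \<forall>y \<in> U. x = y \<or> R x y \<or> R y x)"

lemma linear_on_irrefl: "linear_on U R \<Longrightarrow> x \<in> U \<Longrightarrow> \<not> R x x"
  and linear_on_trans: "linear_on U R \<Longrightarrow> x \<in> U \<Longrightarrow> y \<in> U \<Longrightarrow> z \<in> U \<Longrightarrow> R x y \<Longrightarrow> R y z \<Longrightarrow> R x z"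
  and linear_on_total: "linear_on U R \<Longrightarrow> x \<in> U \<Longrightarrow> y \<in> U \<Longrightarrow> x = y \<or> R x y \<or> R y x"
  unfolding linear_on_def by blast+

lemma linear_on_asym: "linear_on U R \<Longrightarrow> x \<in> U \<Longrightarrow> y \<in> U \<Longrightarrow> R x y \<Longrightarrow> \<not> R y x"
  using linear_on_irrefl linear_on_trans by metis

text \<open>The amalgamation of linear orders on \<open>U\<close> and \<open>Y\<close> that agree on \<open>U \<inter> Y\<close>: a point of \<open>Y - U\<close>
  is put below all points of \<open>U - Y\<close> that lie in the same cut of \<open>U \<inter> Y\<close>.\<close>
definition glue :: "'p set \<Rightarrow> ('p \<Rightarrow> 'p \<Rightarrow> bool) \<Rightarrow> 'p set \<Rightarrow> ('p \<Rightarrow> 'p \<Rightarrow> bool) \<Rightarrow> 'p \<Rightarrow> 'p \<Rightarrow> bool" where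
  "glue U R Y L x y =
    (if x \<in> U \<and> y \<in> U then R x y
     else if x \<in> Y \<and> y \<in> Y then L x y
     else if x \<in> U then \<exists>z \<in> U \<inter> Y. R x z \<and> L z y
     else \<not> (\<exists>z \<in> U \<inter> Y. R y z \<and> L z x))"

lemma glue_left: "x \<in> U \<Longrightarrow> y \<in> U \<Longrightarrow> glue U R Y L x y \<longleftrightarrow> R x y"
  by (simp add: glue_def)

lemma glue_right:
  assumes "\<And>x y. x \<in> U \<inter> Y \<Longrightarrow> y \<in> U \<inter> Y \<Longrightarrow> R x y \<longleftrightarrow> L x y" "x \<in> Y" "y \<in> Y"
  shows "glue U R Y L x y \<longleftrightarrow> L x y"
  using assms by (simp add: glue_def)

text \<open>Whenever a point of \<open>U\<close> is below a point of \<open>Y\<close>, it is so through a point of \<open>U \<inter> Y\<close>, which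
  gives transitivity for the triples that start in \<open>U\<close> and end in \<open>Y\<close>. By totality, a failure of
  transitivity is a cycle of three points, and rotating it leads back to such a triple.\<close>
lemma linear_on_glue:
  assumes R: "linear_on U R" and L: "linear_on Y L"
    and RL: "\<And>x y. x \<in> U \<inter> Y \<Longrightarrow> y \<in> U \<inter> Y \<Longrightarrow> R x y \<longleftrightarrow> L x y"
  shows "linear_on (U \<union> Y) (glue U R Y L)"
proof -
  let ?g = "glue U R Y L"
  have XX: "?g x y \<longleftrightarrow> R x y" if "x \<in> U" "y \<in> U" for x y
    using that by (rule glue_left)
  have YY: "?g x y \<longleftrightarrow> L x y" if "x \<in> Y" "y \<in> Y" for x y
    using RL that by (rule glue_right)
  have XY: "?g x y \<longleftrightarrow> (\<exists>z \<in> U \<inter> Y. R x z \<and> L z y)" if "x \<in> U - Y" "y \<in> Y - U" for x y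
    using that by (simp add: glue_def)
  have YX: "?g y x \<longleftrightarrow> \<not> ?g x y" if "x \<in> U - Y" "y \<in> Y - U" for x y
    using that by (simp add: glue_def)
  note R3 = linear_on_trans[OF R] and L3 = linear_on_trans[OF L]
  have below: "?g x y" if "x \<in> U" "m \<in> U \<inter> Y" "y \<in> Y" "?g x m" "?g m y" for x m y
  proof (cases "x \<in> Y")
    case True
    then show ?thesis using that YY L3[of x m y] by auto
  next
    case False
    then show ?thesis
      using that XX YY XY[of x y] R3[of x m y] by (cases "y \<in> U") auto
  qed
  have between: "\<exists>m \<in> U \<inter> Y. (x = m \<or> ?g x m) \<and> (m = y \<or> ?g m y)"
    if "x \<in> U" "y \<in> Y" "?g x y" for x y
    using that XY[of x y] XX YY by (cases "x \<in> Y"; cases "y \<in> U") auto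
  have tot: "x = y \<or> ?g x y \<or> ?g y x" if "x \<in> U \<union> Y" "y \<in> U \<union> Y" for x y
    using that XX YY YX[of x y] YX[of y x] linear_on_total[OF R] linear_on_total[OF L]
    by (metis DiffI UnE)
  have asym: "\<not> ?g y x" if "?g x y" "x \<in> U \<union> Y" "y \<in> U \<union> Y" for x y
    using that XX YY YX[of x y] YX[of y x] linear_on_asym[OF R] linear_on_asym[OF L]
    by (metis DiffI UnE)
  have XXY: "?g x y" if a: "x \<in> U" "x' \<in> U" "y \<in> Y" "?g x x'" "?g x' y" for x x' y
  proof -
    obtain m where m: "m \<in> U \<inter> Y" "x' = m \<or> ?g x' m" "m = y \<or> ?g m y"
      using between[OF a(2,3,5)] by blast
    then have "?g x m" using that XX R3[of x x' m] by auto
    then show ?thesis using m below[of x m y] that by blast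
  qed
  have XYY: "?g x y" if a: "x \<in> U" "y' \<in> Y" "y \<in> Y" "?g x y'" "?g y' y" for x y' y
  proof -
    obtain m where m: "m \<in> U \<inter> Y" "x = m \<or> ?g x m" "m = y' \<or> ?g m y'"
      using between[OF a(1,2,4)] by blast
    then have "?g m y" using that YY L3[of m y' y] by auto
    then show ?thesis using m below[of x m y] that by blast
  qed
  have tr: "?g x z" if a: "x \<in> U \<union> Y" "y \<in> U \<union> Y" "z \<in> U \<union> Y" "?g x y" "?g y z" for x y z
  proof (rule ccontr)
    assume n: "\<not> ?g x z"
    then have zx: "?g z x" using tot asym a by blast
    consider "x \<in> U" "y \<in> U" "z \<in> U" | "x \<in> Y" "y \<in> Y" "z \<in> Y"
      | "x \<in> U" "y \<in> U" "z \<in> Y" | "x \<in> U" "y \<in> Y" "z \<in> Y"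
      | "y \<in> U" "z \<in> U" "x \<in> Y" | "y \<in> U" "z \<in> Y" "x \<in> Y"
      | "z \<in> U" "x \<in> U" "y \<in> Y" | "z \<in> U" "x \<in> Y" "y \<in> Y"
      using a by blast
    then show False
    proof cases
      case 1
      then show False using a(4,5) n XX R3[of x y z] by simp
    next
      case 2
      then show False using a(4,5) n YY L3[of x y z] by simp
    next
      case 3
      then show False using XXY[of x y z] a n by simp
    next
      case 4
      then show False using XYY[of x y z] a n by simp
    next
      case 5
      then show False using XXY[of y z x] asym[of x y] a zx by blast
    next
      case 6
      then show False using XYY[of y z x] asym[of x y] a zx by blast
    next
      case 7
      then show False using XXY[of z x y] asym[of y z] a zx by blast
    next
      case 8
      then show False using XYY[of z x y] asym[of y z] a zx by blast
    qed
  qed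
  show ?thesis unfolding linear_on_def using tot asym tr by blast
qed

text \<open>The choice made in gluing is canonical, so it is respected by every symmetry of the data.\<close>
lemma glue_invariant:
  assumes f: "\<And>x. x \<in> U \<union> Y \<Longrightarrow> f x \<in> U \<longleftrightarrow> x \<in> U" "\<And>x. x \<in> U \<union> Y \<Longrightarrow> f x \<in> Y \<longleftrightarrow> x \<in> Y"
    and surj: "U \<inter> Y \<subseteq> f ` (U \<inter> Y)"
    and R: "\<And>x y. x \<in> U \<Longrightarrow> y \<in> U \<Longrightarrow> R (f x) (f y) \<longleftrightarrow> R x y"
    and L: "\<And>x y. x \<in> Y \<Longrightarrow> y \<in> Y \<Longrightarrow> L (f x) (f y) \<longleftrightarrow> L x y"
    and xy: "x \<in> U \<union> Y" "y \<in> U \<union> Y"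
  shows "glue U R Y L (f x) (f y) \<longleftrightarrow> glue U R Y L x y"
proof -
  have mid: "(\<exists>z \<in> U \<inter> Y. R (f x) z \<and> L z (f y)) \<longleftrightarrow> (\<exists>z \<in> U \<inter> Y. R x z \<and> L z y)"
    if "x \<in> U" "y \<in> Y" for x y
  proof
    assume "\<exists>z \<in> U \<inter> Y. R (f x) z \<and> L z (f y)"
    then obtain z where "z \<in> U \<inter> Y" "R (f x) (f z)" "L (f z) (f y)" using surj by blast
    then show "\<exists>z \<in> U \<inter> Y. R x z \<and> L z y" using R L that by blast
  next
    assume "\<exists>z \<in> U \<inter> Y. R x z \<and> L z y"
    then obtain z where "z \<in> U \<inter> Y" "R x z" "L z y" by blast
    then show "\<exists>z \<in> U \<inter> Y. R (f x) z \<and> L z (f y)"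
      using R L f that by (intro bexI[of _ "f z"]) auto
  qed
  show ?thesis
    unfolding glue_def using xy f[OF xy(1)] f[OF xy(2)] R L mid[of x y] mid[of y x] by auto
qed

lemma linear_on_cong:
  assumes "\<And>x y. x \<in> U \<Longrightarrow> y \<in> U \<Longrightarrow> R x y \<longleftrightarrow> R' x y"
  shows "linear_on U R \<longleftrightarrow> linear_on U R'"
  unfolding linear_on_def using assms by (simp cong: ball_cong)

lemma (in group) conj_cone_mult:
  assumes "g \<in> carrier G" "k \<in> carrier G"
  shows "conj_cone G (g \<otimes> k) C = conj_cone G g (conj_cone G k C)"
  using assms unfolding conj_cone_def by (auto simp: inv_mult_group m_assoc)

lemma (in group) conj_cone_one: "C \<subseteq> carrier G \<Longrightarrow> conj_cone G \<one> C = C"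
  by (auto simp: conj_cone_def)

lemma (in group) positive_cone_conj:
  assumes C: "positive_cone G C" and g: "g \<in> carrier G"
  shows "positive_cone G (conj_cone G g C)"
proof -
  have prod: "inv g \<otimes> (x \<otimes> y) \<otimes> g = (inv g \<otimes> x \<otimes> g) \<otimes> (inv g \<otimes> y \<otimes> g)"
    if "x \<in> carrier G" "y \<in> carrier G" for x y
  proof -
    have "(inv g \<otimes> x \<otimes> g) \<otimes> (inv g \<otimes> y \<otimes> g) = inv g \<otimes> x \<otimes> (g \<otimes> inv g) \<otimes> y \<otimes> g"
      using that g by (simp only: m_assoc m_closed inv_closed)
    then show ?thesis using that g by (simp add: m_assoc)
  qed
  have inverse: "inv g \<otimes> inv x \<otimes> g = inv (inv g \<otimes> x \<otimes> g)" if "x \<in> carrier G" for x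
    using that g by (simp add: inv_mult_group m_assoc)
  have one: "x = \<one>" if "x \<in> carrier G" "inv g \<otimes> x \<otimes> g = \<one>" for x
  proof -
    have "g \<otimes> (inv g \<otimes> x \<otimes> g) \<otimes> inv g = x"
      using that(1) g by (simp add: m_assoc) (simp add: m_assoc[symmetric])
    then show ?thesis using that(2) g by simp
  qed
  show ?thesis
    unfolding positive_cone_def
  proof (intro conjI ballI impI)
    show "conj_cone G g C \<subseteq> carrier G" by (auto simp: conj_cone_def)
    show "\<one> \<notin> conj_cone G g C" using C g by (simp add: conj_cone_def positive_cone_def)
    show "x \<otimes> y \<in> conj_cone G g C" if "x \<in> conj_cone G g C" "y \<in> conj_cone G g C" for x y
      using that C prod by (simp add: conj_cone_def positive_cone_def)
    show "x \<in> conj_cone G g C \<or> inv x \<in> conj_cone G g C" if "x \<in> carrier G" "x \<noteq> \<one>" for x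
    proof -
      have "inv g \<otimes> x \<otimes> g \<in> carrier G" "inv g \<otimes> x \<otimes> g \<noteq> \<one>" using that g one by auto
      then show ?thesis using C that inverse[OF that(1)]
        by (simp add: conj_cone_def positive_cone_def)
    qed
  qed
qed

section \<open>Invariant linear orders built orbit by orbit\<close>

text \<open>The points of \<open>\<Omega>\<close> are added in stages, indexed by a well-order \<open>r\<close>. Every orbit of a group
  \<open>G i\<close> has its own stage \<open>st i x\<close>, which knows the index \<open>i\<close>; at this stage all points of the
  orbit become present. The stage at which \<open>x\<close> itself is first present is \<open>b x\<close>. The hypothesis
  \<open>parent\<close> says that the points of an orbit that are present before the stage of the orbit form a
  single \<open>H\<close>-orbit, and \<open>saturated\<close> says that orbits grown at a point \<open>y\<close> come after all
  \<open>G i\<close>-orbits of points older than \<open>y\<close>.\<close>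
locale birth_tree =
  fixes I :: "'i set" and G :: "'i \<Rightarrow> ('a, 'm) monoid_scheme"
    and H :: "('h, 'n) monoid_scheme" and \<phi> :: "'i \<Rightarrow> 'h \<Rightarrow> 'a"
    and \<Omega> :: "'p set" and act :: "'i \<Rightarrow> 'a \<Rightarrow> 'p \<Rightarrow> 'p"
    and r :: "('t \<times> 't) set" and idx :: "'t \<Rightarrow> 'i"
    and st :: "'i \<Rightarrow> 'p \<Rightarrow> 't" and b :: "'p \<Rightarrow> 't"
    and lab :: "'i \<Rightarrow> 'p \<Rightarrow> 'a set"
  assumes grp: "\<And>i. i \<in> I \<Longrightarrow> group (G i)"
    and grp_H: "group H"
    and mon: "\<And>i. i \<in> I \<Longrightarrow> \<phi> i \<in> mon H (G i)"
    and act_closed: "\<And>i g x. i \<in> I \<Longrightarrow> g \<in> carrier (G i) \<Longrightarrow> x \<in> \<Omega> \<Longrightarrow> act i g x \<in> \<Omega>"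
    and act_one: "\<And>i x. i \<in> I \<Longrightarrow> x \<in> \<Omega> \<Longrightarrow> act i \<one>\<^bsub>G i\<^esub> x = x"
    and act_mult: "\<And>i g k x. i \<in> I \<Longrightarrow> g \<in> carrier (G i) \<Longrightarrow> k \<in> carrier (G i) \<Longrightarrow> x \<in> \<Omega> \<Longrightarrow>
        act i (g \<otimes>\<^bsub>G i\<^esub> k) x = act i g (act i k x)"
    and act_phi: "\<And>i j h x. i \<in> I \<Longrightarrow> j \<in> I \<Longrightarrow> h \<in> carrier H \<Longrightarrow> x \<in> \<Omega> \<Longrightarrow>
        act i (\<phi> i h) x = act j (\<phi> j h) x"
    and act_free: "\<And>i g x. i \<in> I \<Longrightarrow> g \<in> carrier (G i) \<Longrightarrow> x \<in> \<Omega> \<Longrightarrow> act i g x = x \<Longrightarrow> g = \<one>\<^bsub>G i\<^esub>"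
    and wf_r: "wf r" and trans_r: "Relation.trans r" and total_r: "total r"
    and idx_st: "\<And>i x. i \<in> I \<Longrightarrow> x \<in> \<Omega> \<Longrightarrow> idx (st i x) = i"
    and st_act: "\<And>i g x. i \<in> I \<Longrightarrow> g \<in> carrier (G i) \<Longrightarrow> x \<in> \<Omega> \<Longrightarrow> st i (act i g x) = st i x"
    and st_orbit: "\<And>i x y. i \<in> I \<Longrightarrow> x \<in> \<Omega> \<Longrightarrow> y \<in> \<Omega> \<Longrightarrow> st i x = st i y \<Longrightarrow>
        \<exists>g \<in> carrier (G i). y = act i g x"
    and birth_step: "\<And>x. x \<in> \<Omega> \<Longrightarrow> \<exists>i \<in> I. b x = st i x"
    and birth_le: "\<And>i x. i \<in> I \<Longrightarrow> x \<in> \<Omega> \<Longrightarrow> b x = st i x \<or> (b x, st i x) \<in> r"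
    and parent: "\<And>i x y. i \<in> I \<Longrightarrow> x \<in> \<Omega> \<Longrightarrow> y \<in> \<Omega> \<Longrightarrow> st i x = st i y \<Longrightarrow>
        (b x, st i x) \<in> r \<Longrightarrow> (b y, st i y) \<in> r \<Longrightarrow> \<exists>h \<in> carrier H. y = act i (\<phi> i h) x"
    and saturated: "\<And>i x y. i \<in> I \<Longrightarrow> x \<in> \<Omega> \<Longrightarrow> y \<in> \<Omega> \<Longrightarrow>
        (b y, st i y) \<in> r \<Longrightarrow> (b x, b y) \<in> r \<Longrightarrow> (st i x, st i y) \<in> r"
    and lab_cone: "\<And>i x. i \<in> I \<Longrightarrow> x \<in> \<Omega> \<Longrightarrow> positive_cone (G i) (lab i x)"
    and lab_act: "\<And>i g x. i \<in> I \<Longrightarrow> g \<in> carrier (G i) \<Longrightarrow> x \<in> \<Omega> \<Longrightarrow>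
        lab i (act i g x) = conj_cone (G i) g (lab i x)"
    and lab_phi: "\<And>i j h x. i \<in> I \<Longrightarrow> j \<in> I \<Longrightarrow> h \<in> carrier H \<Longrightarrow> x \<in> \<Omega> \<Longrightarrow>
        \<phi> i h \<in> lab i x \<longleftrightarrow> \<phi> j h \<in> lab j x"
begin

abbreviation prec (infix "\<^bold><" 50) where "t \<^bold>< s \<equiv> (t, s) \<in> r"

lemma prec_trans: "t \<^bold>< s \<Longrightarrow> s \<^bold>< u \<Longrightarrow> t \<^bold>< u"
  using trans_r by (rule transD)

lemma prec_total: "t = s \<or> t \<^bold>< s \<or> s \<^bold>< t"
  using total_r by (auto simp: total_on_def)

lemma prec_irrefl: "\<not> t \<^bold>< t"
  using wf_r by simp

lemma prec_asym: "t \<^bold>< s \<Longrightarrow> \<not> s \<^bold>< t"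
  using prec_trans prec_irrefl by blast

lemma phi_closed: "i \<in> I \<Longrightarrow> h \<in> carrier H \<Longrightarrow> \<phi> i h \<in> carrier (G i)"
  using mon by (auto simp: mon_def hom_def)

lemma inv_closed: "i \<in> I \<Longrightarrow> g \<in> carrier (G i) \<Longrightarrow> inv\<^bsub>G i\<^esub> g \<in> carrier (G i)"
  using grp by (simp add: group.inv_closed)

lemma act_inv:
  assumes "i \<in> I" "g \<in> carrier (G i)" "x \<in> \<Omega>"
  shows "act i (inv\<^bsub>G i\<^esub> g) (act i g x) = x" "act i g (act i (inv\<^bsub>G i\<^esub> g) x) = x"
  using assms grp act_one
  by (simp_all add: group.l_inv group.r_inv group.inv_closed flip: act_mult)

lemma act_cancel:
  assumes "i \<in> I" "g \<in> carrier (G i)" "k \<in> carrier (G i)" "x \<in> \<Omega>" "act i g x = act i k x"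
  shows "g = k"
proof -
  interpret group "G i" using assms by (simp add: grp)
  have "act i (inv\<^bsub>G i\<^esub> k \<otimes>\<^bsub>G i\<^esub> g) x = x"
    using assms by (simp add: act_mult act_inv)
  then have "inv\<^bsub>G i\<^esub> k \<otimes>\<^bsub>G i\<^esub> g = \<one>\<^bsub>G i\<^esub>"
    using assms by (intro act_free[of i _ x]) auto
  then show ?thesis using assms inv_equality inv_inv by (metis inv_closed)
qed

definition latest where "latest x y = (if b x \<^bold>< b y then b y else b x)"

definition earlier where "earlier t = {x \<in> \<Omega>. b x \<^bold>< t}"
definition born_by where "born_by t = {x \<in> \<Omega>. b x = t \<or> b x \<^bold>< t}"
definition completed where "completed t = {x \<in> \<Omega>. st (idx t) x \<^bold>< t}"
definition current where "current t = {x \<in> \<Omega>. st (idx t) x = t}"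

text \<open>The cut of a point \<open>x\<close> of the current orbit in the set of completed orbits, read off at a
  translate \<open>g x\<close> that is already present. If no translate is present, then all cuts are empty,
  which is as good as any equivariant choice.\<close>
definition cut :: "'t \<Rightarrow> ('p \<Rightarrow> 'p \<Rightarrow> bool) \<Rightarrow> 'p \<Rightarrow> 'p set" where
  "cut t R x = {z \<in> completed t. \<exists>g \<in> carrier (G (idx t)). b (act (idx t) g x) \<^bold>< t \<and>
     R (act (idx t) g z) (act (idx t) g x)}"

definition current_less :: "'t \<Rightarrow> ('p \<Rightarrow> 'p \<Rightarrow> bool) \<Rightarrow> 'p \<Rightarrow> 'p \<Rightarrow> bool" where
  "current_less t R x y =
    (if x \<in> current t
     then if y \<in> current t
       then cut t R x \<subset> cut t R y \<or>
         cut t R x = cut t R y \<and> y \<in> (\<lambda>g. act (idx t) g x) ` lab (idx t) x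
       else y \<notin> cut t R x
     else if y \<in> current t then x \<in> cut t R y else R x y)"

text \<open>The order after stage \<open>t\<close>, as a function of the order \<open>R\<close> on the points born before \<open>t\<close>.\<close>
definition step_less :: "'t \<Rightarrow> ('p \<Rightarrow> 'p \<Rightarrow> bool) \<Rightarrow> 'p \<Rightarrow> 'p \<Rightarrow> bool" where
  "step_less t R = glue (earlier t) R (completed t \<union> current t) (current_less t R)"

text \<open>Two points are compared as in \<open>step_less\<close> at the stage at which the later one of them is
  born, so the recursion is on this stage. A single relation arises in this way, and the orders at
  the various stages are its restrictions and extend each other by construction.\<close>
definition less :: "'p \<Rightarrow> 'p \<Rightarrow> bool" where
  "less x y = wfrec (inv_image r (\<lambda>(x, y). latest x y))
     (\<lambda>f (x, y). step_less (latest x y) (\<lambda>u v. latest u v \<^bold>< latest x y \<and> f (u, v)) x y) (x, y)"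

lemma less_unfold:
  "less x y \<longleftrightarrow> step_less (latest x y) (\<lambda>u v. latest u v \<^bold>< latest x y \<and> less u v) x y"
proof -
  let ?R = "inv_image r (\<lambda>(x, y). latest x y)"
  have "wf ?R" using wf_r by (rule wf_inv_image)
  have c: "(latest u v \<^bold>< latest x y \<and> cut_less (u, v)) \<longleftrightarrow>
      (latest u v \<^bold>< latest x y \<and> f (u, v))" if "cut_less = Wfrec.cut f ?R (x, y)" for cut_less f u v
    using that by (auto simp: Wfrec.cut_def)
  show ?thesis
    unfolding less_def by (subst wfrec[OF \<open>wf ?R\<close>]) (simp only: split c)
qed

lemma completed_earlier: "idx t \<in> I \<Longrightarrow> completed t \<subseteq> earlier t"
proof
  fix x assume "idx t \<in> I" "x \<in> completed t"
  then have "x \<in> \<Omega>" "st (idx t) x \<^bold>< t" "b x = st (idx t) x \<or> b x \<^bold>< st (idx t) x"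
    using birth_le by (auto simp: completed_def)
  then show "x \<in> earlier t" using prec_trans[of "b x" "st (idx t) x" t] by (auto simp: earlier_def)
qed

lemma act_completed: "idx t \<in> I \<Longrightarrow> g \<in> carrier (G (idx t)) \<Longrightarrow> x \<in> completed t \<Longrightarrow> act (idx t) g x \<in> completed t"
  and act_current: "idx t \<in> I \<Longrightarrow> g \<in> carrier (G (idx t)) \<Longrightarrow> x \<in> current t \<Longrightarrow> act (idx t) g x \<in> current t"
  by (simp_all add: completed_def current_def act_closed st_act)

lemma completed_current_disjoint: "x \<in> completed t \<Longrightarrow> x \<notin> current t"
  using prec_irrefl by (auto simp: completed_def current_def)

lemma born_by_eq:
  assumes "idx t \<in> I"
  shows "born_by t = earlier t \<union> (completed t \<union> current t)"
proof -
  have "x \<in> current t" if x: "x \<in> \<Omega>" "b x = t" for x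
  proof -
    obtain i where "i \<in> I" "t = st i x" using birth_step x by blast
    then show ?thesis using idx_st x by (auto simp: current_def)
  qed
  moreover have "x \<in> born_by t" if "x \<in> current t" for x
    using that birth_le[OF assms, of x] by (auto simp: current_def born_by_def)
  ultimately show ?thesis using completed_earlier[OF assms] by (auto simp: born_by_def earlier_def)
qed

lemma cut_cong:
  assumes "idx t \<in> I" "x \<in> \<Omega>" "\<And>u v. u \<in> earlier t \<Longrightarrow> v \<in> earlier t \<Longrightarrow> R u v = R' u v"
  shows "cut t R x = cut t R' x"
  unfolding cut_def
proof (intro Collect_cong conj_cong bex_cong refl)
  fix z g
  assume a: "z \<in> completed t" "g \<in> carrier (G (idx t))" "b (act (idx t) g x) \<^bold>< t"
  show "R (act (idx t) g z) (act (idx t) g x) = R' (act (idx t) g z) (act (idx t) g x)"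
  proof (rule assms(3))
    show "act (idx t) g z \<in> earlier t" using act_completed[OF assms(1) a(2,1)] completed_earlier[OF assms(1)] by blast
    show "act (idx t) g x \<in> earlier t" using act_closed[OF assms(1) a(2) assms(2)] a(3)
      by (simp add: earlier_def)
  qed
qed simp_all

lemma step_less_cong:
  assumes t: "idx t \<in> I" and xy: "x \<in> born_by t" "y \<in> born_by t"
    and R: "\<And>u v. u \<in> earlier t \<Longrightarrow> v \<in> earlier t \<Longrightarrow> R u v = R' u v"
  shows "step_less t R x y = step_less t R' x y"
proof -
  have c: "cut t R u = cut t R' u" if "u \<in> current t" for u
    using that cut_cong[OF t _ R] by (simp add: current_def)
  have L: "current_less t R u v = current_less t R' u v" if "u \<in> completed t \<union> current t" "v \<in> completed t \<union> current t" for u v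
  proof (cases "u \<in> current t \<or> v \<in> current t")
    case True
    then show ?thesis using c by (auto simp: current_less_def)
  next
    case False
    then show ?thesis using R[of u v] that completed_earlier[OF t] by (auto simp: current_less_def)
  qed
  show ?thesis
    unfolding step_less_def glue_def
    using R L xy unfolding born_by_eq[OF t] by (auto cong: if_cong)
qed

lemma latest_earlier: "u \<in> earlier t \<Longrightarrow> v \<in> earlier t \<Longrightarrow> latest u v \<^bold>< t"
  by (simp add: latest_def earlier_def)

lemma less_step:
  assumes t: "idx t \<in> I" and x: "x \<in> born_by t" and y: "y \<in> born_by t"
  shows "less x y \<longleftrightarrow> step_less t less x y"
proof (cases "x \<in> earlier t \<and> y \<in> earlier t")
  case True
  then show ?thesis by (simp add: step_less_def glue_left)
next
  case False
  then have l: "latest x y = t"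
    using x y prec_asym prec_irrefl by (auto simp: born_by_def earlier_def latest_def)
  show ?thesis
    unfolding less_unfold[of x y] l
    by (rule step_less_cong[OF t x y]) (simp add: latest_earlier)
qed

text \<open>The invariant of the construction. Its last part is the condition that lets labels and
  orders agree when an orbit is added later at \<open>x\<close>.\<close>
definition good :: "'p set \<Rightarrow> bool" where
  "good U \<longleftrightarrow> linear_on U less \<and>
    (\<forall>i \<in> I. \<forall>g \<in> carrier (G i). \<forall>x \<in> U. \<forall>y \<in> U. act i g x \<in> U \<longrightarrow> act i g y \<in> U \<longrightarrow>
       less x y \<longrightarrow> less (act i g x) (act i g y)) \<and>
    (\<forall>i \<in> I. \<forall>h \<in> carrier H. \<forall>x \<in> U.
       (\<forall>z \<in> earlier (b x). less z x \<longleftrightarrow> less z (act i (\<phi> i h) x)) \<longrightarrow>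
       (less x (act i (\<phi> i h) x) \<longleftrightarrow> \<phi> i h \<in> lab i x))"

lemma good_linear: "good U \<Longrightarrow> linear_on U less"
  by (simp add: good_def)

lemma good_act:
  assumes "good U" "i \<in> I" "g \<in> carrier (G i)" "x \<in> U" "y \<in> U" "act i g x \<in> U" "act i g y \<in> U"
    "U \<subseteq> \<Omega>"
  shows "less (act i g x) (act i g y) \<longleftrightarrow> less x y"
proof
  assume "less x y"
  then show "less (act i g x) (act i g y)" using assms unfolding good_def by blast
next
  assume l: "less (act i g x) (act i g y)"
  have x: "act i (inv\<^bsub>G i\<^esub> g) (act i g x) = x" and y: "act i (inv\<^bsub>G i\<^esub> g) (act i g y) = y"
    using assms act_inv by blast+
  have "less (act i (inv\<^bsub>G i\<^esub> g) (act i g x)) (act i (inv\<^bsub>G i\<^esub> g) (act i g y))"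
    using assms(1) l inv_closed[OF assms(2,3)] assms(2,4-7) x y unfolding good_def by metis
  then show "less x y" using x y by simp
qed

lemma good_label:
  assumes "good U" "i \<in> I" "h \<in> carrier H" "x \<in> U"
    "\<And>z. z \<in> earlier (b x) \<Longrightarrow> less z x \<longleftrightarrow> less z (act i (\<phi> i h) x)"
  shows "less x (act i (\<phi> i h) x) \<longleftrightarrow> \<phi> i h \<in> lab i x"
  using assms unfolding good_def by blast

text \<open>Each part of the invariant concerns at most four points of \<open>U\<close>, so it passes to directed
  unions.\<close>
lemma good_directed:
  assumes "\<And>F. finite F \<Longrightarrow> F \<noteq> {} \<Longrightarrow> F \<subseteq> U \<Longrightarrow> \<exists>s. F \<subseteq> born_by s \<and> good (born_by s)"
  shows "good U"
  unfolding good_def linear_on_def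
proof (intro conjI ballI impI)
  fix x assume x: "x \<in> U"
  obtain s where "{x} \<subseteq> born_by s \<and> good (born_by s)" using assms[of "{x}"] x by auto
  then show "\<not> less x x" using linear_on_irrefl[OF good_linear, of _ x] by auto
next
  fix x y z assume "x \<in> U" "y \<in> U" "z \<in> U" and l: "less x y" "less y z"
  then obtain s where "{x, y, z} \<subseteq> born_by s \<and> good (born_by s)" using assms[of "{x, y, z}"] by auto
  then show "less x z" using linear_on_trans[OF good_linear, of _ x y z] l by auto
next
  fix x y assume "x \<in> U" "y \<in> U"
  then obtain s where "{x, y} \<subseteq> born_by s \<and> good (born_by s)" using assms[of "{x, y}"] by auto
  then show "x = y \<or> less x y \<or> less y x" using linear_on_total[OF good_linear, of _ x y] by auto
next
  fix i g x y
  assume a: "i \<in> I" "g \<in> carrier (G i)" "x \<in> U" "y \<in> U" "act i g x \<in> U" "act i g y \<in> U" "less x y"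
  then obtain s where "{x, y, act i g x, act i g y} \<subseteq> born_by s \<and> good (born_by s)"
    using assms[of "{x, y, act i g x, act i g y}"] by auto
  then show "less (act i g x) (act i g y)" using good_act[of "born_by s" i g x y] a
    by (auto simp: born_by_def)
next
  fix i h x
  assume a: "i \<in> I" "h \<in> carrier H" "x \<in> U"
    "\<forall>z \<in> earlier (b x). less z x \<longleftrightarrow> less z (act i (\<phi> i h) x)"
  obtain s where "{x} \<subseteq> born_by s \<and> good (born_by s)" using assms[of "{x}"] a by auto
  then show "less x (act i (\<phi> i h) x) \<longleftrightarrow> \<phi> i h \<in> lab i x"
    using good_label[of "born_by s" i h x] a by blast
qed

lemma finite_born_before:
  assumes "finite F" "F \<noteq> {}" "F \<subseteq> \<Omega>"
  shows "\<exists>x \<in> F. F \<subseteq> born_by (b x)"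
  using assms
proof (induction F rule: finite_ne_induct)
  case (singleton x)
  then show ?case by (simp add: born_by_def)
next
  case (insert x F)
  then obtain y where y: "y \<in> F" "F \<subseteq> born_by (b y)" by auto
  show ?case
  proof (cases "b y \<^bold>< b x")
    case True
    have "born_by (b y) \<subseteq> born_by (b x)"
      using True prec_trans[OF _ True] by (auto simp: born_by_def)
    moreover have "x \<in> born_by (b x)" using insert.prems by (simp add: born_by_def)
    ultimately show ?thesis using y by blast
  next
    case False
    then have "insert x F \<subseteq> born_by (b y)"
      using y insert.prems prec_total[of "b x" "b y"] by (auto simp: born_by_def)
    then show ?thesis using y by blast
  qed
qed

end

locale birth_tree_step = birth_tree +
  fixes t
  assumes t: "idx t \<in> I" and good_earlier: "good (earlier t)"
begin

abbreviation "A \<equiv> act (idx t)"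
abbreviation "K \<equiv> carrier (G (idx t))"
abbreviation "D \<equiv> cut t less"

lemma earlier_\<Omega>: "earlier t \<subseteq> \<Omega>" and completed_\<Omega>: "completed t \<subseteq> \<Omega>" and current_\<Omega>: "current t \<subseteq> \<Omega>"
  by (auto simp: earlier_def completed_def current_def)

lemma less_linear_earlier: "linear_on (earlier t) less"
  by (rule good_linear) (rule good_earlier)

lemma less_act_earlier:
  "i \<in> I \<Longrightarrow> g \<in> carrier (G i) \<Longrightarrow> x \<in> earlier t \<Longrightarrow> y \<in> earlier t \<Longrightarrow> act i g x \<in> earlier t \<Longrightarrow>
    act i g y \<in> earlier t \<Longrightarrow> less (act i g x) (act i g y) \<longleftrightarrow> less x y"
  using good_act[OF good_earlier] earlier_\<Omega> by blast

text \<open>The existential quantifier in the definition of the cut makes equivariance a substitution.\<close>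
lemma cut_act:
  assumes k: "k \<in> K" and x: "x \<in> \<Omega>" and z: "z \<in> completed t"
  shows "A k z \<in> D (A k x) \<longleftrightarrow> z \<in> D x"
proof -
  interpret Gj: group "G (idx t)" using t by (rule grp)
  have z\<Omega>: "z \<in> \<Omega>" using z completed_\<Omega> by blast
  have "(\<exists>g \<in> K. b (A g (A k x)) \<^bold>< t \<and> less (A g (A k z)) (A g (A k x))) \<longleftrightarrow>
      (\<exists>g \<in> K. b (A g x) \<^bold>< t \<and> less (A g z) (A g x))" (is "?L \<longleftrightarrow> ?R")
  proof
    assume ?L
    then obtain g where "g \<in> K" "b (A g (A k x)) \<^bold>< t" "less (A g (A k z)) (A g (A k x))" by blast
    then show ?R using k t x z\<Omega> by (intro bexI[of _ "g \<otimes>\<^bsub>G (idx t)\<^esub> k"]) (auto simp: act_mult)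
  next
    assume ?R
    then obtain g where g: "g \<in> K" "b (A g x) \<^bold>< t" "less (A g z) (A g x)" by blast
    have "A (g \<otimes>\<^bsub>G (idx t)\<^esub> inv\<^bsub>G (idx t)\<^esub> k) (A k u) = A g u" if "u \<in> \<Omega>" for u
      using that k g t by (simp add: act_mult act_inv act_closed)
    then show ?L using g k t x z\<Omega>
      by (intro bexI[of _ "g \<otimes>\<^bsub>G (idx t)\<^esub> inv\<^bsub>G (idx t)\<^esub> k"]) auto
  qed
  then show ?thesis using act_completed[OF t k z] z by (simp add: cut_def)
qed

lemma cut_completed: "D x \<subseteq> completed t"
  by (auto simp: cut_def)

lemma cut_act_mono:
  assumes k: "k \<in> K" and xy: "x \<in> \<Omega>" "y \<in> \<Omega>"
  shows "D (A k x) \<subseteq> D (A k y) \<longleftrightarrow> D x \<subseteq> D y"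
proof
  assume "D (A k x) \<subseteq> D (A k y)"
  then show "D x \<subseteq> D y" using cut_act[OF k] xy cut_completed by blast
next
  assume s: "D x \<subseteq> D y"
  show "D (A k x) \<subseteq> D (A k y)"
  proof
    fix z assume z: "z \<in> D (A k x)"
    let ?z = "A (inv\<^bsub>G (idx t)\<^esub> k) z"
    have zs: "z \<in> completed t" using z cut_completed by blast
    have z's: "?z \<in> completed t" using act_completed[OF t inv_closed[OF t k] zs] .
    have e: "A k ?z = z" using act_inv(2)[OF t k] zs completed_\<Omega> by blast
    have "?z \<in> D y" using cut_act[OF k xy(1) z's] z s e by auto
    then show "z \<in> D (A k y)" using cut_act[OF k xy(2) z's] e by simp
  qed
qed

lemma cut_initial:
  assumes x: "x \<in> \<Omega>" and z: "z \<in> D x" and w: "w \<in> completed t" "less w z"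
  shows "w \<in> D x"
proof -
  obtain g where g: "g \<in> K" "b (A g x) \<^bold>< t" "less (A g z) (A g x)" and zs: "z \<in> completed t"
    using z by (auto simp: cut_def)
  have ol: "A g w \<in> earlier t" "A g z \<in> earlier t" "w \<in> earlier t" "z \<in> earlier t" "A g x \<in> earlier t"
    using act_completed[OF t g(1)] completed_earlier[OF t] w zs g x t act_closed by (auto simp: earlier_def)
  then have "less (A g w) (A g z)" using less_act_earlier[OF t g(1)] w(2) by blast
  then have "less (A g w) (A g x)" using linear_on_trans[OF less_linear_earlier] ol g(3) by blast
  then show ?thesis using w g by (auto simp: cut_def)
qed

lemma cut_chain:
  assumes "x \<in> \<Omega>" "y \<in> \<Omega>"
  shows "D x \<subseteq> D y \<or> D y \<subseteq> D x"
proof (rule ccontr)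
  assume "\<not> ?thesis"
  then obtain z w where z: "z \<in> D x" "z \<notin> D y" and w: "w \<in> D y" "w \<notin> D x" by blast
  then have zs: "z \<in> completed t" and ws: "w \<in> completed t" using cut_completed by blast+
  then have "z = w \<or> less z w \<or> less w z"
    using linear_on_total[OF less_linear_earlier, of z w] completed_earlier[OF t] by blast
  then show False
    using z w cut_initial[OF assms(1) z(1) ws] cut_initial[OF assms(2) w(1) zs] by auto
qed

lemma cut_old:
  assumes y: "y \<in> current t" "y \<in> earlier t" and z: "z \<in> completed t"
  shows "z \<in> D y \<longleftrightarrow> less z y"
proof
  assume "less z y"
  then show "z \<in> D y"
    using y z t act_one completed_\<Omega> group.is_monoid[OF grp[OF t]]
    by (auto simp: cut_def earlier_def intro!: bexI[of _ "\<one>\<^bsub>G (idx t)\<^esub>"] monoid.one_closed)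
next
  assume "z \<in> D y"
  then obtain g where g: "g \<in> K" "b (A g y) \<^bold>< t" "less (A g z) (A g y)"
    by (auto simp: cut_def)
  have "A g y \<in> earlier t" "A g z \<in> earlier t" "z \<in> earlier t"
    using g y t z act_closed completed_earlier[OF t] act_completed[OF t g(1) z] by (auto simp: earlier_def)
  then show "less z y" using less_act_earlier[OF t g(1), of z y] y g by blast
qed

text \<open>Points with equal cuts are linearly ordered since the label at \<open>g x\<close> is the conjugate by \<open>g\<close>
  of the label at \<open>x\<close>; with a completed orbit involved, the claim is that cuts are initial
  segments.\<close>
lemma current_less_linear: "linear_on (completed t \<union> current t) (current_less t less)"
proof -
  let ?L = "current_less t less"
  let ?j = "idx t"
  interpret Gj: group "G ?j" using t by (rule grp)
  have cone: "positive_cone (G ?j) (lab ?j x)" if "x \<in> current t" for x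
    using that lab_cone t by (simp add: current_def)
  have SS: "?L x y \<longleftrightarrow> less x y" if "x \<in> completed t" "y \<in> completed t" for x y
    using that completed_current_disjoint by (simp add: current_less_def)
  have SO: "?L x y \<longleftrightarrow> x \<in> D y" and OS: "?L y x \<longleftrightarrow> x \<notin> D y" if "x \<in> completed t" "y \<in> current t" for x y
    using that completed_current_disjoint by (simp_all add: current_less_def)
  have OO: "?L x y \<longleftrightarrow> D x \<subset> D y \<or> D x = D y \<and> y \<in> (\<lambda>g. A g x) ` lab ?j x"
    if "x \<in> current t" "y \<in> current t" for x y
    using that by (simp add: current_less_def)
  have lab_trans: "z \<in> (\<lambda>g. A g x) ` lab ?j x"
    if x: "x \<in> current t" and y: "y \<in> (\<lambda>g. A g x) ` lab ?j x" and z: "z \<in> (\<lambda>g. A g y) ` lab ?j y"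
    for x y z
  proof -
    obtain g where g: "g \<in> lab ?j x" "y = A g x" using y by blast
    obtain k where k: "k \<in> lab ?j y" "z = A k y" using z by blast
    have x\<Omega>: "x \<in> \<Omega>" using x current_\<Omega> by blast
    have gK: "g \<in> K" using g cone[OF x] by (auto simp: positive_cone_def)
    have "k \<in> conj_cone (G ?j) g (lab ?j x)" using k g lab_act[OF t gK x\<Omega>] by simp
    then have kK: "k \<in> K" and c: "inv\<^bsub>G ?j\<^esub> g \<otimes>\<^bsub>G ?j\<^esub> k \<otimes>\<^bsub>G ?j\<^esub> g \<in> lab ?j x"
      by (auto simp: conj_cone_def)
    have "g \<otimes>\<^bsub>G ?j\<^esub> (inv\<^bsub>G ?j\<^esub> g \<otimes>\<^bsub>G ?j\<^esub> k \<otimes>\<^bsub>G ?j\<^esub> g) \<in> lab ?j x"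
      using cone[OF x] g c by (auto simp: positive_cone_def)
    moreover have "g \<otimes>\<^bsub>G ?j\<^esub> (inv\<^bsub>G ?j\<^esub> g \<otimes>\<^bsub>G ?j\<^esub> k \<otimes>\<^bsub>G ?j\<^esub> g) = k \<otimes>\<^bsub>G ?j\<^esub> g"
      using gK kK by (simp add: Gj.m_assoc[symmetric])
    ultimately have "k \<otimes>\<^bsub>G ?j\<^esub> g \<in> lab ?j x" by simp
    moreover have "z = A (k \<otimes>\<^bsub>G ?j\<^esub> g) x" using k g gK kK x\<Omega> t by (simp add: act_mult)
    ultimately show ?thesis by blast
  qed
  have lab_irrefl: "x \<notin> (\<lambda>g. A g x) ` lab ?j x" if x: "x \<in> current t" for x
  proof
    assume "x \<in> (\<lambda>g. A g x) ` lab ?j x"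
    then obtain g where g: "g \<in> lab ?j x" "x = A g x" by blast
    moreover have "g \<in> K" using g cone[OF x] by (auto simp: positive_cone_def)
    ultimately have "g = \<one>\<^bsub>G ?j\<^esub>" using act_free[OF t, of g x] x current_\<Omega> by auto
    then show False using cone[OF x] g by (simp add: positive_cone_def)
  qed
  have lab_total: "x = y \<or> y \<in> (\<lambda>g. A g x) ` lab ?j x \<or> x \<in> (\<lambda>g. A g y) ` lab ?j y"
    if x: "x \<in> current t" and y: "y \<in> current t" for x y
  proof -
    have x\<Omega>: "x \<in> \<Omega>" and y\<Omega>: "y \<in> \<Omega>" using x y current_\<Omega> by blast+
    obtain g where g: "g \<in> K" "y = A g x"
      using st_orbit[OF t x\<Omega> y\<Omega>] x y by (auto simp: current_def)
    consider "g = \<one>\<^bsub>G ?j\<^esub>" | "g \<in> lab ?j x" | "inv\<^bsub>G ?j\<^esub> g \<in> lab ?j x"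
      using cone[OF x] g by (auto simp: positive_cone_def)
    then show ?thesis
    proof cases
      case 1
      then show ?thesis using g act_one t x\<Omega> by simp
    next
      case 2
      then show ?thesis using g by blast
    next
      case 3
      then have "inv\<^bsub>G ?j\<^esub> g \<in> lab ?j y"
        using g lab_act[OF t g(1) x\<Omega>] by (simp add: conj_cone_def Gj.m_assoc)
      moreover have "x = A (inv\<^bsub>G ?j\<^esub> g) y" using g act_inv t x\<Omega> by simp
      ultimately show ?thesis by blast
    qed
  qed
  have S_irr: "\<not> less x x" if "x \<in> completed t" for x
    using that completed_earlier[OF t] linear_on_irrefl[OF less_linear_earlier] by blast
  have S_tot: "x = y \<or> less x y \<or> less y x" if "x \<in> completed t" "y \<in> completed t" for x y
    using that completed_earlier[OF t] linear_on_total[OF less_linear_earlier] by blast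
  have S_trans: "less x z" if "x \<in> completed t" "y \<in> completed t" "z \<in> completed t" "less x y" "less y z" for x y z
    using that completed_earlier[OF t] linear_on_trans[OF less_linear_earlier, of x y z] by blast
  have init: "w \<in> D x" if "x \<in> current t" "z \<in> D x" "w \<in> completed t" "less w z" for w x z
    using that cut_initial current_\<Omega> by blast
  have chain: "D x \<subseteq> D y \<or> D y \<subseteq> D x" if "x \<in> current t" "y \<in> current t" for x y
    using that cut_chain current_\<Omega> by blast
  show ?thesis
    unfolding linear_on_def
  proof (intro conjI ballI impI)
    fix x assume "x \<in> completed t \<union> current t"
    then show "\<not> ?L x x" using SS OO S_irr lab_irrefl by blast
  next
    fix x y assume "x \<in> completed t \<union> current t" "y \<in> completed t \<union> current t"
    then consider "x \<in> completed t" "y \<in> completed t" | "x \<in> completed t" "y \<in> current t" | "x \<in> current t" "y \<in> completed t"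
      | "x \<in> current t" "y \<in> current t" by blast
    then show "x = y \<or> ?L x y \<or> ?L y x"
    proof cases
      case 1
      then show ?thesis using SS[of x y] SS[of y x] S_tot[of x y] by simp
    next
      case 2
      then show ?thesis using SO[of x y] OS[of x y] by simp
    next
      case 3
      then show ?thesis using SO[of y x] OS[of y x] by simp
    next
      case 4
      then show ?thesis
        using OO[of x y] OO[of y x] chain[of x y] lab_total[of x y] by blast
    qed
  next
    fix x y z
    assume m: "x \<in> completed t \<union> current t" "y \<in> completed t \<union> current t" "z \<in> completed t \<union> current t"
      and xy: "?L x y" and yz: "?L y z"
    show "?L x z"
    proof (cases "x \<in> current t"; cases "y \<in> current t"; cases "z \<in> current t")
      assume o: "x \<in> current t" "y \<in> current t" "z \<in> current t"
      show ?thesis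
        using xy yz lab_trans[OF o(1), of y z]
        unfolding OO[OF o(1,2)] OO[OF o(2,3)] OO[OF o(1,3)] by blast
    next
      assume o: "x \<in> current t" "y \<in> current t" "z \<notin> current t"
      then have z: "z \<in> completed t" using m by blast
      show ?thesis using xy yz unfolding OO[OF o(1,2)] OS[OF z o(2)] OS[OF z o(1)] by blast
    next
      assume o: "x \<in> current t" "y \<notin> current t" "z \<in> current t"
      then have y: "y \<in> completed t" using m by blast
      show ?thesis
        using xy yz chain[OF o(1,3)] unfolding OS[OF y o(1)] SO[OF y o(3)] OO[OF o(1,3)] by blast
    next
      assume o: "x \<in> current t" "y \<notin> current t" "z \<notin> current t"
      then have y: "y \<in> completed t" and z: "z \<in> completed t" using m by blast+
      show ?thesis
        using xy yz init[OF o(1) _ y, of z] unfolding OS[OF y o(1)] OS[OF z o(1)] SS[OF y z] by blast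
    next
      assume o: "x \<notin> current t" "y \<in> current t" "z \<in> current t"
      then have x: "x \<in> completed t" using m by blast
      show ?thesis using xy yz unfolding SO[OF x o(2)] SO[OF x o(3)] OO[OF o(2,3)] by blast
    next
      assume o: "x \<notin> current t" "y \<in> current t" "z \<notin> current t"
      then have x: "x \<in> completed t" and z: "z \<in> completed t" using m by blast+
      show ?thesis
        using xy yz S_tot[OF x z] init[OF o(2) _ z, of x]
        unfolding SO[OF x o(2)] OS[OF z o(2)] SS[OF x z] by blast
    next
      assume o: "x \<notin> current t" "y \<notin> current t" "z \<in> current t"
      then have x: "x \<in> completed t" and y: "y \<in> completed t" using m by blast+
      show ?thesis
        using xy yz init[OF o(3) _ x, of y] unfolding SO[OF x o(3)] SO[OF y o(3)] SS[OF x y] by blast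
    next
      assume o: "x \<notin> current t" "y \<notin> current t" "z \<notin> current t"
      then have x: "x \<in> completed t" and y: "y \<in> completed t" and z: "z \<in> completed t" using m by blast+
      show ?thesis using xy yz S_trans[OF x y z] unfolding SS[OF x y] SS[OF y z] SS[OF x z] by blast
    qed
  qed
qed

end

context birth_tree
begin

text \<open>The stage at which \<open>x\<close> is born is the stage of one of its orbits, and this orbit contains
  \<open>h x\<close>.\<close>
lemma birth_phi:
  assumes "i \<in> I" "h \<in> carrier H" "x \<in> \<Omega>"
  shows "b (act i (\<phi> i h) x) = b x"
proof -
  have *: "b (act i (\<phi> i h) x) = b x \<or> b (act i (\<phi> i h) x) \<^bold>< b x"
    if x: "x \<in> \<Omega>" and h: "h \<in> carrier H" for h x
  proof -
    obtain j where j: "j \<in> I" "b x = st j x" using birth_step x by blast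
    have y: "act i (\<phi> i h) x = act j (\<phi> j h) x" using act_phi assms(1) j h x by blast
    have "st j (act j (\<phi> j h) x) = b x" using st_act j phi_closed h x by simp
    then show ?thesis using birth_le[OF j(1), of "act j (\<phi> j h) x"] act_closed j phi_closed h x y
      by metis
  qed
  interpret group_hom H "G i" "\<phi> i"
    using grp grp_H mon assms(1) by (auto simp: group_hom_def group_hom_axioms_def mon_def)
  let ?y = "act i (\<phi> i h) x"
  have y: "?y \<in> \<Omega>" using assms act_closed phi_closed by blast
  have "act i (\<phi> i (inv\<^bsub>H\<^esub> h)) ?y = x"
    using assms act_inv phi_closed by simp
  then show ?thesis using *[OF assms(3,2)] *[OF y, of "inv\<^bsub>H\<^esub> h"] assms(2) prec_asym by auto
qed

end

context birth_tree_step
begin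

lemma current_less_act:
  assumes k: "k \<in> K" and x: "x \<in> completed t \<union> current t" and y: "y \<in> completed t \<union> current t"
  shows "current_less t less (A k x) (A k y) \<longleftrightarrow> current_less t less x y"
proof -
  let ?j = "idx t"
  interpret Gj: group "G ?j" using t by (rule grp)
  have O: "A k u \<in> current t \<longleftrightarrow> u \<in> current t" if "u \<in> completed t \<union> current t" for u
    using that act_current[OF t k] act_completed[OF t k] completed_current_disjoint by blast
  have \<Omega>: "u \<in> \<Omega>" if "u \<in> completed t \<union> current t" for u
    using that by (auto simp: completed_def current_def)
  note cones = cut_act[OF k] cut_act_mono[OF k]
  have lab: "A k y \<in> (\<lambda>g. A g (A k x)) ` lab ?j (A k x) \<longleftrightarrow> y \<in> (\<lambda>g. A g x) ` lab ?j x"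
    if o: "x \<in> current t" "y \<in> current t"
  proof -
    have x\<Omega>: "x \<in> \<Omega>" and y\<Omega>: "y \<in> \<Omega>" using o current_\<Omega> by blast+
    obtain g where g: "g \<in> K" "y = A g x"
      using st_orbit[OF t x\<Omega> y\<Omega>] o by (auto simp: current_def)
    have sub: "lab ?j u \<subseteq> K" if "u \<in> \<Omega>" for u
      using lab_cone[OF t that] by (simp add: positive_cone_def)
    have l: "y \<in> (\<lambda>g. A g x) ` lab ?j x \<longleftrightarrow> g \<in> lab ?j x"
      using g sub[OF x\<Omega>] act_cancel[OF t g(1) _ x\<Omega>] by auto
    let ?g = "k \<otimes>\<^bsub>G ?j\<^esub> g \<otimes>\<^bsub>G ?j\<^esub> inv\<^bsub>G ?j\<^esub> k"
    have gK: "?g \<in> K" using g k by simp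
    have kx: "A k x \<in> \<Omega>" using act_closed t k x\<Omega> by blast
    have e: "A k y = A ?g (A k x)"
      using g k t x\<Omega> by (simp add: act_mult act_inv act_closed)
    have "A k y \<in> (\<lambda>g. A g (A k x)) ` lab ?j (A k x) \<longleftrightarrow> ?g \<in> lab ?j (A k x)"
      using e sub[OF kx] act_cancel[OF t gK _ kx] by auto
    also have "\<dots> \<longleftrightarrow> g \<in> lab ?j x"
      using gK g k lab_act[OF t k x\<Omega>]
      by (simp add: conj_cone_def Gj.m_assoc) (simp add: Gj.m_assoc[symmetric])
    finally show ?thesis using l by simp
  qed
  consider "x \<in> completed t" "y \<in> completed t" | "x \<in> completed t" "y \<in> current t" | "x \<in> current t" "y \<in> completed t"
    | "x \<in> current t" "y \<in> current t" using x y by blast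
  then show ?thesis
  proof cases
    case 1
    have "x \<notin> current t" "y \<notin> current t" "A k x \<notin> current t" "A k y \<notin> current t"
      using 1 O x y completed_current_disjoint by blast+
    moreover have "less (A k x) (A k y) \<longleftrightarrow> less x y"
      using 1 less_act_earlier[OF t k] act_completed[OF t k] completed_earlier[OF t] by blast
    ultimately show ?thesis by (simp add: current_less_def)
  next
    case 2
    then show ?thesis
      using O[OF x] O[OF y] cut_act[OF k \<Omega>[OF y] 2(1)] completed_current_disjoint[of x t]
      by (simp add: current_less_def)
  next
    case 3
    then show ?thesis
      using O[OF x] O[OF y] cut_act[OF k \<Omega>[OF x] 3(2)] completed_current_disjoint[of y t]
      by (simp add: current_less_def)
  next
    case 4
    note m = cut_act_mono[OF k \<Omega>[OF x] \<Omega>[OF y]] cut_act_mono[OF k \<Omega>[OF y] \<Omega>[OF x]]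
    have "D (A k x) \<subset> D (A k y) \<longleftrightarrow> D x \<subset> D y"
      unfolding less_le_not_le using m by simp
    moreover have "D (A k x) = D (A k y) \<longleftrightarrow> D x = D y"
      unfolding order_eq_iff using m by simp
    ultimately show ?thesis
      using O[OF x] O[OF y] 4 lab[OF 4] by (simp add: current_less_def)
  qed
qed

text \<open>This is where the invariant is used. Two old points of the current orbit differ by an
  element of \<open>H\<close>. If their cuts in the completed orbits are equal, then so are their cuts in the
  set of the points older than they are, because that set consists of completed points by
  \<open>saturated\<close>; hence they are already ordered by the label.\<close>
lemma earlier_agree:
  assumes x: "x \<in> earlier t \<inter> (completed t \<union> current t)" and y: "y \<in> earlier t \<inter> (completed t \<union> current t)"
  shows "less x y \<longleftrightarrow> current_less t less x y"
proof -
  let ?j = "idx t"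
  have xo: "x \<in> earlier t" and yo: "y \<in> earlier t" using x y by simp_all
  note tot = linear_on_total[OF less_linear_earlier xo yo]
    and asym = linear_on_asym[OF less_linear_earlier xo yo]
  consider "x \<notin> current t" "y \<notin> current t" | "x \<in> completed t" "y \<in> current t" | "x \<in> current t" "y \<in> completed t"
    | "x \<in> current t" "y \<in> current t" using x y by blast
  then show ?thesis
  proof cases
    case 1
    then show ?thesis by (simp add: current_less_def)
  next
    case 2
    then show ?thesis
      using cut_old[of y x] x y completed_current_disjoint[of x t] by (simp add: current_less_def)
  next
    case 3
    then have "x \<noteq> y" using completed_current_disjoint by blast
    then show ?thesis
      using 3 cut_old[of x y] x y completed_current_disjoint[of y t] tot asym by (auto simp: current_less_def)
  next
    case 4
    have x\<Omega>: "x \<in> \<Omega>" and y\<Omega>: "y \<in> \<Omega>" using 4 current_\<Omega> by blast+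
    have st: "st ?j x = t" "st ?j y = t" using 4 by (simp_all add: current_def)
    have b: "b x \<^bold>< t" "b y \<^bold>< t" using x y by (simp_all add: earlier_def)
    obtain h where h: "h \<in> carrier H" "y = A (\<phi> ?j h) x"
      using parent[OF t x\<Omega> y\<Omega>] st b by auto
    have cut_x: "z \<in> D x \<longleftrightarrow> less z x" and cut_y: "z \<in> D y \<longleftrightarrow> less z y" if "z \<in> completed t" for z
      using cut_old[OF 4(1) xo that] cut_old[OF 4(2) yo that] .
    have lt: "less x y" if a: "D x \<subset> D y" "x \<in> earlier t" "y \<in> earlier t" "x \<in> current t" "y \<in> current t" for x y
    proof -
      obtain z where z: "z \<in> D y" "z \<notin> D x" using a(1) by blast
      then have zs: "z \<in> completed t" using cut_completed by blast
      then have zo: "z \<in> earlier t" using completed_earlier[OF t] by blast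
      have "less z y" "\<not> less z x"
        using cut_old[OF a(5,3) zs] cut_old[OF a(4,2) zs] z by simp_all
      moreover have "z \<noteq> x" using zs a(4) completed_current_disjoint by blast
      ultimately have "less x z" using linear_on_total[OF less_linear_earlier zo a(2)] by blast
      then show "less x y"
        using linear_on_trans[OF less_linear_earlier a(2) zo a(3)] \<open>less z y\<close> by blast
    qed
    show ?thesis
    proof (cases "D x = D y")
      case True
      have "less z x \<longleftrightarrow> less z y" if z: "z \<in> earlier (b x)" for z
      proof -
        have "z \<in> \<Omega>" "b z \<^bold>< b x" using z by (simp_all add: earlier_def)
        then have "z \<in> completed t"
          using saturated[OF t _ x\<Omega>, of z] st b by (simp add: completed_def)
        then show ?thesis using cut_x[of z] cut_y[of z] True by simp
      qed
      then have "less x y \<longleftrightarrow> \<phi> ?j h \<in> lab ?j x"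
        using good_label[OF good_earlier t h(1), of x] x h(2) by simp
      moreover have "y \<in> (\<lambda>g. A g x) ` lab ?j x \<longleftrightarrow> \<phi> ?j h \<in> lab ?j x"
        using h act_cancel[OF t phi_closed[OF t h(1)] _ x\<Omega>] lab_cone[OF t x\<Omega>]
        by (auto simp: positive_cone_def)
      ultimately show ?thesis using 4 True by (simp add: current_less_def)
    next
      case False
      then consider "D x \<subset> D y" | "D y \<subset> D x" using cut_chain[OF x\<Omega> y\<Omega>] by blast
      then show ?thesis
      proof cases
        case 1
        then show ?thesis using lt[of x y] 4 xo yo by (simp add: current_less_def)
      next
        case 2
        then have "less y x" using lt[of y x] 4 xo yo by simp
        then have "\<not> less x y" using asym by blast
        then show ?thesis using 2 4 False by (auto simp: current_less_def)
      qed
    qed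
  qed
qed

lemma less_glue: "x \<in> born_by t \<Longrightarrow> y \<in> born_by t \<Longrightarrow>
    less x y \<longleftrightarrow> glue (earlier t) less (completed t \<union> current t) (current_less t less) x y"
  using less_step[OF t] by (simp add: step_less_def)

lemma less_current:
  assumes "x \<in> completed t \<union> current t" "y \<in> completed t \<union> current t"
  shows "less x y \<longleftrightarrow> current_less t less x y"
proof -
  have "x \<in> born_by t" "y \<in> born_by t" using assms by (simp_all add: born_by_eq[OF t])
  from less_glue[OF this] glue_right[OF earlier_agree assms] show ?thesis by (rule HOL.trans)
qed

lemma less_linear_born_by: "linear_on (born_by t) less"
proof -
  let ?g = "glue (earlier t) less (completed t \<union> current t) (current_less t less)"
  have "linear_on (born_by t) ?g"
    unfolding born_by_eq[OF t]
    by (rule linear_on_glue[OF less_linear_earlier current_less_linear earlier_agree])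
  with linear_on_cong[of "born_by t" less ?g, OF less_glue] show ?thesis by (rule iffD2)
qed

lemma less_act_phi:
  assumes i: "i \<in> I" and h: "h \<in> carrier H" and x: "x \<in> born_by t" and y: "y \<in> born_by t"
  shows "less (act i (\<phi> i h) x) (act i (\<phi> i h) y) \<longleftrightarrow> less x y"
proof -
  let ?j = "idx t"
  let ?f = "A (\<phi> ?j h)"
  let ?Y = "completed t \<union> current t"
  have hK: "\<phi> ?j h \<in> K" using phi_closed t h by blast
  have \<Omega>: "u \<in> \<Omega>" if "u \<in> born_by t" for u using that by (simp add: born_by_def)
  have f\<Omega>: "?f u \<in> \<Omega>" if "u \<in> \<Omega>" for u using that act_closed t hK by blast
  have f1: "?f u \<in> earlier t \<longleftrightarrow> u \<in> earlier t" if "u \<in> \<Omega>" for u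
    using that birth_phi[OF t h that] f\<Omega>[OF that] by (simp add: earlier_def)
  have f2: "?f u \<in> ?Y \<longleftrightarrow> u \<in> ?Y" if "u \<in> \<Omega>" for u
    using that st_act[OF t hK that] f\<Omega>[OF that] by (simp add: completed_def current_def)
  have f3: "?f u \<in> born_by t" if "u \<in> born_by t" for u
    using f1 f2 \<Omega>[OF that] that unfolding born_by_eq[OF t] by blast
  have "glue (earlier t) less ?Y (current_less t less) (?f x) (?f y) \<longleftrightarrow>
      glue (earlier t) less ?Y (current_less t less) x y"
  proof (rule glue_invariant)
    show "?f u \<in> earlier t \<longleftrightarrow> u \<in> earlier t" "?f u \<in> ?Y \<longleftrightarrow> u \<in> ?Y" if "u \<in> earlier t \<union> ?Y" for u
      using f1 f2 \<Omega> that unfolding born_by_eq[OF t, symmetric] by blast+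
    show "less (?f u) (?f v) \<longleftrightarrow> less u v" if "u \<in> earlier t" "v \<in> earlier t" for u v
      using less_act_earlier[OF t hK] that f1 earlier_\<Omega> by blast
    show "current_less t less (?f u) (?f v) \<longleftrightarrow> current_less t less u v" if "u \<in> ?Y" "v \<in> ?Y" for u v
      using current_less_act[OF hK that] .
    show "earlier t \<inter> ?Y \<subseteq> ?f ` (earlier t \<inter> ?Y)"
    proof
      fix u assume u: "u \<in> earlier t \<inter> ?Y"
      then have u\<Omega>: "u \<in> \<Omega>" by (simp add: earlier_def)
      let ?u = "A (inv\<^bsub>G ?j\<^esub> (\<phi> ?j h)) u"
      have e: "?f ?u = u" using act_inv(2)[OF t hK u\<Omega>] .
      have "?u \<in> \<Omega>" using act_closed[OF t inv_closed[OF t hK] u\<Omega>] .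
      then have "?u \<in> earlier t \<inter> ?Y" using f1[of ?u] f2[of ?u] e u by simp
      then show "u \<in> ?f ` (earlier t \<inter> ?Y)" using e by (metis imageI)
    qed
  qed (use x y born_by_eq[OF t] in blast)+
  then have "less (?f x) (?f y) \<longleftrightarrow> less x y"
    unfolding less_glue[OF x y, symmetric] less_glue[OF f3[OF x] f3[OF y], symmetric] .
  then show ?thesis using act_phi[OF i t h] \<Omega> x y by simp
qed

text \<open>An orbit whose stage is still to come meets the present points in a single \<open>H\<close>-orbit, so
  elements of \<open>G i\<close> outside \<open>H\<close> impose no condition on it yet.\<close>
lemma step_le_of_act:
  assumes i: "i \<in> I" and g: "g \<in> carrier (G i)" "g \<notin> \<phi> i ` carrier H"
    and x: "x \<in> born_by t" "act i g x \<in> born_by t"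
  shows "st i x = t \<or> st i x \<^bold>< t"
proof (rule ccontr)
  assume "\<not> ?thesis"
  then have later: "t \<^bold>< st i x" using prec_total by blast
  have x\<Omega>: "x \<in> \<Omega>" and y\<Omega>: "act i g x \<in> \<Omega>" using x by (simp_all add: born_by_def)
  have st: "st i (act i g x) = st i x" using st_act i g x\<Omega> by blast
  have "b x \<^bold>< st i x" "b (act i g x) \<^bold>< st i x"
    using x later prec_trans by (auto simp: born_by_def)
  then obtain h where "h \<in> carrier H" "act i g x = act i (\<phi> i h) x"
    using parent[OF i x\<Omega> y\<Omega>] st by auto
  then have "g = \<phi> i h" using act_cancel i g x\<Omega> phi_closed by blast
  then show False using g \<open>h \<in> carrier H\<close> by blast
qed

text \<open>Elements of \<open>H\<close> are symmetries of all data of the stage. For the other elements of \<open>G i\<close>,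
  both points lie in orbits whose stages have been reached; if \<open>i\<close> is not the index of the current
  stage, these orbits are older and nothing has changed on them.\<close>
lemma less_act_born_by:
  assumes i: "i \<in> I" and g: "g \<in> carrier (G i)"
    and x: "x \<in> born_by t" "act i g x \<in> born_by t" and y: "y \<in> born_by t" "act i g y \<in> born_by t"
  shows "less (act i g x) (act i g y) \<longleftrightarrow> less x y"
proof (cases "g \<in> \<phi> i ` carrier H")
  case True
  then show ?thesis using less_act_phi[OF i _ x(1) y(1)] by blast
next
  case False
  have \<Omega>: "x \<in> \<Omega>" "y \<in> \<Omega>" using x y by (simp_all add: born_by_def)
  have le: "st i x = t \<or> st i x \<^bold>< t" "st i y = t \<or> st i y \<^bold>< t"
    using step_le_of_act[OF i g False] x y by blast+
  show ?thesis
  proof (cases "i = idx t")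
    case True
    have xy: "x \<in> completed t \<union> current t" "y \<in> completed t \<union> current t"
      using le \<Omega> True by (auto simp: completed_def current_def)
    have "act i g x \<in> completed t \<union> current t" "act i g y \<in> completed t \<union> current t"
      using xy act_completed[OF t] act_current[OF t] g True by blast+
    then show ?thesis using less_current xy current_less_act g True by simp
  next
    case neq: False
    have before: "u \<in> earlier t \<and> act i g u \<in> earlier t" if "u \<in> \<Omega>" "st i u = t \<or> st i u \<^bold>< t" for u
    proof -
      have s: "st i u \<^bold>< t" using that(2) neq idx_st[OF i that(1)] by auto
      have "st i (act i g u) = st i u" "act i g u \<in> \<Omega>" using st_act act_closed i g that by blast+
      then show ?thesis
        using s birth_le[OF i, of u] birth_le[OF i, of "act i g u"] that prec_trans[OF _ s]
        unfolding earlier_def by auto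
    qed
    then show ?thesis using less_act_earlier[OF i g] le \<Omega> by blast
  qed
qed

lemma less_label_born_by:
  assumes i: "i \<in> I" and h: "h \<in> carrier H" and x: "x \<in> born_by t"
    and same: "\<And>z. z \<in> earlier (b x) \<Longrightarrow> less z x \<longleftrightarrow> less z (act i (\<phi> i h) x)"
  shows "less x (act i (\<phi> i h) x) \<longleftrightarrow> \<phi> i h \<in> lab i x"
proof (cases "b x \<^bold>< t")
  case True
  then have "x \<in> earlier t" using x by (simp add: earlier_def born_by_def)
  then show ?thesis using good_label[OF good_earlier i h _ same] by blast
next
  case False
  let ?j = "idx t"
  have bx: "b x = t" and x\<Omega>: "x \<in> \<Omega>" using x False by (auto simp: born_by_def)
  obtain k where k: "k \<in> I" "t = st k x" using birth_step[OF x\<Omega>] bx by auto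
  then have xo: "x \<in> current t" using idx_st x\<Omega> by (simp add: current_def)
  have hK: "\<phi> ?j h \<in> K" using phi_closed t h by blast
  have e: "act i (\<phi> i h) x = A (\<phi> ?j h) x" using act_phi[OF i t h x\<Omega>] .
  have yo: "A (\<phi> ?j h) x \<in> current t" using act_current[OF t hK xo] .
  have "D x = D (A (\<phi> ?j h) x)"
  proof (rule Set.set_eqI)
    fix z
    show "z \<in> D x \<longleftrightarrow> z \<in> D (A (\<phi> ?j h) x)"
    proof (cases "z \<in> completed t")
      case True
      then have "less z x \<longleftrightarrow> less z (A (\<phi> ?j h) x)" using same completed_earlier[OF t] bx e by auto
      then show ?thesis
        using less_current[of z x] less_current[of z "A (\<phi> ?j h) x"] True xo yo completed_current_disjoint[OF True]
        by (simp add: current_less_def)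
    qed (use cut_completed in blast)
  qed
  then have "less x (A (\<phi> ?j h) x) \<longleftrightarrow> A (\<phi> ?j h) x \<in> (\<lambda>g. A g x) ` lab ?j x"
    using less_current[of x "A (\<phi> ?j h) x"] xo yo by (simp add: current_less_def)
  also have "\<dots> \<longleftrightarrow> \<phi> ?j h \<in> lab ?j x"
    using act_cancel[OF t hK _ x\<Omega>] lab_cone[OF t x\<Omega>] by (auto simp: positive_cone_def)
  finally show ?thesis using e lab_phi[OF i t h x\<Omega>] by simp
qed

lemma good_born_by_step: "good (born_by t)"
  unfolding good_def
  using less_linear_born_by less_act_born_by less_label_born_by by blast

end

context birth_tree
begin

lemma good_earlier:
  assumes "\<And>s. s \<^bold>< t \<Longrightarrow> good (born_by s)"
  shows "good (earlier t)"
proof (rule good_directed)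
  fix F assume F: "finite F" "F \<noteq> {}" "F \<subseteq> earlier t"
  then obtain x where "x \<in> F" "F \<subseteq> born_by (b x)"
    using finite_born_before[of F] by (auto simp: earlier_def)
  then show "\<exists>s. F \<subseteq> born_by s \<and> good (born_by s)" using F assms by (auto simp: earlier_def)
qed

lemma good_born_by: "good (born_by t)"
proof (induction t rule: wf_induct_rule[OF wf_r])
  case (1 t)
  then have o: "good (earlier t)" by (rule good_earlier)
  show ?case
  proof (cases "\<exists>x \<in> \<Omega>. b x = t")
    case True
    then obtain x i where "x \<in> \<Omega>" "i \<in> I" "t = st i x" using birth_step by blast
    then have "idx t \<in> I" using idx_st by simp
    then interpret birth_tree_step I G H \<phi> \<Omega> act r idx st b lab t
      using o by unfold_locales
    show ?thesis by (rule good_born_by_step)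
  next
    case False
    then have "born_by t = earlier t" by (auto simp: born_by_def earlier_def)
    then show ?thesis using o by simp
  qed
qed

lemma good_all: "good \<Omega>"
  by (rule good_directed) (meson finite_born_before good_born_by)

lemma less_linear: "linear_on \<Omega> less"
  using good_all by (rule good_linear)

lemma less_act:
  assumes "i \<in> I" "g \<in> carrier (G i)" "x \<in> \<Omega>" "y \<in> \<Omega>"
  shows "less (act i g x) (act i g y) \<longleftrightarrow> less x y"
  using good_act[OF good_all] assms act_closed by blast

text \<open>No cut separates the points of an orbit with the earliest stage, so only the label counts.\<close>
lemma less_first_orbit:
  assumes i: "i \<in> I" and x: "x \<in> \<Omega>" and g: "g \<in> carrier (G i)"
    and first: "\<And>z. z \<in> \<Omega> \<Longrightarrow> \<not> st i z \<^bold>< st i x"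
  shows "less x (act i g x) \<longleftrightarrow> g \<in> lab i x"
proof -
  let ?t = "st i x"
  have idx: "idx ?t = i" using idx_st i x by blast
  interpret birth_tree_step I G H \<phi> \<Omega> act r idx st b lab ?t
    using good_earlier[OF good_born_by] i idx by unfold_locales simp_all
  have completed: "completed ?t = {}" using first idx by (simp add: completed_def)
  have xo: "x \<in> current ?t" using idx x by (simp add: current_def)
  have yo: "act i g x \<in> current ?t" using act_current[OF t _ xo] g idx by simp
  have "less x (act i g x) \<longleftrightarrow> act i g x \<in> (\<lambda>g. act i g x) ` lab i x"
    using less_current[of x "act i g x"] xo yo completed idx by (simp add: current_less_def cut_def)
  also have "\<dots> \<longleftrightarrow> g \<in> lab i x"
    using act_cancel[OF i g _ x] lab_cone[OF i x] by (auto simp: positive_cone_def)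
  finally show ?thesis .
qed

end

section \<open>Normal forms in an amalgam\<close>

locale amalg_nf =
  fixes I :: "'i set" and G :: "'i \<Rightarrow> ('a, 'm) monoid_scheme"
    and H :: "('h, 'n) monoid_scheme" and \<phi> :: "'i \<Rightarrow> 'h \<Rightarrow> 'a"
  assumes group_G: "\<And>i. i \<in> I \<Longrightarrow> group (G i)"
    and group_H: "group H"
    and mon: "\<And>i. i \<in> I \<Longrightarrow> \<phi> i \<in> mon H (G i)"

sublocale amalg_nf \<subseteq> amalg_data
  using group_G mon by (intro amalg_data.intro) (auto simp: mon_def)

context amalg_nf
begin

abbreviation "img i \<equiv> \<phi> i ` carrier H"

lemma phi_mult: "i \<in> I \<Longrightarrow> h \<in> carrier H \<Longrightarrow> k \<in> carrier H \<Longrightarrow>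
    \<phi> i (h \<otimes>\<^bsub>H\<^esub> k) = \<phi> i h \<otimes>\<^bsub>G i\<^esub> \<phi> i k"
  using mon by (auto simp: mon_def hom_def)

lemma phi_inj: "i \<in> I \<Longrightarrow> h \<in> carrier H \<Longrightarrow> k \<in> carrier H \<Longrightarrow> \<phi> i h = \<phi> i k \<Longrightarrow> h = k"
  using mon by (auto simp: mon_def inj_on_def)

lemma img_subgroup: "i \<in> I \<Longrightarrow> subgroup (img i) (G i)"
  using group_hom.img_is_subgroup[of H "G i" "\<phi> i"] group_G group_H mon
  by (auto simp: group_hom_def group_hom_axioms_def mon_def)

lemma phi_one: "i \<in> I \<Longrightarrow> \<phi> i \<one>\<^bsub>H\<^esub> = \<one>\<^bsub>G i\<^esub>"
  using mon group_G group_H by (auto simp: mon_def intro: hom_one)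

lemma phi_inv: "i \<in> I \<Longrightarrow> h \<in> carrier H \<Longrightarrow> \<phi> i (inv\<^bsub>H\<^esub> h) = inv\<^bsub>G i\<^esub> \<phi> i h"
  using group_hom.hom_inv[of H "G i" "\<phi> i" h] group_G group_H mon
  by (auto simp: group_hom_def group_hom_axioms_def mon_def)

text \<open>Representatives of the right cosets of the image of \<open>H\<close>; the trivial coset is represented by
  the neutral element, so that nontrivial representatives lie outside the image.\<close>
definition rep :: "'i \<Rightarrow> 'a \<Rightarrow> 'a" where
  "rep i g = (if g \<in> img i then \<one>\<^bsub>G i\<^esub> else (SOME k. k \<in> img i #>\<^bsub>G i\<^esub> g))"

definition hpart :: "'i \<Rightarrow> 'a \<Rightarrow> 'h" where
  "hpart i g = (SOME h. h \<in> carrier H \<and> g = \<phi> i h \<otimes>\<^bsub>G i\<^esub> rep i g)"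

lemma img_mult_iff:
  assumes "i \<in> I" "h \<in> carrier H" "g \<in> carrier (G i)"
  shows "\<phi> i h \<otimes>\<^bsub>G i\<^esub> g \<in> img i \<longleftrightarrow> g \<in> img i"
proof -
  interpret group "G i" using assms(1) by (rule group_G)
  interpret S: subgroup "img i" "G i" using assms(1) by (rule img_subgroup)
  have h: "\<phi> i h \<in> img i" "\<phi> i h \<in> carrier (G i)" using assms by auto
  show ?thesis
  proof
    assume "\<phi> i h \<otimes>\<^bsub>G i\<^esub> g \<in> img i"
    then have "inv\<^bsub>G i\<^esub> (\<phi> i h) \<otimes>\<^bsub>G i\<^esub> (\<phi> i h \<otimes>\<^bsub>G i\<^esub> g) \<in> img i" using h by blast
    then show "g \<in> img i" using h assms by (simp add: m_assoc[symmetric])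
  qed (use h in blast)
qed

lemma rep_mult:
  assumes "i \<in> I" "h \<in> carrier H" "g \<in> carrier (G i)"
  shows "rep i (\<phi> i h \<otimes>\<^bsub>G i\<^esub> g) = rep i g"
proof -
  interpret group "G i" using assms(1) by (rule group_G)
  have h: "\<phi> i h \<in> img i" "\<phi> i h \<in> carrier (G i)" using assms by auto
  have "img i #>\<^bsub>G i\<^esub> (\<phi> i h \<otimes>\<^bsub>G i\<^esub> g) = img i #>\<^bsub>G i\<^esub> \<phi> i h #>\<^bsub>G i\<^esub> g"
    using coset_mult_assoc[OF subgroup.subset[OF img_subgroup[OF assms(1)]] h(2) assms(3)] by simp
  also have "img i #>\<^bsub>G i\<^esub> \<phi> i h = img i"
    using coset_join2[OF h(2) img_subgroup[OF assms(1)] h(1)] .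
  finally show ?thesis using img_mult_iff[OF assms] by (simp add: rep_def)
qed

lemma rep_decomp:
  assumes "i \<in> I" "g \<in> carrier (G i)"
  shows "\<exists>h \<in> carrier H. g = \<phi> i h \<otimes>\<^bsub>G i\<^esub> rep i g" and "rep i g \<in> carrier (G i)"
proof -
  interpret group "G i" using assms(1) by (rule group_G)
  have "(\<exists>h \<in> carrier H. g = \<phi> i h \<otimes>\<^bsub>G i\<^esub> rep i g) \<and> rep i g \<in> carrier (G i)"
  proof (cases "g \<in> img i")
    case True
    then show ?thesis using assms by (auto simp: rep_def)
  next
    case False
    have "g \<in> img i #>\<^bsub>G i\<^esub> g" using rcos_self[OF assms(2) img_subgroup[OF assms(1)]] .
    then have "rep i g \<in> img i #>\<^bsub>G i\<^esub> g" using False by (auto simp: rep_def intro: someI)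
    then obtain h where h: "h \<in> carrier H" "rep i g = \<phi> i h \<otimes>\<^bsub>G i\<^esub> g" by (auto simp: r_coset_def)
    then have "g = \<phi> i (inv\<^bsub>H\<^esub> h) \<otimes>\<^bsub>G i\<^esub> rep i g"
      using assms by (simp add: phi_inv m_assoc[symmetric])
    then show ?thesis using h assms group.inv_closed[OF group_H h(1)] by auto
  qed
  then show "\<exists>h \<in> carrier H. g = \<phi> i h \<otimes>\<^bsub>G i\<^esub> rep i g" "rep i g \<in> carrier (G i)" by blast+
qed

lemma hpart_decomp:
  assumes "i \<in> I" "g \<in> carrier (G i)"
  shows "hpart i g \<in> carrier H" "\<phi> i (hpart i g) \<otimes>\<^bsub>G i\<^esub> rep i g = g"
proof -
  have "hpart i g \<in> carrier H \<and> g = \<phi> i (hpart i g) \<otimes>\<^bsub>G i\<^esub> rep i g"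
    unfolding hpart_def using rep_decomp(1)[OF assms] by (metis (mono_tags, lifting) someI)
  then show "hpart i g \<in> carrier H" "\<phi> i (hpart i g) \<otimes>\<^bsub>G i\<^esub> rep i g = g" by auto
qed

lemma hpart_unique:
  assumes "i \<in> I" "g \<in> carrier (G i)" "h \<in> carrier H" "\<phi> i h \<otimes>\<^bsub>G i\<^esub> rep i g = g"
  shows "hpart i g = h"
proof -
  interpret group "G i" using assms(1) by (rule group_G)
  have "\<phi> i (hpart i g) \<otimes>\<^bsub>G i\<^esub> rep i g = \<phi> i h \<otimes>\<^bsub>G i\<^esub> rep i g" using hpart_decomp assms by simp
  then have "\<phi> i (hpart i g) = \<phi> i h"
    using right_cancel[OF rep_decomp(2)[OF assms(1,2)], of "\<phi> i (hpart i g)" "\<phi> i h"] assms hpart_decomp(1)[OF assms(1,2)] by simp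
  then show ?thesis using phi_inj assms hpart_decomp(1) by blast
qed

lemma hpart_mult:
  assumes "i \<in> I" "h \<in> carrier H" "g \<in> carrier (G i)"
  shows "hpart i (\<phi> i h \<otimes>\<^bsub>G i\<^esub> g) = h \<otimes>\<^bsub>H\<^esub> hpart i g"
proof -
  interpret group "G i" using assms(1) by (rule group_G)
  interpret H: group H by (rule group_H)
  show ?thesis
    using assms hpart_decomp[OF assms(1,3)] rep_decomp(2)[OF assms(1,3)] rep_mult[OF assms]
    by (intro hpart_unique) (auto simp: phi_mult m_assoc)
qed

lemma rep_eq_one_iff:
  assumes "i \<in> I" "g \<in> carrier (G i)"
  shows "rep i g \<in> img i \<longleftrightarrow> g \<in> img i"
  using img_mult_iff[OF assms(1) hpart_decomp(1)[OF assms] rep_decomp(2)[OF assms]]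
  by (simp add: hpart_decomp(2)[OF assms])

lemma rep_rep:
  assumes "i \<in> I" "g \<in> carrier (G i)"
  shows "rep i (rep i g) = rep i g"
  using rep_mult[OF assms(1) hpart_decomp(1)[OF assms] rep_decomp(2)[OF assms]]
  by (simp add: hpart_decomp(2)[OF assms])

lemma hpart_phi_rep:
  assumes "i \<in> I" "h \<in> carrier H" "g \<in> carrier (G i)" "rep i g = g"
  shows "hpart i (\<phi> i h \<otimes>\<^bsub>G i\<^esub> g) = h"
  using assms rep_mult[OF assms(1-3)] group.is_monoid[OF group_G]
  by (intro hpart_unique) (auto intro: monoid.m_closed)

definition starts :: "'i \<Rightarrow> ('i \<times> 'a) list \<Rightarrow> bool" where
  "starts i w \<longleftrightarrow> w \<noteq> [] \<and> fst (hd w) = i"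

lemma starts_simps [simp]: "\<not> starts i []" "starts i ((j, g) # w) \<longleftrightarrow> j = i"
  by (simp_all add: starts_def)

text \<open>The tails of the normal forms: the letters are nontrivial coset representatives, and
  neighbouring letters belong to different groups. A normal form has in addition a head in \<open>H\<close>.\<close>
fun reduced :: "('i \<times> 'a) list \<Rightarrow> bool" where
  "reduced [] \<longleftrightarrow> True"
| "reduced ((i, g) # w) \<longleftrightarrow> i \<in> I \<and> g \<in> carrier (G i) \<and> rep i g = g \<and> g \<notin> img i \<and>
    \<not> starts i w \<and> reduced w"

definition nforms :: "('h \<times> ('i \<times> 'a) list) set" where
  "nforms = carrier H \<times> {w. reduced w}"

text \<open>Seen from \<open>G i\<close>, a normal form is an element of \<open>G i\<close> followed by a tail that does not start
  with a letter of \<open>G i\<close>. In these coordinates \<open>G i\<close> acts by left multiplication on the first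
  component, so no case distinction is needed to see that this is a free action.\<close>
definition split :: "'i \<Rightarrow> 'h \<times> ('i \<times> 'a) list \<Rightarrow> 'a \<times> ('i \<times> 'a) list" where
  "split i = (\<lambda>(h, w). if starts i w then (\<phi> i h \<otimes>\<^bsub>G i\<^esub> snd (hd w), tl w) else (\<phi> i h, w))"

definition join :: "'i \<Rightarrow> 'a \<times> ('i \<times> 'a) list \<Rightarrow> 'h \<times> ('i \<times> 'a) list" where
  "join i = (\<lambda>(g, w). (hpart i g, if g \<in> img i then w else (i, rep i g) # w))"

definition nact :: "'i \<Rightarrow> 'a \<Rightarrow> 'h \<times> ('i \<times> 'a) list \<Rightarrow> 'h \<times> ('i \<times> 'a) list" where
  "nact i g x = join i (g \<otimes>\<^bsub>G i\<^esub> fst (split i x), snd (split i x))"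

lemma split_closed:
  assumes "i \<in> I" "x \<in> nforms"
  shows "fst (split i x) \<in> carrier (G i)" "reduced (snd (split i x))" "\<not> starts i (snd (split i x))"
proof -
  interpret group "G i" using assms(1) by (rule group_G)
  obtain h w where x: "x = (h, w)" "h \<in> carrier H" "reduced w" using assms by (auto simp: nforms_def)
  have "fst (split i x) \<in> carrier (G i) \<and> reduced (snd (split i x)) \<and> \<not> starts i (snd (split i x))"
    using x assms(1) by (cases w) (auto simp: split_def)
  then show "fst (split i x) \<in> carrier (G i)" "reduced (snd (split i x))"
    "\<not> starts i (snd (split i x))" by blast+
qed

lemma join_closed:
  assumes "i \<in> I" "g \<in> carrier (G i)" "reduced w" "\<not> starts i w"
  shows "join i (g, w) \<in> nforms"
  using assms hpart_decomp rep_decomp rep_rep rep_eq_one_iff by (auto simp: join_def nforms_def)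

lemma split_join:
  assumes "i \<in> I" "g \<in> carrier (G i)" "\<not> starts i w"
  shows "split i (join i (g, w)) = (g, w)"
proof (cases "g \<in> img i")
  case True
  then have "rep i g = \<one>\<^bsub>G i\<^esub>" by (simp add: rep_def)
  then have "\<phi> i (hpart i g) = g"
    using hpart_decomp[OF assms(1,2)] group_G[OF assms(1)] assms(1)
    by (simp add: group.is_monoid)
  then show ?thesis using True assms by (simp add: split_def join_def)
next
  case False
  then show ?thesis using hpart_decomp[OF assms(1,2)] by (simp add: split_def join_def)
qed

lemma join_split:
  assumes "i \<in> I" "x \<in> nforms"
  shows "join i (split i x) = x"
proof -
  interpret group "G i" using assms(1) by (rule group_G)
  obtain h w where x: "x = (h, w)" "h \<in> carrier H" "reduced w" using assms by (auto simp: nforms_def)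
  show ?thesis
  proof (cases "starts i w")
    case True
    then obtain g v where w: "w = (i, g) # v" by (cases w) auto
    then have g: "g \<in> carrier (G i)" "rep i g = g" "g \<notin> img i" using x by auto
    then show ?thesis
      using x w assms img_mult_iff[OF assms(1) x(2) g(1)] rep_mult[OF assms(1) x(2) g(1)]
        hpart_phi_rep[OF assms(1) x(2) g(1,2)]
      by (simp add: split_def join_def)
  next
    case False
    have "rep i (\<phi> i h) = \<one>\<^bsub>G i\<^esub>" using x by (simp add: rep_def)
    then have "hpart i (\<phi> i h) = h" using x assms by (intro hpart_unique) auto
    then show ?thesis using False x by (simp add: split_def join_def)
  qed
qed

lemma split_nact:
  assumes "i \<in> I" "g \<in> carrier (G i)" "x \<in> nforms"
  shows "split i (nact i g x) = (g \<otimes>\<^bsub>G i\<^esub> fst (split i x), snd (split i x))"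
  unfolding nact_def using assms split_closed[OF assms(1,3)] group.is_monoid[OF group_G[OF assms(1)]]
  by (intro split_join) (auto intro: monoid.m_closed)

lemma nact_closed:
  assumes "i \<in> I" "g \<in> carrier (G i)" "x \<in> nforms"
  shows "nact i g x \<in> nforms"
  unfolding nact_def using assms split_closed[OF assms(1,3)] group.is_monoid[OF group_G[OF assms(1)]]
  by (intro join_closed) (auto intro: monoid.m_closed)

lemma nact_one:
  assumes "i \<in> I" "x \<in> nforms"
  shows "nact i \<one>\<^bsub>G i\<^esub> x = x"
  using assms join_split[OF assms] split_closed(1)[OF assms] group.is_monoid[OF group_G[OF assms(1)]]
  by (simp add: nact_def monoid.l_one)

lemma nact_mult:
  assumes "i \<in> I" "g \<in> carrier (G i)" "k \<in> carrier (G i)" "x \<in> nforms"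
  shows "nact i (g \<otimes>\<^bsub>G i\<^esub> k) x = nact i g (nact i k x)"
  using split_nact[OF assms(1,3,4)] assms split_closed(1)[OF assms(1,4)]
    group.is_monoid[OF group_G[OF assms(1)]]
  by (simp add: nact_def[of i g] nact_def[of i "g \<otimes>\<^bsub>G i\<^esub> k"] monoid.m_assoc)

lemma nact_phi:
  assumes "i \<in> I" "k \<in> carrier H" "x \<in> nforms"
  shows "nact i (\<phi> i k) x = (k \<otimes>\<^bsub>H\<^esub> fst x, snd x)"
proof -
  obtain g v where gv: "split i x = (g, v)" by (cases "split i x")
  then have g: "g \<in> carrier (G i)" using split_closed(1)[OF assms(1,3)] by simp
  have "x = (hpart i g, if g \<in> img i then v else (i, rep i g) # v)"
    using join_split[OF assms(1,3)] gv by (simp add: join_def)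
  then show ?thesis
    using hpart_mult[OF assms(1,2) g] rep_mult[OF assms(1,2) g] img_mult_iff[OF assms(1,2) g] gv
    by (simp add: nact_def join_def)
qed

lemma nact_free:
  assumes "i \<in> I" "g \<in> carrier (G i)" "x \<in> nforms" "nact i g x = x"
  shows "g = \<one>\<^bsub>G i\<^esub>"
proof -
  interpret group "G i" using assms(1) by (rule group_G)
  have "g \<otimes>\<^bsub>G i\<^esub> fst (split i x) = fst (split i x)"
    using split_nact[OF assms(1-3)] assms(4) by (metis fst_conv)
  then show ?thesis using assms(2) split_closed(1)[OF assms(1,3)] by simp
qed

end

context amalg_nf
begin

text \<open>A pair \<open>(i, w)\<close>, with \<open>w\<close> a tail not starting with a letter of \<open>G i\<close>, stands for the
  \<open>G i\<close>-orbit that has the points with tail \<open>w\<close> as its oldest points. Its code lists the group and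
  letter choices that lead to this orbit. For nonempty \<open>w\<close>, dropping the first entry gives the
  code of the orbit in which the points with tail \<open>w\<close> are born; to have this, each letter is
  paired with the index of the group that comes next, and \<open>a\<close> fills the gap at the end.\<close>
fun code :: "'a \<Rightarrow> 'i \<times> ('i \<times> 'a) list \<Rightarrow> ('a \<times> 'i) list" where
  "code a (i, []) = [(a, i)]"
| "code a (i, (j, g) # w) = (g, i) # code a (j, w)"

text \<open>Read from the other end, the codes are compared by length and then lexicographically. So the
  orbits are ordered first by the birth of their oldest points, as \<open>step_order_mono\<close> says.\<close>
definition step_order :: "('a \<times> 'i) rel \<Rightarrow> 'a \<Rightarrow> ('i \<times> ('i \<times> 'a) list) rel" where
  "step_order \<rho> a = inv_image (lenlex \<rho>) (\<lambda>s. rev (code a s))"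

text \<open>The orbit in which the points with tail \<open>w\<close> are born. For the empty tail this is an orbit of
  the group with a distinguished index \<open>o1\<close>.\<close>
fun birth :: "'i \<Rightarrow> ('i \<times> 'a) list \<Rightarrow> 'i \<times> ('i \<times> 'a) list" where
  "birth o1 [] = (o1, [])"
| "birth o1 ((i, g) # w) = (i, w)"

lemma length_code: "length (code a (i, w)) = Suc (length w)"
  by (induction a "(i, w)" arbitrary: i w rule: code.induct) auto

lemma inj_code: "inj (code a)"
proof (rule injI)
  fix s t :: "'i \<times> ('i \<times> 'a) list"
  show "code a s = code a t \<Longrightarrow> s = t"
  proof (induction a s arbitrary: t rule: code.induct)
    case (1 a i)
    then show ?case
      by (cases "(a, t)" rule: code.cases) (use length_code[of a] in \<open>auto dest: arg_cong[of _ _ length]\<close>)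
  next
    case (2 a i j g w)
    obtain i' w' where t: "t = (i', w')" by (cases t)
    then have "length w' = Suc (length w)"
      using 2(2) length_code[of a i "(j, g) # w"] length_code[of a i' w'] by simp
    then obtain j' g' v' where "w' = (j', g') # v'" by (cases w') auto
    then show ?case using 2(1)[of "(j', v')"] 2(2) t by auto
  qed
qed

lemma step_order_props:
  assumes "wf \<rho>" "Relation.trans \<rho>" "total \<rho>"
  shows "wf (step_order \<rho> a)" "Relation.trans (step_order \<rho> a)" "total (step_order \<rho> a)"
proof -
  show "wf (step_order \<rho> a)" unfolding step_order_def using assms(1) by blast
  show "Relation.trans (step_order \<rho> a)"
    unfolding step_order_def by (rule trans_inv_image) (rule lenlex_transI[OF assms(2)])
  show "total (step_order \<rho> a)"
    using total_lenlex[OF assms(3)] injD[OF inj_code]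
    unfolding step_order_def total_on_def by (metis UNIV_I in_inv_image rev_is_rev_conv)
qed

lemma step_order_length:
  "length v < length w \<Longrightarrow> ((i, v), (j, w)) \<in> step_order \<rho> a"
  "((i, v), (j, w)) \<in> step_order \<rho> a \<Longrightarrow> length v \<le> length w"
  by (auto simp: step_order_def lenlex_conv length_code)

lemma birth_before: "w \<noteq> [] \<Longrightarrow> (birth o1 w, (i, w)) \<in> step_order \<rho> a"
  by (cases w) (auto simp: step_order_length(1))

lemma step_order_mono:
  assumes "(birth o1 v, birth o1 w) \<in> step_order \<rho> a" "v \<noteq> []" "w \<noteq> []"
  shows "((i, v), (i, w)) \<in> step_order \<rho> a"
proof -
  obtain j g v' where v: "v = (j, g) # v'" using assms(2) by (cases v) auto
  obtain k l w' where w: "w = (k, l) # w'" using assms(3) by (cases w) auto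
  have "(rev (code a (j, v')), rev (code a (k, w'))) \<in> lenlex \<rho>"
    using assms(1) v w by (simp add: step_order_def)
  then have "(rev (code a (j, v')) @ [(g, i)], rev (code a (k, w')) @ [(l, i)]) \<in> lenlex \<rho>"
    by (rule lenlex_append1) simp
  then show ?thesis using v w by (simp add: step_order_def)
qed

end

section \<open>Left orders on amalgams\<close>

locale ordered_amalgam = amalg_nf I G H \<phi>
  for I :: "'i set" and G :: "'i \<Rightarrow> ('a, 'm) monoid_scheme"
    and H :: "('h, 'n) monoid_scheme" and \<phi> +
  fixes L :: "'i \<Rightarrow> 'a set set" and Q :: "'i \<Rightarrow> 'a set"
  assumes nonempty: "I \<noteq> {}"
    and L_cone: "\<And>i C. i \<in> I \<Longrightarrow> C \<in> L i \<Longrightarrow> positive_cone (G i) C"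
    and L_conj: "\<And>i C g. i \<in> I \<Longrightarrow> C \<in> L i \<Longrightarrow> g \<in> carrier (G i) \<Longrightarrow> conj_cone (G i) g C \<in> L i"
    and L_compatible: "\<And>i j C. i \<in> I \<Longrightarrow> j \<in> I \<Longrightarrow> C \<in> L i \<Longrightarrow>
        \<exists>D \<in> L j. \<forall>h \<in> carrier H. \<phi> j h \<in> D \<longleftrightarrow> \<phi> i h \<in> C"
    and Q_L: "\<And>i. i \<in> I \<Longrightarrow> Q i \<in> L i"
    and Q_compatible: "\<And>i j h. i \<in> I \<Longrightarrow> j \<in> I \<Longrightarrow> h \<in> carrier H \<Longrightarrow> \<phi> i h \<in> Q i \<longleftrightarrow> \<phi> j h \<in> Q j"
begin

text \<open>Labels for the points with head \<open>\<one>\<close>. Passing to another point of a \<open>G i\<close>-orbit conjugates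
  the cone on \<open>G i\<close>, and this stays within \<open>L i\<close>; the cone on another group \<open>G j\<close> is then any
  member of \<open>L j\<close> with the same restriction to \<open>H\<close>. The head \<open>h\<close> acts by conjugation, too.\<close>
fun tail_label :: "('i \<times> 'a) list \<Rightarrow> 'i \<Rightarrow> 'a set" where
  "tail_label [] j = Q j"
| "tail_label ((i, g) # w) j =
    (let C = conj_cone (G i) g (tail_label w i) in
     if j = i then C else SOME D. D \<in> L j \<and> (\<forall>h \<in> carrier H. \<phi> j h \<in> D \<longleftrightarrow> \<phi> i h \<in> C))"

definition label :: "'i \<Rightarrow> 'h \<times> ('i \<times> 'a) list \<Rightarrow> 'a set" where
  "label j x = conj_cone (G j) (\<phi> j (fst x)) (tail_label (snd x) j)"

lemma tail_label:
  assumes "reduced w"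
  shows "j \<in> I \<Longrightarrow> tail_label w j \<in> L j"
    and "i \<in> I \<Longrightarrow> j \<in> I \<Longrightarrow> h \<in> carrier H \<Longrightarrow> \<phi> i h \<in> tail_label w i \<longleftrightarrow> \<phi> j h \<in> tail_label w j"
proof -
  have "(\<forall>j \<in> I. tail_label w j \<in> L j) \<and>
      (\<forall>i \<in> I. \<forall>j \<in> I. \<forall>h \<in> carrier H. \<phi> i h \<in> tail_label w i \<longleftrightarrow> \<phi> j h \<in> tail_label w j)"
    using assms
  proof (induction w)
    case Nil
    show ?case unfolding tail_label.simps using Q_L Q_compatible by blast
  next
    case (Cons l w)
    obtain i g where l: "l = (i, g)" by (cases l)
    let ?C = "conj_cone (G i) g (tail_label w i)"
    have i: "i \<in> I" and g: "g \<in> carrier (G i)" using Cons.prems l by auto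
    have C: "?C \<in> L i" using Cons l L_conj by simp
    have *: "tail_label (l # w) j \<in> L j \<and>
        (\<forall>h \<in> carrier H. \<phi> j h \<in> tail_label (l # w) j \<longleftrightarrow> \<phi> i h \<in> ?C)" if j: "j \<in> I" for j
    proof (cases "j = i")
      case True
      then show ?thesis using l C by simp
    next
      case False
      obtain D where "D \<in> L j \<and> (\<forall>h \<in> carrier H. \<phi> j h \<in> D \<longleftrightarrow> \<phi> i h \<in> ?C)"
        using L_compatible[OF i j C] by blast
      then show ?thesis using False l by (simp add: Let_def) (rule someI)
    qed
    then show ?case by blast
  qed
  then show "j \<in> I \<Longrightarrow> tail_label w j \<in> L j"
    and "i \<in> I \<Longrightarrow> j \<in> I \<Longrightarrow> h \<in> carrier H \<Longrightarrow> \<phi> i h \<in> tail_label w i \<longleftrightarrow> \<phi> j h \<in> tail_label w j"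
    by blast+
qed

lemma label_split:
  assumes i: "i \<in> I" and x: "x \<in> nforms"
  shows "label i x = conj_cone (G i) (fst (split i x)) (tail_label (snd (split i x)) i)"
proof -
  interpret group "G i" using i by (rule group_G)
  obtain h w where hw: "x = (h, w)" "h \<in> carrier H" "reduced w" using x by (auto simp: nforms_def)
  show ?thesis
  proof (cases "starts i w")
    case True
    then obtain g v where w: "w = (i, g) # v" by (cases w) auto
    then show ?thesis using hw i by (simp add: label_def split_def conj_cone_mult)
  next
    case False
    then show ?thesis using hw by (simp add: label_def split_def)
  qed
qed

lemma label_act:
  assumes i: "i \<in> I" and g: "g \<in> carrier (G i)" and x: "x \<in> nforms"
  shows "label i (nact i g x) = conj_cone (G i) g (label i x)"
  using label_split[OF i nact_closed[OF i g x]] label_split[OF i x] split_nact[OF i g x]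
    group.conj_cone_mult[OF group_G[OF i] g split_closed(1)[OF i x]] by simp

lemma label_cone:
  assumes i: "i \<in> I" and x: "x \<in> nforms"
  shows "positive_cone (G i) (label i x)"
proof -
  have "reduced (snd x)" "fst x \<in> carrier H" using x by (auto simp: nforms_def)
  then show ?thesis
    unfolding label_def using i tail_label(1) L_cone
    by (intro group.positive_cone_conj[OF group_G[OF i]]) auto
qed

lemma label_phi:
  assumes i: "i \<in> I" and j: "j \<in> I" and h: "h \<in> carrier H" and x: "x \<in> nforms"
  shows "\<phi> i h \<in> label i x \<longleftrightarrow> \<phi> j h \<in> label j x"
proof -
  interpret H: group H by (rule group_H)
  have x: "reduced (snd x)" "fst x \<in> carrier H" using x by (auto simp: nforms_def)
  let ?k = "inv\<^bsub>H\<^esub> fst x \<otimes>\<^bsub>H\<^esub> h \<otimes>\<^bsub>H\<^esub> fst x"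
  have *: "\<phi> i h \<in> label i x \<longleftrightarrow> \<phi> i ?k \<in> tail_label (snd x) i" if "i \<in> I" for i
    using that h x by (simp add: label_def conj_cone_def phi_mult phi_inv)
  show ?thesis using *[OF i] *[OF j] tail_label(2)[OF x(1) i j, of ?k] h x by simp
qed

lemma label_base:
  assumes "i \<in> I"
  shows "label i (\<one>\<^bsub>H\<^esub>, []) = Q i"
proof -
  have "Q i \<subseteq> carrier (G i)" using L_cone[OF assms Q_L[OF assms]] by (simp add: positive_cone_def)
  then show ?thesis
    using group.conj_cone_one[OF group_G[OF assms]] assms by (simp add: label_def phi_one)
qed

lemma invariant_order:
  obtains R where "linear_on nforms R"
    and "\<And>i g x y. i \<in> I \<Longrightarrow> g \<in> carrier (G i) \<Longrightarrow> x \<in> nforms \<Longrightarrow> y \<in> nforms \<Longrightarrow>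
      R (nact i g x) (nact i g y) \<longleftrightarrow> R x y"
    and "\<And>i g. i \<in> I \<Longrightarrow> g \<in> carrier (G i) \<Longrightarrow> R (\<one>\<^bsub>H\<^esub>, []) (nact i g (\<one>\<^bsub>H\<^esub>, [])) \<longleftrightarrow> g \<in> Q i"
proof -
  interpret H: group H by (rule group_H)
  obtain r :: "('a \<times> 'i) rel" where r: "well_order_on UNIV r"
    using well_order_on by blast
  define \<rho> where "\<rho> = r - Id"
  have wf: "wf \<rho>" and tr: "Relation.trans \<rho>" and tot: "total \<rho>"
  proof -
    show "wf \<rho>" using r by (simp add: \<rho>_def well_order_on_def)
    show "Relation.trans \<rho>"
      using r unfolding \<rho>_def well_order_on_def linear_order_on_def partial_order_on_def
        preorder_on_def by (intro trans_diff_Id) auto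
    show "total \<rho>"
      using r unfolding \<rho>_def well_order_on_def linear_order_on_def by simp
  qed
  \<comment> \<open>The orbit of the base point under the group with index \<open>o1\<close> has to come first, so \<open>o1\<close> and the
    filler \<open>a\<close> are chosen such that its one-letter code is the least one.\<close>
  obtain p where p: "p \<in> UNIV \<times> I" and p_min: "\<And>q. (q, p) \<in> \<rho> \<Longrightarrow> q \<notin> UNIV \<times> I"
    using nonempty wfE_min[OF wf, of _ "UNIV \<times> I"] by blast
  obtain a o1 where ao: "p = (a, o1)" by (cases p)
  then have o1: "o1 \<in> I" using p by simp
  let ?r = "step_order \<rho> a"
  let ?st = "\<lambda>i x. (i, snd (split i x))"
  let ?b = "\<lambda>x. birth o1 (snd x)"
  note props = step_order_props[OF wf tr tot, of a]
  have irrefl: "(s, s) \<notin> ?r" for s using props(1) by simp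
  have trans: "(s, t) \<in> ?r \<Longrightarrow> (t, u) \<in> ?r \<Longrightarrow> (s, u) \<in> ?r" for s t u
    using props(2) by (rule transD)
  have first: "(s, (i, [])) \<notin> ?r" if "fst s = i" for s i
    using that irrefl step_order_length(2)[of "fst s" "snd s" i "[]" \<rho> a] by (cases s) auto
  have origin: "(o1, []) = (i, []) \<or> ((o1, []), (i, [])) \<in> ?r" if "i \<in> I" for i
    using that tot p_min[of "(a, i)"] ao
    by (auto simp: step_order_def lenlex_conv total_on_def)
  have first_origin: "(birth o1 w, (o1, [])) \<notin> ?r" if "reduced w" for w
  proof
    assume l: "(birth o1 w, (o1, [])) \<in> ?r"
    have "fst (birth o1 w) \<in> I" using that o1 by (cases w) auto
    moreover have "birth o1 w = (fst (birth o1 w), [])"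
      using l step_order_length(2)[of "fst (birth o1 w)" "snd (birth o1 w)" o1 "[]" \<rho> a]
      by (cases "birth o1 w") auto
    ultimately show False using origin l trans irrefl by metis
  qed
  have later: "snd (split i x) = snd x" if "\<not> starts i (snd x)" for i x
    using that by (cases x) (simp add: split_def)
  have now: "birth o1 (snd x) = ?st i x" if "starts i (snd x)" for i x
    using that by (cases x; cases "snd x") (auto simp: split_def)
  have birth_le: "birth o1 (snd x) = ?st i x \<or> (birth o1 (snd x), ?st i x) \<in> ?r"
    if "i \<in> I" "x \<in> nforms" for i x
  proof (cases "starts i (snd x)")
    case True
    then show ?thesis using now by blast
  next
    case False
    then show ?thesis
      using later[OF False] origin[OF that(1)] birth_before[of "snd x" o1 i \<rho> a]
      by (cases "snd x = []") auto
  qed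
  have tree: "birth_tree I G H \<phi> nforms nact ?r fst ?st ?b label"
  proof (rule birth_tree.intro)
    show "\<exists>g \<in> carrier (G i). y = nact i g x"
      if i: "i \<in> I" and x: "x \<in> nforms" and y: "y \<in> nforms" and e: "?st i x = ?st i y" for i x y
    proof -
      interpret group "G i" using i by (rule group_G)
      let ?g = "fst (split i y) \<otimes>\<^bsub>G i\<^esub> inv\<^bsub>G i\<^esub> fst (split i x)"
      have g: "?g \<in> carrier (G i)" using split_closed(1) i x y by simp
      have "?g \<otimes>\<^bsub>G i\<^esub> fst (split i x) = fst (split i y)"
        using split_closed(1)[OF i x] split_closed(1)[OF i y] by (simp add: m_assoc)
      then have "nact i ?g x = join i (split i y)" using e by (simp add: nact_def)
      then show ?thesis using g join_split[OF i y] by metis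
    qed
    show "\<exists>i \<in> I. ?b x = ?st i x" if x: "x \<in> nforms" for x
    proof (cases "snd x = []")
      case True
      then show ?thesis using o1 by (intro bexI[of _ o1]) (auto simp: split_def split: prod.split)
    next
      case False
      then obtain i g w where w: "snd x = (i, g) # w" by (cases "snd x") auto
      then have "i \<in> I" using x by (auto simp: nforms_def)
      then show ?thesis using now[of i x] w by (intro bexI[of _ i]) auto
    qed
    show "\<exists>h \<in> carrier H. y = nact i (\<phi> i h) x"
      if i: "i \<in> I" and x: "x \<in> nforms" and y: "y \<in> nforms" and e: "?st i x = ?st i y"
        and l: "(?b x, ?st i x) \<in> ?r" "(?b y, ?st i y) \<in> ?r" for i x y
    proof -
      have "\<not> starts i (snd x)" "\<not> starts i (snd y)" using l now irrefl by metis+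
      then have w: "snd x = snd y" using e later by simp
      have h: "fst x \<in> carrier H" "fst y \<in> carrier H" using x y by (auto simp: nforms_def)
      then have "nact i (\<phi> i (fst y \<otimes>\<^bsub>H\<^esub> inv\<^bsub>H\<^esub> fst x)) x = y"
        using nact_phi[OF i _ x] w by (simp add: H.m_assoc prod_eq_iff)
      then show ?thesis using h by (intro bexI[of _ "fst y \<otimes>\<^bsub>H\<^esub> inv\<^bsub>H\<^esub> fst x"]) auto
    qed
    show "(?st i x, ?st i y) \<in> ?r"
      if i: "i \<in> I" and x: "x \<in> nforms" and y: "y \<in> nforms"
        and l: "(?b y, ?st i y) \<in> ?r" "(?b x, ?b y) \<in> ?r" for i x y
    proof (cases "starts i (snd x)")
      case True
      then show ?thesis using now[OF True] l trans by metis
    next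
      case False
      have "\<not> starts i (snd y)" using l now irrefl by metis
      then have st: "?st i x = (i, snd x)" "?st i y = (i, snd y)" using False later by simp_all
      have "reduced (snd x)" using x by (auto simp: nforms_def)
      then have "snd y \<noteq> []" using l(2) first_origin by auto
      moreover have "((i, []), (i, snd y)) \<in> ?r" if "snd y \<noteq> []"
        using that by (intro step_order_length) simp
      ultimately show ?thesis
        using l(2) st step_order_mono[of o1 "snd x" "snd y" \<rho> a i] by (cases "snd x = []") auto
    qed
    show "label i (nact i g x) = conj_cone (G i) g (label i x)"
      if "i \<in> I" "g \<in> carrier (G i)" "x \<in> nforms" for i g x
      using that by (rule label_act)
    show "\<phi> i h \<in> label i x \<longleftrightarrow> \<phi> j h \<in> label j x"
      if "i \<in> I" "j \<in> I" "h \<in> carrier H" "x \<in> nforms" for i j h x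
      using that by (rule label_phi)
    show "nact i (\<phi> i h) x = nact j (\<phi> j h) x"
      if "i \<in> I" "j \<in> I" "h \<in> carrier H" "x \<in> nforms" for i j h x
      using that nact_phi by simp
  qed (simp_all add: group_G group_H mon nact_closed nact_one nact_mult split_nact label_cone
      props birth_le nact_free)
  interpret birth_tree I G H \<phi> nforms nact ?r fst ?st ?b label by (rule tree)
  have base: "(\<one>\<^bsub>H\<^esub>, []) \<in> nforms" by (simp add: nforms_def)
  show ?thesis
  proof (rule that[of less])
    show "less (\<one>\<^bsub>H\<^esub>, []) (nact i g (\<one>\<^bsub>H\<^esub>, [])) \<longleftrightarrow> g \<in> Q i"
      if "i \<in> I" "g \<in> carrier (G i)" for i g
      using less_first_orbit[OF that(1) base that(2)] first label_base[OF that(1)]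
      by (simp add: split_def)
  qed (use less_linear less_act in blast)+
qed

end

context amalg_nf
begin

definition acts :: "('i \<times> 'a) list \<Rightarrow> 'h \<times> ('i \<times> 'a) list \<Rightarrow> 'h \<times> ('i \<times> 'a) list" where
  "acts w x = foldr (\<lambda>(i, g). nact i g) w x"

lemma acts_simps [simp]: "acts [] x = x" "acts ((i, g) # w) x = nact i g (acts w x)"
  "acts (v @ w) x = acts v (acts w x)"
  by (simp_all add: acts_def)

lemma acts_closed: "w \<in> W \<Longrightarrow> x \<in> nforms \<Longrightarrow> acts w x \<in> nforms"
  by (induction w) (auto simp: nact_closed)

lemma acts_eqv: "eqv v w \<Longrightarrow> x \<in> nforms \<Longrightarrow> acts v x = acts w x"
proof (induction arbitrary: x rule: amalg_eq.induct)
  case (mult u v i g h)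
  then show ?case by (simp add: nact_mult acts_closed)
next
  case (one u v i)
  then show ?case by (simp add: nact_one acts_closed)
next
  case (amalg u v i j h)
  then show ?case by (simp add: nact_phi acts_closed)
qed auto

definition word :: "'i \<Rightarrow> 'h \<times> ('i \<times> 'a) list \<Rightarrow> ('i \<times> 'a) list" where
  "word o1 x = (o1, \<phi> o1 (fst x)) # snd x"

lemma reduced_word: "reduced w \<Longrightarrow> w \<in> W"
  by (induction w rule: reduced.induct) auto

lemma eqv_join:
  assumes o1: "o1 \<in> I" and i: "i \<in> I" and g: "g \<in> carrier (G i)" and w: "w \<in> W"
  shows "eqv ((i, g) # w) (word o1 (join i (g, w)))"
proof -
  interpret group "G i" using i by (rule group_G)
  note d = hpart_decomp[OF i g] rep_decomp(2)[OF i g]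
  have a: "eqv ((i, \<phi> i (hpart i g)) # v) ((o1, \<phi> o1 (hpart i g)) # v)" if "v \<in> W" for v
    using amalg_eq.amalg[of "[]" I G v i o1 "hpart i g" H \<phi>] that i o1 d by simp
  show ?thesis
  proof (cases "g \<in> img i")
    case True
    then have "\<phi> i (hpart i g) = g" using d i by (simp add: rep_def)
    then show ?thesis using a[OF w] True by (simp add: word_def join_def)
  next
    case False
    have "eqv ((i, \<phi> i (hpart i g)) # (i, rep i g) # w) ((i, g) # w)"
      using amalg_eq.mult[of "[]" I G w i "\<phi> i (hpart i g)" "rep i g" H \<phi>] i w d by simp
    moreover have "eqv ((i, \<phi> i (hpart i g)) # (i, rep i g) # w)
        ((o1, \<phi> o1 (hpart i g)) # (i, rep i g) # w)"
      using a[of "(i, rep i g) # w"] i w d by simp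
    ultimately show ?thesis
      using False by (simp add: word_def join_def) (metis amalg_eq.sym amalg_eq.trans)
  qed
qed

lemma eqv_nact:
  assumes o1: "o1 \<in> I" and i: "i \<in> I" and g: "g \<in> carrier (G i)" and x: "x \<in> nforms"
  shows "eqv ((i, g) # word o1 x) (word o1 (nact i g x))"
proof -
  interpret group "G i" using i by (rule group_G)
  obtain k v where kv: "split i x = (k, v)" by (cases "split i x")
  have k: "k \<in> carrier (G i)" and v: "v \<in> W"
    using split_closed[OF i x] kv reduced_word by simp_all
  have "eqv (word o1 x) ((i, k) # v)"
    using eqv_join[OF o1 i k v] join_split[OF i x] kv by (simp add: amalg_eq.sym)
  then have "eqv ([(i, g)] @ word o1 x @ []) ([(i, g)] @ ((i, k) # v) @ [])"
    by (rule amalg_eq_context) (use i g in simp_all)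
  moreover have "eqv ((i, g) # (i, k) # v) ((i, g \<otimes>\<^bsub>G i\<^esub> k) # v)"
    using amalg_eq.mult[of "[]" I G v i g k H \<phi>] i g k v by simp
  moreover have "eqv ((i, g \<otimes>\<^bsub>G i\<^esub> k) # v) (word o1 (nact i g x))"
    using eqv_join[OF o1 i _ v, of "g \<otimes>\<^bsub>G i\<^esub> k"] g k kv by (simp add: nact_def)
  ultimately show ?thesis by simp (metis amalg_eq.trans)
qed

lemma base_nforms: "(\<one>\<^bsub>H\<^esub>, []) \<in> nforms"
  using group.is_monoid[OF group_H] by (simp add: nforms_def monoid.one_closed)

text \<open>Acting with a word on the base point computes its normal form, so words that act in the same
  way on the base point are equal in the amalgam.\<close>
lemma eqv_normal_form:
  assumes o1: "o1 \<in> I" and w: "w \<in> W"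
  shows "eqv w (word o1 (acts w (\<one>\<^bsub>H\<^esub>, [])))"
  using w
proof (induction w)
  case Nil
  have "eqv [(o1, \<one>\<^bsub>G o1\<^esub>)] []"
    using amalg_eq.one[of "[]" I G "[]" o1 H \<phi>] o1 by simp
  then show ?case using o1 by (simp add: word_def phi_one amalg_eq.sym)
next
  case (Cons l w)
  obtain i g where l: "l = (i, g)" by (cases l)
  have ig: "i \<in> I" "g \<in> carrier (G i)" "w \<in> W" using Cons.prems l by simp_all
  have "eqv ([(i, g)] @ w @ []) ([(i, g)] @ word o1 (acts w (\<one>\<^bsub>H\<^esub>, [])) @ [])"
    by (rule amalg_eq_context) (use Cons.IH ig in simp_all)
  moreover have "eqv ((i, g) # word o1 (acts w (\<one>\<^bsub>H\<^esub>, []))) (word o1 (acts (l # w) (\<one>\<^bsub>H\<^esub>, [])))"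
    using eqv_nact[OF o1 ig(1,2) acts_closed[OF ig(3) base_nforms]] l by simp
  ultimately show ?case using l by simp (metis amalg_eq.trans)
qed

lemma eqv_iff_acts:
  assumes "I \<noteq> {}" "v \<in> W" "w \<in> W"
  shows "eqv v w \<longleftrightarrow> acts v (\<one>\<^bsub>H\<^esub>, []) = acts w (\<one>\<^bsub>H\<^esub>, [])"
proof
  show "eqv v w \<Longrightarrow> acts v (\<one>\<^bsub>H\<^esub>, []) = acts w (\<one>\<^bsub>H\<^esub>, [])"
    using acts_eqv base_nforms by blast
  obtain o1 where "o1 \<in> I" using assms(1) by blast
  then show "acts v (\<one>\<^bsub>H\<^esub>, []) = acts w (\<one>\<^bsub>H\<^esub>, []) \<Longrightarrow> eqv v w"
    using eqv_normal_form assms(2,3) by (metis amalg_eq.sym amalg_eq.trans)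
qed

end

context ordered_amalgam
begin

text \<open>The theorem of Bludov and Glass: the order on the normal forms is transported to the amalgam
  by letting it act on the base point.\<close>
theorem amalgam_positive_cone:
  "\<exists>C. positive_cone P C \<and> (\<forall>i \<in> I. \<forall>g \<in> carrier (G i). \<iota> i g \<in> C \<longleftrightarrow> g \<in> Q i)"
proof -
  obtain lt where lin: "linear_on nforms lt"
    and inv: "\<And>i g x y. i \<in> I \<Longrightarrow> g \<in> carrier (G i) \<Longrightarrow> x \<in> nforms \<Longrightarrow> y \<in> nforms \<Longrightarrow>
      lt (nact i g x) (nact i g y) \<longleftrightarrow> lt x y"
    and base: "\<And>i g. i \<in> I \<Longrightarrow> g \<in> carrier (G i) \<Longrightarrow>
      lt (\<one>\<^bsub>H\<^esub>, []) (nact i g (\<one>\<^bsub>H\<^esub>, [])) \<longleftrightarrow> g \<in> Q i"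
    using invariant_order by blast
  let ?e = "(\<one>\<^bsub>H\<^esub>, []) :: 'h \<times> ('i \<times> 'a) list"
  note e = base_nforms
  interpret P: group P by (rule group_P)
  have inv_acts: "lt (acts w x) (acts w y) \<longleftrightarrow> lt x y"
    if "w \<in> W" "x \<in> nforms" "y \<in> nforms" for w x y
    using that by (induction w) (auto simp: inv acts_closed)
  define C where "C = {R `` {w} | w. w \<in> W \<and> lt ?e (acts w ?e)}"
  have mem: "R `` {w} \<in> C \<longleftrightarrow> lt ?e (acts w ?e)" if w: "w \<in> W" for w
  proof
    assume "R `` {w} \<in> C"
    then obtain v where v: "R `` {w} = R `` {v}" "v \<in> W" "lt ?e (acts v ?e)" by (auto simp: C_def)
    then have "acts w ?e = acts v ?e" using class_eq[OF w v(2)] acts_eqv e by blast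
    then show "lt ?e (acts w ?e)" using v(3) by simp
  qed (use w C_def in blast)
  have "positive_cone P C"
    unfolding positive_cone_def
  proof (intro conjI ballI impI)
    show "C \<subseteq> carrier P" using class_closed by (auto simp: C_def)
    show "\<one>\<^bsub>P\<^esub> \<notin> C" using mem[of "[]"] linear_on_irrefl[OF lin e] by (simp add: one_P)
  next
    fix p q assume "p \<in> C" "q \<in> C"
    then obtain v w where v: "p = R `` {v}" "v \<in> W" "lt ?e (acts v ?e)"
      and w: "q = R `` {w}" "w \<in> W" "lt ?e (acts w ?e)" by (auto simp: C_def)
    have "lt (acts v ?e) (acts v (acts w ?e))" using inv_acts[OF v(2) e acts_closed[OF w(2) e]] w(3) by simp
    then have "lt ?e (acts (v @ w) ?e)"
      using linear_on_trans[OF lin e _ _ v(3)] acts_closed v(2) w(2) e by simp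
    then show "p \<otimes>\<^bsub>P\<^esub> q \<in> C" using v w mem[of "v @ w"] by (simp add: mult_P)
  next
    fix p assume p: "p \<in> carrier P" "p \<noteq> \<one>\<^bsub>P\<^esub>"
    then obtain w where w: "p = R `` {w}" "w \<in> W" by (auto simp: carrier_P)
    obtain v where v: "inv\<^bsub>P\<^esub> p = R `` {v}" "v \<in> W"
      using P.inv_closed[OF p(1)] by (auto simp: carrier_P)
    have "R `` {v @ w} = R `` {[]}"
      using P.l_inv[OF p(1)] v w by (simp add: mult_P one_P)
    then have vw: "acts v (acts w ?e) = ?e"
      using class_eq[of "v @ w" "[]"] acts_eqv[of "v @ w" "[]" ?e] v w e by simp
    have we: "acts w ?e \<in> nforms" using acts_closed w e by blast
    have "acts w ?e \<noteq> ?e"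
    proof
      assume "acts w ?e = ?e"
      then have "eqv w []" using eqv_iff_acts[OF nonempty w(2), of "[]"] by simp
      then show False using p w class_eq[OF w(2), of "[]"] by (simp add: one_P)
    qed
    then consider "lt ?e (acts w ?e)" | "lt (acts w ?e) ?e"
      using linear_on_total[OF lin e we] by metis
    then show "p \<in> C \<or> inv\<^bsub>P\<^esub> p \<in> C"
    proof cases
      case 1
      then show ?thesis using mem w by simp
    next
      case 2
      then have "lt (acts v (acts w ?e)) (acts v ?e)" using inv_acts[OF v(2) we e] by blast
      then show ?thesis using vw mem[OF v(2)] v(1) by simp
    qed
  qed
  moreover have "\<iota> i g \<in> C \<longleftrightarrow> g \<in> Q i" if "i \<in> I" "g \<in> carrier (G i)" for i g
    using mem[of "[(i, g)]"] base that by (simp add: amalg_incl_def)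
  ultimately show ?thesis by blast
qed

end

section \<open>Circular orders on quotients by a cofinal central subgroup\<close>

definition cone_less :: "('k, 'm) monoid_scheme \<Rightarrow> 'k set \<Rightarrow> 'k \<Rightarrow> 'k \<Rightarrow> bool" where
  "cone_less K C x y \<longleftrightarrow> inv\<^bsub>K\<^esub> x \<otimes>\<^bsub>K\<^esub> y \<in> C"

definition sg :: "('k \<Rightarrow> 'k \<Rightarrow> bool) \<Rightarrow> 'k \<Rightarrow> 'k \<Rightarrow> int" where
  "sg lt x y = (if lt x y then 1 else if lt y x then -1 else 0)"

lemma (in group) cone_less_linear:
  assumes C: "positive_cone G C"
  shows "linear_on (carrier G) (cone_less G C)"
  unfolding linear_on_def
proof (intro conjI ballI impI)
  show "\<not> cone_less G C x x" if "x \<in> carrier G" for x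
    using that C by (simp add: cone_less_def positive_cone_def)
  show "cone_less G C x z"
    if "x \<in> carrier G" "y \<in> carrier G" "z \<in> carrier G" "cone_less G C x y" "cone_less G C y z"
    for x y z
  proof -
    have "(inv x \<otimes> y) \<otimes> (inv y \<otimes> z) \<in> C"
      using that C by (simp add: cone_less_def positive_cone_def)
    moreover have "(inv x \<otimes> y) \<otimes> (inv y \<otimes> z) = inv x \<otimes> z"
      using that by (simp add: m_assoc) (simp add: m_assoc[symmetric])
    ultimately show ?thesis by (simp add: cone_less_def)
  qed
  show "x = y \<or> cone_less G C x y \<or> cone_less G C y x" if "x \<in> carrier G" "y \<in> carrier G" for x y
  proof -
    have "inv (inv x \<otimes> y) = inv y \<otimes> x" using that by (simp add: inv_mult_group)
    moreover have "inv x \<otimes> y = \<one> \<Longrightarrow> x = y"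
      using that by (metis inv_inv inv_closed inv_equality)
    moreover have "inv x \<otimes> y \<in> carrier G" using that by simp
    ultimately show ?thesis using C unfolding cone_less_def positive_cone_def by metis
  qed
qed

lemma (in group) cone_less_mult:
  assumes "g \<in> carrier G" "x \<in> carrier G" "y \<in> carrier G"
  shows "cone_less G C (g \<otimes> x) (g \<otimes> y) \<longleftrightarrow> cone_less G C x y"
proof -
  have "inv (g \<otimes> x) \<otimes> (g \<otimes> y) = inv x \<otimes> (inv g \<otimes> g) \<otimes> y"
    using assms by (simp only: inv_mult_group m_assoc m_closed inv_closed)
  then show ?thesis using assms by (simp add: cone_less_def)
qed

lemma sg_self: "linear_on U lt \<Longrightarrow> x \<in> U \<Longrightarrow> sg lt x x = 0"
  by (simp add: sg_def linear_on_def)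

lemma sg_antisym: "linear_on U lt \<Longrightarrow> x \<in> U \<Longrightarrow> y \<in> U \<Longrightarrow> sg lt y x = - sg lt x y"
  using linear_on_asym[of U lt x y] by (auto simp: sg_def)

text \<open>The sign function of a linear order is an antisymmetric cochain whose coboundary is the
  circular order induced by the linear order.\<close>
lemma sg_cases:
  assumes "linear_on U lt" "x \<in> U" "y \<in> U" "z \<in> U"
  defines "s \<equiv> sg lt y z - sg lt x z + sg lt x y"
  shows "s \<in> {-1, 0, 1}" "s = 0 \<longleftrightarrow> x = y \<or> x = z \<or> y = z"
proof -
  note self = sg_self[OF assms(1)] and anti = sg_antisym[OF assms(1)]
  have "s \<in> {-1, 0, 1} \<and> (s = 0 \<longleftrightarrow> x = y \<or> x = z \<or> y = z)"
  proof (cases "x = y \<or> x = z \<or> y = z")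
    case True
    then have "s = 0" using self assms(2-4) anti[of x y] by (auto simp: s_def)
    then show ?thesis using True by simp
  next
    case False
    have v: "sg lt u v = (if lt u v then 1 else -1)" if "u \<in> U" "v \<in> U" "u \<noteq> v" for u v
      using that linear_on_total[OF assms(1), of u v] by (auto simp: sg_def)
    have "lt x z" if "lt x y" "lt y z"
      using linear_on_trans[OF assms(1-4)] that by blast
    moreover have "\<not> lt x z" if "\<not> lt x y" "\<not> lt y z"
    proof -
      have "lt z y" "lt y x" using that False linear_on_total[OF assms(1)] assms(2-4) by metis+
      then have "lt z x" using linear_on_trans[OF assms(1,4,3,2)] by blast
      then show ?thesis using linear_on_asym[OF assms(1,4,2)] by blast
    qed
    moreover have "sg lt x y = (if lt x y then 1 else -1)" "sg lt y z = (if lt y z then 1 else -1)"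
      "sg lt x z = (if lt x z then 1 else -1)" using False v assms(2-4) by simp_all
    ultimately show ?thesis using False by (auto simp: s_def)
  qed
  then show "s \<in> {-1, 0, 1}" "s = 0 \<longleftrightarrow> x = y \<or> x = z \<or> y = z" by blast+
qed

locale cofinal_center = K: group K for K :: "('k, 'm) monoid_scheme" (structure) +
  fixes C :: "'k set" and \<zeta> :: "int \<Rightarrow> 'k"
  assumes cone: "positive_cone K C"
    and \<zeta>_closed [simp]: "\<zeta> n \<in> carrier K"
    and \<zeta>_add: "\<zeta> (m + n) = \<zeta> m \<otimes> \<zeta> n"
    and \<zeta>_central: "x \<in> carrier K \<Longrightarrow> \<zeta> n \<otimes> x = x \<otimes> \<zeta> n"
    and \<zeta>_pos: "\<zeta> 1 \<in> C"
    and cofinal: "x \<in> carrier K \<Longrightarrow> \<exists>n. \<zeta> n \<otimes> x \<in> C"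
begin

abbreviation lt where "lt \<equiv> cone_less K C"

text \<open>The half-open interval from \<open>\<one>\<close> (included) to \<open>\<zeta> 1\<close> (excluded), a set of representatives for
  the quotient by the powers of \<open>\<zeta> 1\<close>.\<close>
definition fund :: "'k set" where
  "fund = {x \<in> carrier K. \<not> lt x \<one> \<and> lt x (\<zeta> 1)}"

lemmas lin = K.cone_less_linear[OF cone]

lemma lt_trans: "x \<in> carrier K \<Longrightarrow> y \<in> carrier K \<Longrightarrow> z \<in> carrier K \<Longrightarrow> lt x y \<Longrightarrow> lt y z \<Longrightarrow> lt x z"
  using linear_on_trans[OF lin] .

lemma lt_total: "x \<in> carrier K \<Longrightarrow> y \<in> carrier K \<Longrightarrow> x = y \<or> lt x y \<or> lt y x"
  using linear_on_total[OF lin] .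

lemma lt_irrefl: "x \<in> carrier K \<Longrightarrow> \<not> lt x x"
  using linear_on_irrefl[OF lin] .

lemma lt_mult: "g \<in> carrier K \<Longrightarrow> x \<in> carrier K \<Longrightarrow> y \<in> carrier K \<Longrightarrow> lt (g \<otimes> x) (g \<otimes> y) \<longleftrightarrow> lt x y"
  using K.cone_less_mult .

lemma one_lt: "x \<in> carrier K \<Longrightarrow> lt \<one> x \<longleftrightarrow> x \<in> C"
  by (simp add: cone_less_def)

lemma \<zeta>_zero: "\<zeta> 0 = \<one>"
  using \<zeta>_add[of 0 0] by (metis K.l_cancel_one' \<zeta>_closed add.right_neutral)

lemma \<zeta>_mult: "x \<in> carrier K \<Longrightarrow> \<zeta> m \<otimes> (\<zeta> n \<otimes> x) = \<zeta> (m + n) \<otimes> x"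
  by (simp add: \<zeta>_add K.m_assoc)

lemma \<zeta>_less: "m < n \<Longrightarrow> x \<in> carrier K \<Longrightarrow> lt (\<zeta> m \<otimes> x) (\<zeta> n \<otimes> x)"
proof -
  assume mn: "m < n" and x: "x \<in> carrier K"
  have step: "lt (\<zeta> k \<otimes> x) (\<zeta> (k + 1) \<otimes> x)" for k
  proof -
    have "lt (x \<otimes> \<zeta> k \<otimes> \<one>) (x \<otimes> \<zeta> k \<otimes> \<zeta> 1)"
      using \<zeta>_pos x by (subst lt_mult) (simp_all add: one_lt)
    then show ?thesis
      using x \<zeta>_central[OF x, of k] \<zeta>_central[OF x, of "k + 1"] by (simp add: \<zeta>_add K.m_assoc)
  qed
  show ?thesis
    using mn
  proof (induction n rule: int_gr_induct)
    case base
    then show ?case using step .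
  next
    case (step n)
    then show ?case using lt_trans[OF _ _ _ step.IH] \<open>\<And>k. lt (\<zeta> k \<otimes> x) (\<zeta> (k + 1) \<otimes> x)\<close> x by simp
  qed
qed

lemma fund_exists:
  assumes x: "x \<in> carrier K"
  shows "\<exists>n. \<zeta> n \<otimes> x \<in> fund"
proof -
  let ?Q = "\<lambda>n. \<not> lt (\<zeta> n \<otimes> x) \<one>"
  obtain n where n: "\<zeta> n \<otimes> x \<in> C" using cofinal x by blast
  then have Qn: "?Q n"
    using one_lt[of "\<zeta> n \<otimes> x"] lt_trans[of \<one> "\<zeta> n \<otimes> x" \<one>] lt_irrefl x by auto
  obtain m where m: "\<zeta> m \<otimes> inv x \<in> C" using cofinal x by blast
  have "lt (\<zeta> (- m) \<otimes> x) \<one>"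
  proof -
    have "inv (\<zeta> (- m) \<otimes> x) = \<zeta> m \<otimes> inv x"
    proof (rule K.inv_equality)
      show "\<zeta> m \<otimes> inv x \<otimes> (\<zeta> (- m) \<otimes> x) = \<one>"
      proof -
        have "inv x \<otimes> (x \<otimes> \<zeta> (- m)) = \<zeta> (- m)" using x by (simp add: K.m_assoc[symmetric])
        then show ?thesis
          using x \<zeta>_central[OF x, of "- m"] \<zeta>_add[of m "- m"] \<zeta>_zero by (simp add: K.m_assoc)
      qed
    qed (use x in auto)
    then show ?thesis using m x by (simp add: cone_less_def)
  qed
  then have Qm: "\<not> ?Q (- m)" by simp
  have "- m < n"
  proof (rule ccontr)
    assume "\<not> - m < n"
    then have "n = - m \<or> lt (\<zeta> n \<otimes> x) (\<zeta> (- m) \<otimes> x)" using \<zeta>_less x by force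
    then show False using Qm Qn lt_trans x by (metis K.m_closed K.one_closed \<zeta>_closed)
  qed
  have "\<exists>k. ?Q k \<and> \<not> ?Q (k - 1)"
  proof (rule ccontr)
    assume a: "\<not> ?thesis"
    have "\<not> ?Q k" if "- m < k" for k
      using that
    proof (induction k rule: int_gr_induct)
      case base
      then show ?case using a Qm by force
    next
      case (step k)
      then show ?case using a by force
    qed
    then show False using Qn \<open>- m < n\<close> by blast
  qed
  then obtain k where k: "?Q k" "\<not> ?Q (k - 1)" by blast
  have "lt (\<zeta> 1 \<otimes> (\<zeta> (k - 1) \<otimes> x)) (\<zeta> 1 \<otimes> \<one>)" using k(2) x by (subst lt_mult) auto
  then have "lt (\<zeta> k \<otimes> x) (\<zeta> 1)" using x by (simp add: \<zeta>_mult)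
  then show ?thesis using k x by (auto simp: fund_def)
qed

text \<open>The points \<open>x\<close> and \<open>y\<close> are less than one period apart, so multiplication by \<open>a\<close> can move
  them at most into adjacent periods.\<close>
lemma fund_shift:
  assumes x: "x \<in> fund" and y: "y \<in> fund" and a: "a \<in> carrier K"
    and kx: "\<zeta> k \<otimes> (a \<otimes> x) \<in> fund" and ly: "\<zeta> l \<otimes> (a \<otimes> y) \<in> fund" and kl: "k < l"
  shows "l = k + 1" "lt y x" "lt (\<zeta> k \<otimes> (a \<otimes> x)) (\<zeta> l \<otimes> (a \<otimes> y))"
proof -
  have xK: "x \<in> carrier K" and yK: "y \<in> carrier K" using x y by (simp_all add: fund_def)
  have yx: "lt (\<zeta> n \<otimes> (a \<otimes> x)) (\<zeta> (n + 1) \<otimes> (a \<otimes> y))" for n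
  proof -
    have "lt x (\<zeta> 1)" "\<zeta> 1 = \<zeta> 1 \<otimes> y \<or> lt (\<zeta> 1) (\<zeta> 1 \<otimes> y)"
      using x y lt_total[OF yK K.one_closed] lt_mult[of "\<zeta> 1" \<one> y] by (auto simp: fund_def)
    then have "lt x (\<zeta> 1 \<otimes> y)" using lt_trans[of x "\<zeta> 1" "\<zeta> 1 \<otimes> y"] xK yK by auto
    then have "lt (\<zeta> n \<otimes> a \<otimes> x) (\<zeta> n \<otimes> a \<otimes> (\<zeta> 1 \<otimes> y))"
      using lt_mult[of "\<zeta> n \<otimes> a"] xK yK a by simp
    moreover have "\<zeta> n \<otimes> a \<otimes> (\<zeta> 1 \<otimes> y) = \<zeta> (n + 1) \<otimes> (a \<otimes> y)"
    proof -
      have "a \<otimes> (\<zeta> 1 \<otimes> y) = \<zeta> 1 \<otimes> (a \<otimes> y)"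
        using a yK \<zeta>_central[OF a, of 1] by (simp add: K.m_assoc[symmetric])
      then show ?thesis using a yK by (simp add: \<zeta>_add K.m_assoc)
    qed
    ultimately show ?thesis using a xK by (simp add: K.m_assoc)
  qed
  have c: "\<zeta> n \<otimes> (a \<otimes> x) \<in> carrier K" "\<zeta> n \<otimes> (a \<otimes> y) \<in> carrier K" for n using a xK yK by simp_all
  show l: "l = k + 1"
  proof (rule ccontr)
    assume "l \<noteq> k + 1"
    then have "k + 1 < l" using kl by simp
    have "lt \<one> (\<zeta> k \<otimes> (a \<otimes> x)) \<or> \<one> = \<zeta> k \<otimes> (a \<otimes> x)"
      using kx lt_total[OF K.one_closed c(1)] by (auto simp: fund_def)
    then have "lt (\<zeta> 1) (\<zeta> 1 \<otimes> (\<zeta> k \<otimes> (a \<otimes> x))) \<or> \<zeta> 1 = \<zeta> 1 \<otimes> (\<zeta> k \<otimes> (a \<otimes> x))"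
      using lt_mult[of "\<zeta> 1" \<one> "\<zeta> k \<otimes> (a \<otimes> x)"] c by auto
    then have 1: "lt (\<zeta> 1) (\<zeta> (k + 1) \<otimes> (a \<otimes> x)) \<or> \<zeta> 1 = \<zeta> (k + 1) \<otimes> (a \<otimes> x)"
      using \<zeta>_mult[of "a \<otimes> x" 1 k] a xK by (simp add: add.commute)
    have 2: "lt (\<zeta> (k + 1) \<otimes> (a \<otimes> x)) (\<zeta> (k + 2) \<otimes> (a \<otimes> y))" using yx[of "k + 1"] by (simp add: add.commute)
    have 3: "lt (\<zeta> (k + 2) \<otimes> (a \<otimes> y)) (\<zeta> l \<otimes> (a \<otimes> y)) \<or> k + 2 = l"
      using \<open>k + 1 < l\<close> \<zeta>_less[of "k + 2" l "a \<otimes> y"] a yK by force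
    have "lt (\<zeta> 1) (\<zeta> (k + 2) \<otimes> (a \<otimes> y))" using 1 2 lt_trans[OF \<zeta>_closed c(1) c(2)] by metis
    then have "lt (\<zeta> 1) (\<zeta> l \<otimes> (a \<otimes> y))" using 3 lt_trans[OF \<zeta>_closed c(2) c(2)] by metis
    moreover have "lt (\<zeta> l \<otimes> (a \<otimes> y)) (\<zeta> 1)" using ly by (simp add: fund_def)
    ultimately have "lt (\<zeta> 1) (\<zeta> 1)" by (rule lt_trans[OF \<zeta>_closed c(2) \<zeta>_closed])
    then show False using lt_irrefl[OF \<zeta>_closed, of 1] by simp
  qed
  show "lt (\<zeta> k \<otimes> (a \<otimes> x)) (\<zeta> l \<otimes> (a \<otimes> y))" using yx[of k] l by simp
  have "lt (\<zeta> 1 \<otimes> (\<zeta> k \<otimes> (a \<otimes> y))) (\<zeta> 1 \<otimes> \<one>)"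
    using ly l \<zeta>_mult[of "a \<otimes> y" 1 k] a yK by (simp add: fund_def add.commute)
  then have "lt (\<zeta> k \<otimes> (a \<otimes> y)) \<one>" using lt_mult[OF \<zeta>_closed c(2) K.one_closed] by blast
  moreover have "\<one> = \<zeta> k \<otimes> (a \<otimes> x) \<or> lt \<one> (\<zeta> k \<otimes> (a \<otimes> x))"
    using kx lt_total[OF K.one_closed c(1)] by (auto simp: fund_def)
  ultimately have "lt (\<zeta> k \<otimes> (a \<otimes> y)) (\<zeta> k \<otimes> (a \<otimes> x))"
    using lt_trans[OF c(2) K.one_closed c(1)] by metis
  then show "lt y x" using lt_mult[of "\<zeta> k \<otimes> a" y x] a xK yK by (simp add: K.m_assoc)
qed

text \<open>Under the action of \<open>a\<close> on the representatives, the sign function changes by a coboundary.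
  This makes the circular order below invariant.\<close>
lemma sg_shift:
  assumes "x \<in> fund" "y \<in> fund" "a \<in> carrier K"
    "\<zeta> k \<otimes> (a \<otimes> x) \<in> fund" "\<zeta> l \<otimes> (a \<otimes> y) \<in> fund"
  shows "sg lt (\<zeta> k \<otimes> (a \<otimes> x)) (\<zeta> l \<otimes> (a \<otimes> y)) = sg lt x y + 2 * (l - k)"
proof -
  have K: "x \<in> carrier K" "y \<in> carrier K" using assms by (simp_all add: fund_def)
  have K': "\<zeta> k \<otimes> (a \<otimes> x) \<in> carrier K" "\<zeta> l \<otimes> (a \<otimes> y) \<in> carrier K" using K assms by simp_all
  consider "k < l" | "l < k" | "k = l" by linarith
  then show ?thesis
  proof cases
    case 1
    note f = fund_shift[OF assms 1]
    then show ?thesis using linear_on_asym[OF lin K(2,1)] by (simp add: sg_def)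
  next
    case 2
    note f = fund_shift[OF assms(2,1,3,5,4) 2]
    then show ?thesis
      using linear_on_asym[OF lin K'(2,1)] by (simp add: sg_def)
  next
    case 3
    have "lt (\<zeta> k \<otimes> (a \<otimes> u)) (\<zeta> k \<otimes> (a \<otimes> v)) \<longleftrightarrow> lt u v" if "u \<in> carrier K" "v \<in> carrier K" for u v
      using that assms(3) lt_mult by simp
    then show ?thesis using 3 K by (simp add: sg_def)
  qed
qed

text \<open>The circular order is the coboundary of the sign function on the representatives in \<open>fund\<close>,
  so the cocycle identity is automatic.\<close>
theorem circ_order_quotient:
  assumes P: "group P" and hom: "\<pi> \<in> hom K P" and surj: "carrier P \<subseteq> \<pi> ` carrier K"
    and ker: "\<And>x. x \<in> carrier K \<Longrightarrow> \<pi> x = \<one>\<^bsub>P\<^esub> \<Longrightarrow> x \<in> range \<zeta>"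
    and ker': "\<And>n. \<pi> (\<zeta> n) = \<one>\<^bsub>P\<^esub>"
  shows "\<exists>c \<in> circ_orders P. \<forall>x \<in> fund. \<forall>y \<in> fund. \<forall>z \<in> fund.
    c (\<pi> x, \<pi> y, \<pi> z) = sg lt y z - sg lt x z + sg lt x y"
proof -
  interpret P: group P by (rule P)
  interpret \<pi>: group_hom K P \<pi> using hom by unfold_locales
  have fK: "x \<in> carrier K" if "x \<in> fund" for x using that by (simp add: fund_def)
  have shift: "\<exists>n. y = \<zeta> n \<otimes> x" if a: "x \<in> carrier K" "y \<in> carrier K" "\<pi> x = \<pi> y" for x y
  proof -
    have "\<pi> (y \<otimes> inv x) = \<one>\<^bsub>P\<^esub>" using a by simp
    then have "y \<otimes> inv x \<in> range \<zeta>" using ker[of "y \<otimes> inv x"] a by simp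
    then obtain n where n: "y \<otimes> inv x = \<zeta> n" by blast
    have "y = y \<otimes> inv x \<otimes> x" using a by (simp add: K.m_assoc)
    then have "y = \<zeta> n \<otimes> x" using n by simp
    then show ?thesis by blast
  qed
  have inj: "x = y" if f: "x \<in> fund" "y \<in> fund" "\<pi> x = \<pi> y" for x y
  proof -
    have K: "x \<in> carrier K" "y \<in> carrier K" using f fK by blast+
    obtain n where n: "y = \<zeta> n \<otimes> x" using shift[OF K f(3)] by blast
    have "\<zeta> 0 \<otimes> (\<one> \<otimes> x) \<in> fund" "\<zeta> n \<otimes> (\<one> \<otimes> x) \<in> fund" using f n K by (simp_all add: \<zeta>_zero)
    then have "\<not> 0 < n" "\<not> n < 0"
      using fund_shift(2)[OF f(1,1) K.one_closed, of 0 n] fund_shift(2)[OF f(1,1) K.one_closed, of n 0]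
        lt_irrefl[OF K(1)] by blast+
    then show ?thesis using n K by (simp add: \<zeta>_zero)
  qed
  have "\<exists>x \<in> fund. \<pi> x = p" if p: "p \<in> carrier P" for p
  proof -
    obtain x where x: "x \<in> carrier K" "\<pi> x = p" using surj p by blast
    obtain n where n: "\<zeta> n \<otimes> x \<in> fund" using fund_exists[OF x(1)] by blast
    have "\<pi> (\<zeta> n \<otimes> x) = p" using x ker' p by simp
    then show ?thesis using n by blast
  qed
  then obtain s where s: "\<And>p. p \<in> carrier P \<Longrightarrow> s p \<in> fund \<and> \<pi> (s p) = p" by metis
  have sK: "s p \<in> carrier K" if "p \<in> carrier P" for p using s fK that by blast
  have s_inj: "s p = s q \<longleftrightarrow> p = q" if "p \<in> carrier P" "q \<in> carrier P" for p q
    using s that by metis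
  define F where "F p q r = sg lt (s q) (s r) - sg lt (s p) (s r) + sg lt (s p) (s q)" for p q r
  define c where "c = (\<lambda>(p, q, r) \<in> carrier P \<times> carrier P \<times> carrier P. F p q r)"
  have c: "c (p, q, r) = F p q r" if "p \<in> carrier P" "q \<in> carrier P" "r \<in> carrier P" for p q r
    using that by (simp add: c_def)
  have "c \<in> circ_orders P"
    unfolding circ_orders_def
  proof (intro CollectI conjI ballI)
    show "c \<in> carrier P \<times> carrier P \<times> carrier P \<rightarrow>\<^sub>E {-1, 0, 1}"
    proof (rule PiE_I)
      fix t assume "t \<in> carrier P \<times> carrier P \<times> carrier P"
      then obtain p q r where t: "t = (p, q, r)" "p \<in> carrier P" "q \<in> carrier P" "r \<in> carrier P" by auto
      show "c t \<in> {-1, 0, 1}"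
        using sg_cases(1)[OF lin sK[OF t(2)] sK[OF t(3)] sK[OF t(4)]] t by (simp add: c F_def)
    qed (auto simp: c_def)
  next
    fix p q r assume m: "p \<in> carrier P" "q \<in> carrier P" "r \<in> carrier P"
    show "c (p, q, r) = 0 \<longleftrightarrow> p = q \<or> p = r \<or> q = r"
      using sg_cases(2)[OF lin sK[OF m(1)] sK[OF m(2)] sK[OF m(3)]] s_inj m by (simp add: c F_def)
  next
    fix p q r t assume "p \<in> carrier P" "q \<in> carrier P" "r \<in> carrier P" "t \<in> carrier P"
    then show "c (q, r, t) - c (p, r, t) + c (p, q, t) - c (p, q, r) = 0"
      by (simp add: c F_def)
  next
    fix g p q r assume m: "g \<in> carrier P" "p \<in> carrier P" "q \<in> carrier P" "r \<in> carrier P"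
    have "\<exists>n. s (g \<otimes>\<^bsub>P\<^esub> p) = \<zeta> n \<otimes> (s g \<otimes> s p)" if "p \<in> carrier P" for p
      using shift[of "s g \<otimes> s p" "s (g \<otimes>\<^bsub>P\<^esub> p)"] m that s sK by simp
    then obtain n where n: "\<And>p. p \<in> carrier P \<Longrightarrow> s (g \<otimes>\<^bsub>P\<^esub> p) = \<zeta> (n p) \<otimes> (s g \<otimes> s p)" by metis
    have "sg lt (s (g \<otimes>\<^bsub>P\<^esub> p)) (s (g \<otimes>\<^bsub>P\<^esub> q)) = sg lt (s p) (s q) + 2 * (n q - n p)"
      if "p \<in> carrier P" "q \<in> carrier P" for p q
      using sg_shift[of "s p" "s q" "s g" "n p" "n q"] that s n sK m by (metis P.m_closed)
    then show "c (g \<otimes>\<^bsub>P\<^esub> p, g \<otimes>\<^bsub>P\<^esub> q, g \<otimes>\<^bsub>P\<^esub> r) = c (p, q, r)"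
      using m by (simp add: c F_def)
  qed
  moreover have "c (\<pi> x, \<pi> y, \<pi> z) = sg lt y z - sg lt x z + sg lt x y"
    if "x \<in> fund" "y \<in> fund" "z \<in> fund" for x y z
  proof -
    have "s (\<pi> u) = u" if "u \<in> fund" for u using inj s fK that by (metis \<pi>.hom_closed)
    then show ?thesis using that fK by (simp add: c F_def)
  qed
  ultimately show ?thesis by blast
qed

end

section \<open>Euler cocycles and central extensions\<close>

context
  fixes G :: "('a, 'm) monoid_scheme" (structure) and d
  assumes G: "group G" and d: "d \<in> circ_orders G"
begin

interpretation group G by (rule G)

lemma circ_order_act:
  "g \<in> carrier G \<Longrightarrow> x \<in> carrier G \<Longrightarrow> y \<in> carrier G \<Longrightarrow> z \<in> carrier G \<Longrightarrow>
    d (g \<otimes> x, g \<otimes> y, g \<otimes> z) = d (x, y, z)"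
  using d unfolding circ_orders_def by blast

lemma euler_cocycle_bounds:
  assumes "a \<in> carrier G" "b \<in> carrier G"
  shows "0 \<le> euler_cocycle G d (a, b)" "euler_cocycle G d (a, b) \<le> 1"
  by (simp_all add: euler_cocycle_cases[OF G d assms])

lemma euler_cocycle_one:
  assumes "a \<in> carrier G"
  shows "euler_cocycle G d (\<one>, a) = 0" "euler_cocycle G d (a, \<one>) = 0"
  using euler_cocycle_cases[OF G d] assms by simp_all

lemma euler_cocycle_inv:
  assumes "a \<in> carrier G" "a \<noteq> \<one>"
  shows "euler_cocycle G d (a, inv a) = 1"
  using euler_cocycle_cases[OF G d assms(1), of "inv a"] assms
    circ_order_zero[OF d one_closed assms(1) one_closed] by simp

text \<open>Left invariance turns the right translate by \<open>g\<close> into conjugation of the arguments.\<close>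
lemma euler_cocycle_right_translate:
  assumes g: "g \<in> carrier G" and dg: "right_translate G g d \<in> circ_orders G"
    and a: "a \<in> carrier G" and b: "b \<in> carrier G"
  shows "euler_cocycle G (right_translate G g d) (a, b) =
    euler_cocycle G d (inv g \<otimes> a \<otimes> g, inv g \<otimes> b \<otimes> g)"
proof -
  have one: "inv g \<otimes> x \<otimes> g = \<one> \<longleftrightarrow> x = \<one>" if "x \<in> carrier G" for x
  proof
    assume "inv g \<otimes> x \<otimes> g = \<one>"
    then have "g \<otimes> (inv g \<otimes> x \<otimes> g) \<otimes> inv g = \<one>" using g by simp
    then show "x = \<one>"
      using that g by (simp add: m_assoc) (simp add: m_assoc[symmetric])
  qed (use g in simp)
  have prod: "(inv g \<otimes> a \<otimes> g) \<otimes> (inv g \<otimes> b \<otimes> g) = inv g \<otimes> (a \<otimes> b \<otimes> g)"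
  proof -
    have "g \<otimes> (inv g \<otimes> (b \<otimes> g)) = b \<otimes> g" using b g by (simp add: m_assoc[symmetric])
    then show ?thesis using a b g by (simp add: m_assoc)
  qed
  have "right_translate G g d (\<one>, a, a \<otimes> b) = d (g, a \<otimes> g, a \<otimes> b \<otimes> g)"
    using a b g by (simp add: right_translate_def)
  also have "\<dots> = d (inv g \<otimes> g, inv g \<otimes> (a \<otimes> g), inv g \<otimes> (a \<otimes> b \<otimes> g))"
    using circ_order_act[of "inv g" g "a \<otimes> g" "a \<otimes> b \<otimes> g"] a b g by simp
  also have "\<dots> = d (\<one>, inv g \<otimes> a \<otimes> g, (inv g \<otimes> a \<otimes> g) \<otimes> (inv g \<otimes> b \<otimes> g))"
    using prod a b g by (simp add: m_assoc)
  finally show ?thesis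
    using euler_cocycle_cases[OF G dg a b]
      euler_cocycle_cases[OF G d, of "inv g \<otimes> a \<otimes> g" "inv g \<otimes> b \<otimes> g"] one a b g by simp
qed

lemma circ_orders_pullback:
  assumes H: "group H" and \<phi>: "\<phi> \<in> mon H G"
  shows "pullback H \<phi> d \<in> circ_orders H"
proof -
  interpret H: group H by (rule H)
  have \<phi>c: "\<phi> x \<in> carrier G" if "x \<in> carrier H" for x using \<phi> that by (auto simp: mon_def hom_def)
  have \<phi>i: "\<phi> x = \<phi> y \<longleftrightarrow> x = y" if "x \<in> carrier H" "y \<in> carrier H" for x y
    using \<phi> that by (auto simp: mon_def inj_on_def)
  have \<phi>m: "\<phi> (x \<otimes>\<^bsub>H\<^esub> y) = \<phi> x \<otimes> \<phi> y" if "x \<in> carrier H" "y \<in> carrier H" for x y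
    using \<phi> that by (auto simp: mon_def hom_def)
  have p: "pullback H \<phi> d (x, y, z) = d (\<phi> x, \<phi> y, \<phi> z)"
    if "x \<in> carrier H" "y \<in> carrier H" "z \<in> carrier H" for x y z
    using that by (simp add: pullback_def)
  show ?thesis
    unfolding circ_orders_def
  proof (intro CollectI conjI ballI)
    show "pullback H \<phi> d \<in> carrier H \<times> carrier H \<times> carrier H \<rightarrow>\<^sub>E {-1, 0, 1}"
    proof (rule PiE_I)
      fix t assume "t \<in> carrier H \<times> carrier H \<times> carrier H"
      then obtain x y z where t: "t = (x, y, z)" "x \<in> carrier H" "y \<in> carrier H" "z \<in> carrier H"
        by auto
      show "pullback H \<phi> d t \<in> {-1, 0, 1}"
        using circ_order_values[OF d \<phi>c[OF t(2)] \<phi>c[OF t(3)] \<phi>c[OF t(4)]] t p by simp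
    qed (auto simp: pullback_def)
  next
    fix x y z assume "x \<in> carrier H" "y \<in> carrier H" "z \<in> carrier H"
    then show "pullback H \<phi> d (x, y, z) = 0 \<longleftrightarrow> x = y \<or> x = z \<or> y = z"
      using circ_order_zero[OF d \<phi>c \<phi>c \<phi>c] \<phi>i p by simp
  next
    fix x y z w assume "x \<in> carrier H" "y \<in> carrier H" "z \<in> carrier H" "w \<in> carrier H"
    then show "pullback H \<phi> d (y, z, w) - pullback H \<phi> d (x, z, w) + pullback H \<phi> d (x, y, w)
        - pullback H \<phi> d (x, y, z) = 0"
      using circ_order_cocycle[OF d \<phi>c \<phi>c \<phi>c \<phi>c, of x y z w] p by simp
  next
    fix g x y z assume "g \<in> carrier H" "x \<in> carrier H" "y \<in> carrier H" "z \<in> carrier H"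
    then show "pullback H \<phi> d (g \<otimes>\<^bsub>H\<^esub> x, g \<otimes>\<^bsub>H\<^esub> y, g \<otimes>\<^bsub>H\<^esub> z) = pullback H \<phi> d (x, y, z)"
      using circ_order_act[of "\<phi> g" "\<phi> x" "\<phi> y" "\<phi> z"] \<phi>m \<phi>c p by simp
  qed
qed

lemma euler_cocycle_pullback:
  assumes H: "group H" and \<phi>: "\<phi> \<in> mon H G" and x: "x \<in> carrier H" and y: "y \<in> carrier H"
  shows "euler_cocycle H (pullback H \<phi> d) (x, y) = euler_cocycle G d (\<phi> x, \<phi> y)"
proof -
  interpret H: group H by (rule H)
  have one: "\<phi> \<one>\<^bsub>H\<^esub> = \<one>" using \<phi> H by (auto simp: mon_def intro: hom_one)
  have inj: "inj_on \<phi> (carrier H)" using \<phi> by (simp add: mon_def)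
  have c: "\<phi> x \<in> carrier G" "\<phi> y \<in> carrier G" using \<phi> x y by (auto simp: mon_def hom_def)
  have "\<phi> x = \<one> \<longleftrightarrow> x = \<one>\<^bsub>H\<^esub>" "\<phi> y = \<one> \<longleftrightarrow> y = \<one>\<^bsub>H\<^esub>"
    using inj_on_eq_iff[OF inj x H.one_closed] inj_on_eq_iff[OF inj y H.one_closed] one by simp_all
  moreover have "pullback H \<phi> d (\<one>\<^bsub>H\<^esub>, x, x \<otimes>\<^bsub>H\<^esub> y) = d (\<one>, \<phi> x, \<phi> x \<otimes> \<phi> y)"
    using \<phi> one x y by (auto simp: pullback_def mon_def hom_def)
  ultimately show ?thesis
    using euler_cocycle_cases[OF H circ_orders_pullback[OF H \<phi>] x y] euler_cocycle_cases[OF G d c]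
    by simp
qed

end

text \<open>The Euler cocycle of \<open>d\<close> is \<open>f - \<delta>u\<close>. Equivalently, \<open>d\<close> is induced by the cone
  \<open>lifted_cone G u\<close> on the central extension belonging to \<open>f\<close>.\<close>
definition lifts :: "('a, 'm) monoid_scheme \<Rightarrow> ('a \<times> 'a \<Rightarrow> int) \<Rightarrow> ('a \<times> 'a \<times> 'a \<Rightarrow> int) \<Rightarrow>
    ('a \<Rightarrow> int) \<Rightarrow> bool" where
  "lifts G f d u \<longleftrightarrow> (\<forall>a \<in> carrier G. \<forall>b \<in> carrier G.
     f (a, b) = euler_cocycle G d (a, b) + (u b - u (a \<otimes>\<^bsub>G\<^esub> b) + u a))"

lemma lifts_of_class_eq:
  fixes G (structure)
  assumes G: "group G" and c: "c \<in> circ_orders G" and d: "d \<in> circ_orders G"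
    and eq: "H2_class G (euler_cocycle G c) = H2_class G (euler_cocycle G d)"
  shows "\<exists>u. lifts G (euler_cocycle G c) d u"
proof -
  interpret Z: comm_group "Z2 G" using G by (rule Z2_comm_group)
  have "subgroup (B2 G) (Z2 G)" using B2_normal[OF G] by (simp add: normal_def)
  then have "euler_cocycle G c \<in> H2_class G (euler_cocycle G c)"
    unfolding H2_class_def using Z.rcos_self[OF euler_cocycle_closed[OF G c]] by blast
  then obtain h where h: "h \<in> B2 G" "euler_cocycle G c = h \<otimes>\<^bsub>Z2 G\<^esub> euler_cocycle G d"
    unfolding eq by (auto simp: H2_class_def r_coset_def)
  then obtain u where "h = (\<lambda>(a, b) \<in> carrier G \<times> carrier G. u b - u (a \<otimes> b) + u a)"
    by (auto simp: B2_def)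
  then have "lifts G (euler_cocycle G c) d u" using h(2) by (simp add: lifts_def Z2_ops)
  then show ?thesis by blast
qed

definition central_ext :: "('a, 'm) monoid_scheme \<Rightarrow> ('a \<times> 'a \<Rightarrow> int) \<Rightarrow> ('a \<times> int) monoid" where
  "central_ext G f = \<lparr>carrier = carrier G \<times> UNIV,
     monoid.mult = (\<lambda>(a, m) (b, n). (a \<otimes>\<^bsub>G\<^esub> b, m + n + f (a, b))), one = (\<one>\<^bsub>G\<^esub>, 0)\<rparr>"

lemma central_ext_simps [simp]:
  "carrier (central_ext G f) = carrier G \<times> UNIV"
  "(a, m) \<otimes>\<^bsub>central_ext G f\<^esub> (b, n) = (a \<otimes>\<^bsub>G\<^esub> b, m + n + f (a, b))"
  "\<one>\<^bsub>central_ext G f\<^esub> = (\<one>\<^bsub>G\<^esub>, 0)"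
  by (simp_all add: central_ext_def)

definition lifted_cone :: "('a, 'm) monoid_scheme \<Rightarrow> ('a \<Rightarrow> int) \<Rightarrow> ('a \<times> int) set" where
  "lifted_cone G u = {(a, n). a \<in> carrier G \<and> 0 \<le> n + u a \<and> (a, n) \<noteq> (\<one>\<^bsub>G\<^esub>, 0)}"

locale normalized_cocycle = group G for G :: "('a, 'm) monoid_scheme" (structure) +
  fixes f :: "'a \<times> 'a \<Rightarrow> int"
  assumes f_cocycle: "x \<in> carrier G \<Longrightarrow> y \<in> carrier G \<Longrightarrow> z \<in> carrier G \<Longrightarrow>
      f (y, z) - f (x \<otimes> y, z) + f (x, y \<otimes> z) - f (x, y) = 0"
    and f_one: "a \<in> carrier G \<Longrightarrow> f (\<one>, a) = 0" "a \<in> carrier G \<Longrightarrow> f (a, \<one>) = 0"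
begin

abbreviation "E \<equiv> central_ext G f"

lemma f_inv: "a \<in> carrier G \<Longrightarrow> f (inv a, a) = f (a, inv a)"
  using f_cocycle[of a "inv a" a] f_one by simp

lemma group_E: "group E"
proof (rule groupI)
  fix x y z assume "x \<in> carrier E" "y \<in> carrier E" "z \<in> carrier E"
  then show "x \<otimes>\<^bsub>E\<^esub> y \<otimes>\<^bsub>E\<^esub> z = x \<otimes>\<^bsub>E\<^esub> (y \<otimes>\<^bsub>E\<^esub> z)"
    using f_cocycle[of "fst x" "fst y" "fst z"] by (auto simp: m_assoc)
next
  fix x assume x: "x \<in> carrier E"
  then show "\<exists>y \<in> carrier E. y \<otimes>\<^bsub>E\<^esub> x = \<one>\<^bsub>E\<^esub>"
    by (intro bexI[of _ "(inv (fst x), - snd x - f (inv (fst x), fst x))"]) auto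
qed (auto simp: f_one)

lemma inv_E: "a \<in> carrier G \<Longrightarrow> inv\<^bsub>E\<^esub> (a, n) = (inv a, - n - f (a, inv a))"
  by (rule group.inv_equality[OF group_E]) (auto simp: f_inv)

text \<open>In the coordinates \<open>n + u a\<close> the multiplication adds the Euler cocycle of \<open>d\<close> itself. As its
  values are at least \<open>0\<close>, products of positive elements are positive; as its value at \<open>a\<close> and the
  inverse of \<open>a\<close> is \<open>1\<close> for \<open>a \<noteq> \<one>\<close>, an element or its inverse is positive.\<close>
lemma positive_cone_lifted:
  assumes d: "d \<in> circ_orders G" and u: "lifts G f d u"
  shows "positive_cone E (lifted_cone G u)"
proof -
  let ?e = "\<lambda>a b. euler_cocycle G d (a, b)"
  have f: "f (a, b) = ?e a b + (u b - u (a \<otimes> b) + u a)" if "a \<in> carrier G" "b \<in> carrier G" for a b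
    using u that by (simp add: lifts_def)
  note bounds = euler_cocycle_bounds[OF is_group d] and e_inv = euler_cocycle_inv[OF is_group d]
  have u1: "u \<one> = 0"
    using f[of \<one> \<one>] f_one[of \<one>] euler_cocycle_one[OF is_group d, of \<one>] by simp
  show ?thesis
    unfolding positive_cone_def
  proof (intro conjI ballI impI)
    show "lifted_cone G u \<subseteq> carrier E" "\<one>\<^bsub>E\<^esub> \<notin> lifted_cone G u" by (auto simp: lifted_cone_def)
  next
    fix x y assume xy: "x \<in> lifted_cone G u" "y \<in> lifted_cone G u"
    obtain a m b n where x: "x = (a, m)" and y: "y = (b, n)" by (cases x, cases y)
    have a: "a \<in> carrier G" "0 \<le> m + u a" "(a, m) \<noteq> (\<one>, 0)"
      and b: "b \<in> carrier G" "0 \<le> n + u b" "(b, n) \<noteq> (\<one>, 0)"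
      using xy x y by (auto simp: lifted_cone_def)
    have sum: "m + n + f (a, b) + u (a \<otimes> b) = (m + u a) + (n + u b) + ?e a b"
      using f[OF a(1) b(1)] by simp
    have "(a \<otimes> b, m + n + f (a, b)) \<noteq> (\<one>, 0)"
    proof
      assume eq: "(a \<otimes> b, m + n + f (a, b)) = (\<one>, 0)"
      then have z: "m + u a = 0" "n + u b = 0" "?e a b = 0"
        using sum u1 a(2) b(2) bounds[OF a(1) b(1)] by auto
      have "b = inv a" using eq a(1) b(1) inv_equality[of b a] inv_comm[of a b] by simp
      then have "a = \<one>" using e_inv[OF a(1)] z(3) by auto
      then have "m = 0" using z(1) u1 by simp
      then show False using \<open>a = \<one>\<close> a(3) by simp
    qed
    then show "x \<otimes>\<^bsub>E\<^esub> y \<in> lifted_cone G u"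
      using x y a b sum bounds[OF a(1) b(1)] by (simp add: lifted_cone_def)
  next
    fix x assume x: "x \<in> carrier E" "x \<noteq> \<one>\<^bsub>E\<^esub>"
    obtain a n where an: "x = (a, n)" "a \<in> carrier G" using x by auto
    show "x \<in> lifted_cone G u \<or> inv\<^bsub>E\<^esub> x \<in> lifted_cone G u"
    proof (cases "0 \<le> n + u a")
      case True
      then show ?thesis using an x by (auto simp: lifted_cone_def)
    next
      case False
      have "f (a, inv a) = ?e a (inv a) + u (inv a) + u a"
        using f[of a "inv a"] an u1 by simp
      then have "0 \<le> (- n - f (a, inv a)) + u (inv a)"
        using False bounds(2)[OF an(2), of "inv a"] an(2) by simp
      moreover have "(inv a, - n - f (a, inv a)) \<noteq> (\<one>, 0)"
        using False u1 an(2) f_one[of \<one>] by auto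
      ultimately show ?thesis using an by (simp add: inv_E lifted_cone_def)
    qed
  qed
qed

text \<open>Conjugation by \<open>x\<close> sends \<open>(a, n)\<close> to the conjugate of \<open>a\<close> together with \<open>n + t a\<close>. That it
  is a homomorphism says that \<open>\<delta>t\<close> is the difference of \<open>f\<close> and its conjugate, which is what is
  needed for the conjugate cone to belong to the right translate of \<open>d\<close>.\<close>
lemma conj_lifted_cone:
  assumes d: "d \<in> circ_orders G" and u: "lifts G f d u" and x: "x \<in> carrier E"
    and dx: "right_translate G (fst x) d \<in> circ_orders G"
  shows "\<exists>v. conj_cone E x (lifted_cone G u) = lifted_cone G v \<and>
    lifts G f (right_translate G (fst x) d) v"
proof -
  interpret E: group E by (rule group_E)
  obtain g k where gk: "x = (g, k)" "g \<in> carrier G" using x by auto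
  let ?c = "\<lambda>a. inv g \<otimes> a \<otimes> g"
  define t where "t a = f (inv g, a) + f (inv g \<otimes> a, g) - f (g, inv g)" for a
  have conj: "inv\<^bsub>E\<^esub> x \<otimes>\<^bsub>E\<^esub> (a, n) \<otimes>\<^bsub>E\<^esub> x = (?c a, n + t a)" if "a \<in> carrier G" for a n
    using gk that by (simp add: inv_E t_def)
  have t: "t a + t b + f (?c a, ?c b) = f (a, b) + t (a \<otimes> b)" if a: "a \<in> carrier G" and b: "b \<in> carrier G" for a b
  proof -
    let ?a = "(a, 0 :: int)" and ?b = "(b, 0 :: int)"
    have ab: "?a \<in> carrier E" "?b \<in> carrier E" using a b by simp_all
    have "x \<otimes>\<^bsub>E\<^esub> (inv\<^bsub>E\<^esub> x \<otimes>\<^bsub>E\<^esub> (?b \<otimes>\<^bsub>E\<^esub> x)) = ?b \<otimes>\<^bsub>E\<^esub> x"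
      using x ab by (simp add: E.m_assoc[symmetric] del: central_ext_simps)
    then have "(inv\<^bsub>E\<^esub> x \<otimes>\<^bsub>E\<^esub> ?a \<otimes>\<^bsub>E\<^esub> x) \<otimes>\<^bsub>E\<^esub> (inv\<^bsub>E\<^esub> x \<otimes>\<^bsub>E\<^esub> ?b \<otimes>\<^bsub>E\<^esub> x) = inv\<^bsub>E\<^esub> x \<otimes>\<^bsub>E\<^esub> (?a \<otimes>\<^bsub>E\<^esub> ?b) \<otimes>\<^bsub>E\<^esub> x"
      using x ab by (simp add: E.m_assoc del: central_ext_simps)
    moreover have "?a \<otimes>\<^bsub>E\<^esub> ?b = (a \<otimes> b, f (a, b))" by simp
    ultimately have "(?c a, 0 + t a) \<otimes>\<^bsub>E\<^esub> (?c b, 0 + t b) = (?c (a \<otimes> b), f (a, b) + t (a \<otimes> b))"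
      using conj a b by (metis m_closed)
    then show ?thesis by simp
  qed
  define v where "v a = t a + u (?c a)" for a
  have "conj_cone E x (lifted_cone G u) = lifted_cone G v"
  proof (rule Set.set_eqI)
    fix y :: "'a \<times> int"
    obtain a n where y: "y = (a, n)" by (cases y)
    show "y \<in> conj_cone E x (lifted_cone G u) \<longleftrightarrow> y \<in> lifted_cone G v"
    proof (cases "a \<in> carrier G")
      case True
      have "(a, n) = \<one>\<^bsub>E\<^esub> \<longleftrightarrow> inv\<^bsub>E\<^esub> x \<otimes>\<^bsub>E\<^esub> (a, n) \<otimes>\<^bsub>E\<^esub> x = \<one>\<^bsub>E\<^esub>"
      proof
        assume "(a, n) = \<one>\<^bsub>E\<^esub>"
        then show "inv\<^bsub>E\<^esub> x \<otimes>\<^bsub>E\<^esub> (a, n) \<otimes>\<^bsub>E\<^esub> x = \<one>\<^bsub>E\<^esub>" using x by (simp del: central_ext_simps)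
      next
        assume l: "inv\<^bsub>E\<^esub> x \<otimes>\<^bsub>E\<^esub> (a, n) \<otimes>\<^bsub>E\<^esub> x = \<one>\<^bsub>E\<^esub>"
        have an: "(a, n) \<in> carrier E" using True by simp
        have ix: "inv\<^bsub>E\<^esub> x \<in> carrier E" using E.inv_closed[OF x] .
        have "inv\<^bsub>E\<^esub> x = inv\<^bsub>E\<^esub> x \<otimes>\<^bsub>E\<^esub> (a, n)"
          using E.inv_equality[OF l x E.m_closed[OF ix an]] .
        then show "(a, n) = \<one>\<^bsub>E\<^esub>" using E.l_cancel_one[OF ix an] by metis
      qed
      then have "(a, n) = (\<one>, 0) \<longleftrightarrow> (?c a, n + t a) = (\<one>, 0)" using conj[OF True] by simp
      then show ?thesis
        using y True conj[OF True, of n] gk by (auto simp add: conj_cone_def lifted_cone_def v_def add.assoc)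
    qed (use y in \<open>auto simp: conj_cone_def lifted_cone_def\<close>)
  qed
  moreover have "lifts G f (right_translate G (fst x) d) v"
    unfolding lifts_def
  proof (intro ballI)
    fix a b assume a: "a \<in> carrier G" and b: "b \<in> carrier G"
    have "g \<otimes> (inv g \<otimes> (b \<otimes> g)) = b \<otimes> g" using b gk by (simp add: m_assoc[symmetric])
    then have c: "?c a \<otimes> ?c b = ?c (a \<otimes> b)" using a b gk by (simp add: m_assoc)
    have "f (?c a, ?c b) = euler_cocycle G d (?c a, ?c b) + (u (?c b) - u (?c a \<otimes> ?c b) + u (?c a))"
      using u a b gk by (simp add: lifts_def)
    moreover have "euler_cocycle G (right_translate G (fst x) d) (a, b) = euler_cocycle G d (?c a, ?c b)"
      using euler_cocycle_right_translate[OF is_group d _ dx a b] gk by simp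
    ultimately show "f (a, b) = euler_cocycle G (right_translate G (fst x) d) (a, b) + (v b - v (a \<otimes> b) + v a)"
      using t[OF a b] c by (simp add: v_def)
  qed
  ultimately show ?thesis by blast
qed

end

lemma normalized_euler_cocycle:
  assumes "group G" "c \<in> circ_orders G"
  shows "normalized_cocycle G (euler_cocycle G c)"
proof -
  interpret group G by fact
  show ?thesis
    using euler_cocycle_closed[OF assms] euler_cocycle_one[OF assms]
    by unfold_locales (simp_all add: Z2_iff)
qed

section \<open>Circular orders on amalgams\<close>

context amalg_data
begin

lemma incl_closed: "i \<in> I \<Longrightarrow> g \<in> carrier (G i) \<Longrightarrow> \<iota> i g \<in> carrier P"
  by (simp add: amalg_incl_def class_closed)

lemma class_Cons: "i \<in> I \<Longrightarrow> g \<in> carrier (G i) \<Longrightarrow> w \<in> W \<Longrightarrow>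
    R `` {(i, g) # w} = \<iota> i g \<otimes>\<^bsub>P\<^esub> R `` {w}"
  by (simp add: amalg_incl_def mult_P)

lemma incl_mult: "i \<in> I \<Longrightarrow> g \<in> carrier (G i) \<Longrightarrow> h \<in> carrier (G i) \<Longrightarrow>
    \<iota> i (g \<otimes>\<^bsub>G i\<^esub> h) = \<iota> i g \<otimes>\<^bsub>P\<^esub> \<iota> i h"
  using incl_hom by (auto simp: hom_def)

lemma incl_one: "i \<in> I \<Longrightarrow> \<iota> i \<one>\<^bsub>G i\<^esub> = \<one>\<^bsub>P\<^esub>"
  using hom_one[OF incl_hom grp group_P] .

lemma amalgam_induct [consumes 1, case_names one mult]:
  assumes p: "p \<in> carrier P" and one: "Q \<one>\<^bsub>P\<^esub>"
    and mult: "\<And>i g q. i \<in> I \<Longrightarrow> g \<in> carrier (G i) \<Longrightarrow> q \<in> carrier P \<Longrightarrow> Q q \<Longrightarrow> Q (\<iota> i g \<otimes>\<^bsub>P\<^esub> q)"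
  shows "Q p"
proof -
  have "Q (R `` {w})" if "w \<in> W" for w
    using that
  proof (induction w)
    case Nil
    then show ?case using one by (simp add: one_P)
  next
    case (Cons l w)
    obtain i g where l: "l = (i, g)" by (cases l)
    have ig: "i \<in> I" "g \<in> carrier (G i)" "w \<in> W" using Cons.prems l by simp_all
    then show ?case
      using mult[OF ig(1,2) class_closed[OF ig(3)]] Cons.IH l by (simp add: class_Cons)
  qed
  then show ?thesis using p by (auto simp: carrier_P)
qed

end

locale circ_amalgam = base: amalg_nf I G H \<phi>
  for I :: "'i set" and G :: "'i \<Rightarrow> ('a, 'm) monoid_scheme"
    and H :: "('h, 'n) monoid_scheme" and \<phi> +
  fixes c :: "'i \<Rightarrow> 'a \<times> 'a \<times> 'a \<Rightarrow> int" and N :: "'i \<Rightarrow> ('a \<times> 'a \<times> 'a \<Rightarrow> int) set"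
    and o1 :: 'i
  assumes o1: "o1 \<in> I"
    and N_normal: "\<And>i. i \<in> I \<Longrightarrow> normal_family (G i) (N i)"
    and N_const: "\<And>i. i \<in> I \<Longrightarrow> cohom_constant (G i) (N i)"
    and c_N: "\<And>i. i \<in> I \<Longrightarrow> c i \<in> N i"
    and c_compatible: "compatible_orders I H \<phi> c"
    and N_compatible: "compatible_families I H \<phi> N"
    and H1_surj: "\<And>i. i \<in> I \<Longrightarrow> H1_map H (\<phi> i) ` H1 (G i) = H1 H"
begin

lemma N_circ: "i \<in> I \<Longrightarrow> d \<in> N i \<Longrightarrow> d \<in> circ_orders (G i)"
  using N_normal by (auto simp: normal_family_def)

lemma c_circ: "i \<in> I \<Longrightarrow> c i \<in> circ_orders (G i)"
  by (rule N_circ) (auto intro: c_N)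

definition f where "f i = euler_cocycle (G i) (c i)"

definition fH where "fH = euler_cocycle H (pullback H (\<phi> o1) (c o1))"

abbreviation E where "E \<equiv> \<lambda>i. central_ext (G i) (f i)"

abbreviation EH where "EH \<equiv> central_ext H fH"

definition \<Phi> where "\<Phi> i = (\<lambda>(h, n :: int). (\<phi> i h, n))"

definition L where
  "L i = {lifted_cone (G i) u | u. \<exists>d \<in> N i. lifts (G i) (f i) d u}"

definition Q where "Q i = lifted_cone (G i) (\<lambda>a. 0)"

lemma cocycle_G: "i \<in> I \<Longrightarrow> normalized_cocycle (G i) (f i)"
  unfolding f_def using base.group_G c_circ by (intro normalized_euler_cocycle)

lemma cocycle_H: "normalized_cocycle H fH"
  unfolding fH_def using base.group_H base.group_G base.mon c_circ o1
  by (intro normalized_euler_cocycle circ_orders_pullback)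

lemma f_phi:
  assumes i: "i \<in> I" and h: "h \<in> carrier H" "k \<in> carrier H"
  shows "f i (\<phi> i h, \<phi> i k) = fH (h, k)"
proof -
  have "fH = euler_cocycle H (pullback H (\<phi> i) (c i))"
    using c_compatible i o1 unfolding compatible_orders_def fH_def by metis
  then show ?thesis
    using euler_cocycle_pullback[OF base.group_G[OF i] c_circ[OF i] base.group_H base.mon[OF i] h]
    by (simp add: f_def)
qed

lemma lifts_phi:
  assumes i: "i \<in> I" and d: "d \<in> N i" and u: "lifts (G i) (f i) d u"
    and h: "h \<in> carrier H" "k \<in> carrier H"
  shows "fH (h, k) = euler_cocycle H (pullback H (\<phi> i) d) (h, k) +
    (u (\<phi> i k) - u (\<phi> i (h \<otimes>\<^bsub>H\<^esub> k)) + u (\<phi> i h))"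
  using u h base.phi_closed[OF i] f_phi[OF i h] base.phi_mult[OF i h]
    euler_cocycle_pullback[OF base.group_G[OF i] N_circ[OF i d] base.group_H base.mon[OF i] h]
  by (simp add: lifts_def)

text \<open>A cone on \<open>E i\<close> induces a circular order \<open>d\<close> on \<open>G i\<close>. By compatibility some \<open>d'\<close> in the
  family of \<open>G j\<close> has the same restriction to \<open>H\<close>, and it lifts to a cone on \<open>E j\<close>. On \<open>H\<close> the
  cochains \<open>u\<close> and \<open>v\<close> of the two cones have the same coboundary, so they differ by a homomorphism
  \<open>w\<close> to the integers. Extending it to \<open>G j\<close> and adding it to \<open>v\<close> corrects the second cone.\<close>
lemma lifted_families_compatible:
  assumes i: "i \<in> I" and j: "j \<in> I" and C: "C \<in> L i"
  shows "\<exists>D \<in> L j. \<forall>x \<in> carrier EH. \<Phi> j x \<in> D \<longleftrightarrow> \<Phi> i x \<in> C"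
proof -
  interpret H: group H by (rule base.group_H)
  interpret Gj: group "G j" using j by (rule base.group_G)
  obtain u d where d: "d \<in> N i" and u: "lifts (G i) (f i) d u" and Cu: "C = lifted_cone (G i) u"
    using C by (auto simp: L_def)
  have "pullback H (\<phi> i) d \<in> pullback H (\<phi> j) ` N j"
    using N_compatible i j d unfolding compatible_families_def by blast
  then obtain d' where d': "d' \<in> N j" "pullback H (\<phi> i) d = pullback H (\<phi> j) d'" by blast
  have "H2_class (G j) (f j) = H2_class (G j) (euler_cocycle (G j) d')"
    using N_const[OF j] c_N[OF j] d'(1) unfolding cohom_constant_def f_def by blast
  then obtain v where v: "lifts (G j) (f j) d' v"
    using lifts_of_class_eq[OF base.group_G[OF j] c_circ[OF j] N_circ[OF j d'(1)]]
    unfolding f_def by blast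
  define w where "w = (\<lambda>h \<in> carrier H. u (\<phi> i h) - v (\<phi> j h))"
  have "w \<in> hom H integer_group"
  proof (rule homI)
    fix h k assume h: "h \<in> carrier H" "k \<in> carrier H"
    show "w (h \<otimes>\<^bsub>H\<^esub> k) = w h \<otimes>\<^bsub>integer_group\<^esub> w k"
      using lifts_phi[OF i d u h] lifts_phi[OF j d'(1) v h] d'(2) h by (simp add: w_def)
  qed simp
  then have "w \<in> H1 H" by (simp add: H1_def w_def)
  then have "w \<in> H1_map H (\<phi> j) ` H1 (G j)" using H1_surj[OF j] by simp
  then obtain \<psi> where \<psi>: "\<psi> \<in> H1 (G j)" "H1_map H (\<phi> j) \<psi> = w" by (elim imageE) simp
  have \<psi>_mult: "\<psi> (a \<otimes>\<^bsub>G j\<^esub> b) = \<psi> a + \<psi> b" if "a \<in> carrier (G j)" "b \<in> carrier (G j)" for a b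
    using \<psi>(1) that by (auto simp: H1_def hom_def)
  have \<psi>_phi: "\<psi> (\<phi> j h) = u (\<phi> i h) - v (\<phi> j h)" if "h \<in> carrier H" for h
    using fun_cong[OF \<psi>(2), of h] that by (simp add: H1_map_def compose_def w_def)
  have "lifts (G j) (f j) d' (\<lambda>a. v a + \<psi> a)"
    using v \<psi>_mult by (simp add: lifts_def)
  then have "lifted_cone (G j) (\<lambda>a. v a + \<psi> a) \<in> L j" using d' by (auto simp: L_def)
  moreover have "\<phi> k h = \<one>\<^bsub>G k\<^esub> \<longleftrightarrow> h = \<one>\<^bsub>H\<^esub>" if "k \<in> I" "h \<in> carrier H" for k h
    using base.phi_inj[OF that H.one_closed] base.phi_one[OF that(1)] by auto
  ultimately show ?thesis
    using i j base.phi_closed \<psi>_phi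
    by (intro bexI[of _ "lifted_cone (G j) (\<lambda>a. v a + \<psi> a)"])
      (auto simp: Cu \<Phi>_def lifted_cone_def)
qed

lemma \<Phi>_mon:
  assumes i: "i \<in> I"
  shows "\<Phi> i \<in> mon EH (E i)"
  unfolding mon_def
proof (intro CollectI conjI homI)
  show "inj_on (\<Phi> i) (carrier EH)"
    using base.phi_inj[OF i] by (auto simp: inj_on_def \<Phi>_def)
qed (use i base.phi_closed[OF i] base.phi_mult[OF i] f_phi[OF i] in \<open>auto simp: \<Phi>_def\<close>)

lemma lifts_zero: "lifts (G i) (f i) (c i) (\<lambda>a. 0)"
  by (simp add: lifts_def f_def)

lemma ordered_lift: "ordered_amalgam I E EH \<Phi> L Q"
proof (intro ordered_amalgam.intro amalg_nf.intro ordered_amalgam_axioms.intro)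
  show "group (E i)" if "i \<in> I" for i
    using normalized_cocycle.group_E[OF cocycle_G[OF that]] .
  show "group EH" using normalized_cocycle.group_E[OF cocycle_H] .
  show "I \<noteq> {}" using o1 by blast
  show "positive_cone (E i) C" if "i \<in> I" "C \<in> L i" for i C
  proof -
    obtain u d where "d \<in> N i" "lifts (G i) (f i) d u" "C = lifted_cone (G i) u"
      using \<open>C \<in> L i\<close> by (auto simp: L_def)
    then show ?thesis
      using normalized_cocycle.positive_cone_lifted[OF cocycle_G[OF \<open>i \<in> I\<close>] N_circ[OF \<open>i \<in> I\<close>]] by simp
  qed
  show "conj_cone (E i) x C \<in> L i" if i: "i \<in> I" and C: "C \<in> L i" and x: "x \<in> carrier (E i)" for i C x
  proof -
    obtain u d where d: "d \<in> N i" and u: "lifts (G i) (f i) d u" and Cu: "C = lifted_cone (G i) u"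
      using C by (auto simp: L_def)
    have dx: "right_translate (G i) (fst x) d \<in> N i"
      using N_normal[OF i] d x by (auto simp: normal_family_def)
    show ?thesis
      using normalized_cocycle.conj_lifted_cone[OF cocycle_G[OF i] N_circ[OF i d] u x N_circ[OF i dx]] dx
      by (auto simp: L_def Cu)
  qed
  show "Q i \<in> L i" if "i \<in> I" for i
    using that c_N lifts_zero by (auto simp: L_def Q_def)
  show "\<Phi> i x \<in> Q i \<longleftrightarrow> \<Phi> j x \<in> Q j" if "i \<in> I" "j \<in> I" "x \<in> carrier EH" for i j x
  proof -
    have "\<phi> k h = \<one>\<^bsub>G k\<^esub> \<longleftrightarrow> h = \<one>\<^bsub>H\<^esub>" if "k \<in> I" "h \<in> carrier H" for k h
      using base.phi_inj[OF that monoid.one_closed[OF group.is_monoid[OF base.group_H]]]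
        base.phi_one[OF that(1)] by auto
    then show ?thesis using that by (auto simp: Q_def \<Phi>_def lifted_cone_def)
  qed
qed (use \<Phi>_mon lifted_families_compatible in blast)+

sublocale lift: ordered_amalgam I E EH \<Phi> L Q
  by (rule ordered_lift)

abbreviation lift_mult (infixl "\<star>" 70) where "x \<star> y \<equiv> x \<otimes>\<^bsub>lift.P\<^esub> y"

definition \<zeta> :: "int \<Rightarrow> ('i \<times> 'a \<times> int) list set" where
  "\<zeta> n = lift.\<iota> o1 (\<one>\<^bsub>G o1\<^esub>, n)"

lemma one_closed: "i \<in> I \<Longrightarrow> \<one>\<^bsub>G i\<^esub> \<in> carrier (G i)"
  using base.group_G by (simp add: group.is_monoid monoid.one_closed)

lemma \<zeta>_eq:
  assumes i: "i \<in> I"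
  shows "\<zeta> n = lift.\<iota> i (\<one>\<^bsub>G i\<^esub>, n)"
proof -
  interpret H: group H by (rule base.group_H)
  show ?thesis
    using lift.incl_amalg[OF o1 i, of "(\<one>\<^bsub>H\<^esub>, n)"] base.phi_one[OF i] base.phi_one[OF o1]
    by (simp add: \<zeta>_def \<Phi>_def)
qed

lemma \<zeta>_closed: "\<zeta> n \<in> carrier lift.P"
  unfolding \<zeta>_def using lift.incl_closed[OF o1] one_closed[OF o1] by simp

lemma incl_\<zeta>:
  assumes i: "i \<in> I" and a: "a \<in> carrier (G i)"
  shows "\<zeta> m \<star> lift.\<iota> i (a, n) = lift.\<iota> i (a, m + n)"
    and "lift.\<iota> i (a, n) \<star> \<zeta> m = lift.\<iota> i (a, m + n)"
proof -
  interpret Gi: normalized_cocycle "G i" "f i" using i by (rule cocycle_G)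
  have "(\<one>\<^bsub>G i\<^esub>, m) \<otimes>\<^bsub>E i\<^esub> (a, n) = (a, m + n)" "(a, n) \<otimes>\<^bsub>E i\<^esub> (\<one>\<^bsub>G i\<^esub>, m) = (a, m + n)"
    using a by (simp_all add: Gi.f_one)
  then show "\<zeta> m \<star> lift.\<iota> i (a, n) = lift.\<iota> i (a, m + n)"
    "lift.\<iota> i (a, n) \<star> \<zeta> m = lift.\<iota> i (a, m + n)"
    using lift.incl_mult[OF i, of "(\<one>\<^bsub>G i\<^esub>, m)" "(a, n)"] lift.incl_mult[OF i, of "(a, n)" "(\<one>\<^bsub>G i\<^esub>, m)"] a
    by (simp_all add: \<zeta>_eq[OF i] del: central_ext_simps(2))
qed

lemma \<zeta>_add: "\<zeta> (m + n) = \<zeta> m \<star> \<zeta> n"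
  using incl_\<zeta>(1)[OF o1 one_closed[OF o1], of m n] by (simp add: \<zeta>_def)

lemma \<zeta>_zero: "\<zeta> 0 = \<one>\<^bsub>lift.P\<^esub>"
  using lift.incl_one[OF o1] by (simp add: \<zeta>_def)

lemma \<zeta>_central:
  assumes "x \<in> carrier lift.P"
  shows "\<zeta> n \<star> x = x \<star> \<zeta> n"
proof -
  interpret P: group lift.P by (rule lift.group_P)
  show ?thesis
    using assms
  proof (induction x rule: lift.amalgam_induct)
    case one
    then show ?case using \<zeta>_closed by simp
  next
    case (mult i g q)
    obtain a k where g: "g = (a, k)" "a \<in> carrier (G i)" using mult by (cases g) auto
    have gP: "lift.\<iota> i g \<in> carrier lift.P" using lift.incl_closed mult by blast
    have "\<zeta> n \<star> lift.\<iota> i g = lift.\<iota> i g \<star> \<zeta> n"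
      using incl_\<zeta>[OF mult(1) g(2)] g(1) by simp
    then have "\<zeta> n \<star> (lift.\<iota> i g \<star> q) = lift.\<iota> i g \<star> (\<zeta> n \<star> q)"
      using gP \<zeta>_closed mult(3) by (simp add: P.m_assoc[symmetric])
    then show ?case using gP \<zeta>_closed mult by (simp add: P.m_assoc)
  qed
qed

lemma cofinal_center:
  assumes C: "positive_cone lift.P C"
    and CQ: "\<And>i g. i \<in> I \<Longrightarrow> g \<in> carrier (E i) \<Longrightarrow> lift.\<iota> i g \<in> C \<longleftrightarrow> g \<in> Q i"
  shows "cofinal_center lift.P C \<zeta>"
proof -
  interpret P: group lift.P by (rule lift.group_P)
  have pos: "lift.\<iota> i (a, 1) \<in> C" if "i \<in> I" "a \<in> carrier (G i)" for i a
    using CQ[OF that(1), of "(a, 1)"] that by (simp add: Q_def lifted_cone_def)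
  have cofinal: "\<exists>n. \<zeta> n \<star> x \<in> C" if "x \<in> carrier lift.P" for x
    using that
  proof (induction x rule: lift.amalgam_induct)
    case one
    have "\<zeta> 1 \<star> \<one>\<^bsub>lift.P\<^esub> \<in> C"
      using pos[OF o1 one_closed[OF o1]] \<zeta>_closed[of 1] by (simp add: \<zeta>_def)
    then show ?case by blast
  next
    case (mult i g q)
    obtain a k where g: "g = (a, k)" "a \<in> carrier (G i)" using mult by (cases g) auto
    obtain n where n: "\<zeta> n \<star> q \<in> C" using mult by blast
    have gP: "lift.\<iota> i g \<in> carrier lift.P" using lift.incl_closed mult by blast
    have "\<zeta> (1 - k) \<star> lift.\<iota> i g \<in> C" using incl_\<zeta>(1)[OF mult(1) g(2)] g(1) pos mult(1) g(2) by simp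
    then have "(\<zeta> (1 - k) \<star> lift.\<iota> i g) \<star> (\<zeta> n \<star> q) \<in> C"
      using C n by (simp add: positive_cone_def)
    moreover have "(\<zeta> (1 - k) \<star> lift.\<iota> i g) \<star> (\<zeta> n \<star> q) =
        \<zeta> (1 - k + n) \<star> (lift.\<iota> i g \<star> q)"
    proof -
      have "lift.\<iota> i g \<star> (\<zeta> n \<star> q) = \<zeta> n \<star> (lift.\<iota> i g \<star> q)"
        using gP \<zeta>_closed mult(3) \<zeta>_central[OF gP, of n] by (simp add: P.m_assoc[symmetric])
      then show ?thesis using gP \<zeta>_closed mult(3) by (simp add: P.m_assoc \<zeta>_add)
    qed
    ultimately show ?case by metis
  qed
  show ?thesis
  proof (intro cofinal_center.intro cofinal_center_axioms.intro lift.group_P)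
    show "\<zeta> 1 \<in> C" using pos[OF o1 one_closed[OF o1]] by (simp add: \<zeta>_def)
  qed (fact C \<zeta>_closed \<zeta>_add \<zeta>_central cofinal)+
qed

definition lift_word :: "('i \<times> 'a) list \<Rightarrow> ('i \<times> 'a \<times> int) list" where
  "lift_word = map (\<lambda>(i, g). (i, (g, 0)))"

definition \<sigma> where "\<sigma> w = lift.R `` {lift_word w}"

lemma lift_word: "w \<in> base.W \<Longrightarrow> lift_word w \<in> lift.W"
  by (induction w) (auto simp: lift_word_def)

lemma \<sigma>_closed: "w \<in> base.W \<Longrightarrow> \<sigma> w \<in> carrier lift.P"
  using lift_word lift.class_closed by (simp add: \<sigma>_def)

lemma \<sigma>_simps:
  "\<sigma> [] = \<one>\<^bsub>lift.P\<^esub>"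
  "i \<in> I \<Longrightarrow> g \<in> carrier (G i) \<Longrightarrow> w \<in> base.W \<Longrightarrow> \<sigma> ((i, g) # w) = lift.\<iota> i (g, 0) \<star> \<sigma> w"
  "v \<in> base.W \<Longrightarrow> w \<in> base.W \<Longrightarrow> \<sigma> (v @ w) = \<sigma> v \<star> \<sigma> w"
proof -
  show "\<sigma> [] = \<one>\<^bsub>lift.P\<^esub>" by (simp add: \<sigma>_def lift_word_def lift.one_P)
  show "\<sigma> ((i, g) # w) = lift.\<iota> i (g, 0) \<star> \<sigma> w"
    if "i \<in> I" "g \<in> carrier (G i)" "w \<in> base.W"
    using lift.class_Cons[of i "(g, 0)" "lift_word w"] lift_word that
    by (simp add: \<sigma>_def) (simp add: lift_word_def)
  show "\<sigma> (v @ w) = \<sigma> v \<star> \<sigma> w" if "v \<in> base.W" "w \<in> base.W"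
    using that lift_word by (simp add: \<sigma>_def lift.mult_P) (simp add: lift_word_def)
qed

lemma \<zeta>_mult: "x \<in> carrier lift.P \<Longrightarrow> \<zeta> m \<star> (\<zeta> n \<star> x) = \<zeta> (m + n) \<star> x"
  using \<zeta>_closed by (simp add: \<zeta>_add monoid.m_assoc[OF group.is_monoid[OF lift.group_P]])

text \<open>The map that lifts each letter with integer part \<open>0\<close> respects the relations up to central
  elements, which is why the kernel of the projection below is generated by \<open>\<zeta> 1\<close>.\<close>
lemma \<sigma>_eqv: "base.eqv v w \<Longrightarrow> \<exists>k. \<sigma> v = \<zeta> k \<star> \<sigma> w"
proof (induction rule: amalg_eq.induct)
  interpret P: group lift.P by (rule lift.group_P)
  {
    case (refl w)
    then show ?case using \<sigma>_closed by (intro exI[of _ 0]) (simp add: \<zeta>_zero)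
  next
    case (sym v w)
    then obtain k where k: "\<sigma> v = \<zeta> k \<star> \<sigma> w" by blast
    have "w \<in> base.W" using base.amalg_eq_words[OF sym(1)] by blast
    then have "\<sigma> w = \<zeta> (- k) \<star> \<sigma> v" using k \<sigma>_closed by (simp add: \<zeta>_mult \<zeta>_zero)
    then show ?case by blast
  next
    case (trans u v w)
    then obtain k l where "\<sigma> u = \<zeta> k \<star> \<sigma> v" "\<sigma> v = \<zeta> l \<star> \<sigma> w" by blast
    moreover have "w \<in> base.W" using base.amalg_eq_words[OF trans(2)] by blast
    ultimately have "\<sigma> u = \<zeta> (k + l) \<star> \<sigma> w" using \<sigma>_closed by (simp add: \<zeta>_mult)
    then show ?case by blast
  next
    case (mult u v i g h)
    interpret Gi: group "G i" using mult(3) by (rule base.group_G)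
    let ?k = "f i (g, h)"
    have cl: "lift.\<iota> i (x, 0) \<in> carrier lift.P" if "x \<in> carrier (G i)" for x
      using lift.incl_closed[OF mult(3)] that by simp
    have "lift.\<iota> i (g, 0) \<star> lift.\<iota> i (h, 0) = lift.\<iota> i (g \<otimes>\<^bsub>G i\<^esub> h, ?k)"
      using lift.incl_mult[OF mult(3), of "(g, 0)" "(h, 0)"] mult by simp
    also have "\<dots> = \<zeta> ?k \<star> lift.\<iota> i (g \<otimes>\<^bsub>G i\<^esub> h, 0)"
      using incl_\<zeta>(1)[OF mult(3), of "g \<otimes>\<^bsub>G i\<^esub> h" ?k 0] mult by simp
    finally have e: "lift.\<iota> i (g, 0) \<star> lift.\<iota> i (h, 0) = \<zeta> ?k \<star> lift.\<iota> i (g \<otimes>\<^bsub>G i\<^esub> h, 0)" .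
    have "\<sigma> (u @ [(i, g), (i, h)] @ v) =
        \<sigma> u \<star> ((lift.\<iota> i (g, 0) \<star> lift.\<iota> i (h, 0)) \<star> \<sigma> v)"
      using mult cl \<sigma>_closed by (simp add: \<sigma>_simps P.m_assoc)
    also have "\<dots> = (\<sigma> u \<star> \<zeta> ?k) \<star> (lift.\<iota> i (g \<otimes>\<^bsub>G i\<^esub> h, 0) \<star> \<sigma> v)"
      unfolding e using mult cl \<sigma>_closed \<zeta>_closed by (simp add: P.m_assoc)
    also have "\<dots> = \<zeta> ?k \<star> \<sigma> (u @ [(i, g \<otimes>\<^bsub>G i\<^esub> h)] @ v)"
      unfolding \<zeta>_central[OF \<sigma>_closed[OF mult(1)], symmetric]
      using mult cl \<sigma>_closed \<zeta>_closed by (simp add: \<sigma>_simps P.m_assoc)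
    finally show ?case by blast
  next
    case (one u v i)
    have "lift.\<iota> i (\<one>\<^bsub>G i\<^esub>, 0) = \<one>\<^bsub>lift.P\<^esub>" using lift.incl_one[OF one(3)] by simp
    then have "\<sigma> (u @ [(i, \<one>\<^bsub>G i\<^esub>)] @ v) = \<sigma> (u @ v)"
      using one one_closed \<sigma>_closed by (simp add: \<sigma>_simps)
    then show ?case using one \<sigma>_closed by (intro exI[of _ 0]) (simp add: \<zeta>_zero)
  next
    case (amalg u v i j x)
    have "lift.\<iota> i (\<phi> i x, 0) = lift.\<iota> j (\<phi> j x, 0)"
      using lift.incl_amalg[OF amalg(3,4), of "(x, 0)"] amalg(5) by (simp add: \<Phi>_def)
    then have "\<sigma> (u @ [(i, \<phi> i x)] @ v) = \<sigma> (u @ [(j, \<phi> j x)] @ v)"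
      using amalg base.phi_closed by (simp add: \<sigma>_simps)
    then show ?case using amalg \<sigma>_closed by (intro exI[of _ 0]) (simp add: \<zeta>_zero)
  }
qed

lemma \<sigma>_surj: "x \<in> carrier lift.P \<Longrightarrow> \<exists>w \<in> base.W. \<exists>k. x = \<zeta> k \<star> \<sigma> w"
proof (induction x rule: lift.amalgam_induct)
  interpret P: group lift.P by (rule lift.group_P)
  case one
  show ?case by (intro bexI[of _ "[]"] exI[of _ 0]) (simp_all add: \<sigma>_simps \<zeta>_zero)
next
  interpret P: group lift.P by (rule lift.group_P)
  case (mult i g q)
  obtain a n where g: "g = (a, n)" "a \<in> carrier (G i)" using mult by (cases g) auto
  obtain w k where w: "w \<in> base.W" "q = \<zeta> k \<star> \<sigma> w" using mult by blast
  have aP: "lift.\<iota> i (a, 0) \<in> carrier lift.P" using lift.incl_closed mult(1) g by simp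
  have "lift.\<iota> i g = \<zeta> n \<star> lift.\<iota> i (a, 0)" using incl_\<zeta>(1)[OF mult(1) g(2), of n 0] g by simp
  then have "lift.\<iota> i g \<star> q = \<zeta> n \<star> ((lift.\<iota> i (a, 0) \<star> \<zeta> k) \<star> \<sigma> w)"
    using aP w \<zeta>_closed \<sigma>_closed by (simp add: P.m_assoc)
  also have "\<dots> = \<zeta> (n + k) \<star> \<sigma> ((i, a) # w)"
    unfolding \<zeta>_central[OF aP, symmetric]
    using aP w \<zeta>_closed \<sigma>_closed g mult(1) by (simp add: \<sigma>_simps \<zeta>_add P.m_assoc)
  finally show ?case using w g mult(1) by (intro bexI[of _ "(i, a) # w"] exI[of _ "n + k"]) simp_all
qed

lemma projection:
  obtains \<pi> where "\<pi> \<in> hom lift.P base.P"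
    and "\<And>i a n. i \<in> I \<Longrightarrow> a \<in> carrier (G i) \<Longrightarrow> \<pi> (lift.\<iota> i (a, n)) = base.\<iota> i a"
    and "carrier base.P \<subseteq> \<pi> ` carrier lift.P"
    and "\<And>x. x \<in> carrier lift.P \<Longrightarrow> \<pi> x = \<one>\<^bsub>base.P\<^esub> \<Longrightarrow> x \<in> range \<zeta>"
    and "\<And>n. \<pi> (\<zeta> n) = \<one>\<^bsub>base.P\<^esub>"
proof -
  interpret P: group base.P by (rule base.group_P)
  interpret LP: group lift.P by (rule lift.group_P)
  have "(\<lambda>x. base.\<iota> i (fst x)) \<in> hom (E i) base.P" if "i \<in> I" for i
    using base.incl_closed base.incl_mult that by (intro homI) auto
  moreover have "base.\<iota> i (fst (\<Phi> i x)) = base.\<iota> j (fst (\<Phi> j x))"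
    if "i \<in> I" "j \<in> I" "x \<in> carrier EH" for i j x
    using that base.incl_amalg[OF that(1,2), of "fst x"] by (auto simp: \<Phi>_def)
  ultimately obtain \<pi> where hom: "\<pi> \<in> hom lift.P base.P"
    and \<pi>: "\<And>i x. i \<in> I \<Longrightarrow> x \<in> carrier (E i) \<Longrightarrow> \<pi> (lift.\<iota> i x) = base.\<iota> i (fst x)"
    using lift.universal_property[OF base.group_P, of "\<lambda>i x. base.\<iota> i (fst x)"] by blast
  interpret \<pi>: group_hom lift.P base.P \<pi> using hom by unfold_locales
  have \<pi>_incl: "\<pi> (lift.\<iota> i (a, n)) = base.\<iota> i a" if "i \<in> I" "a \<in> carrier (G i)" for i a n
    using \<pi>[OF that(1), of "(a, n)"] that(2) by simp
  have \<pi>_\<zeta>: "\<pi> (\<zeta> n) = \<one>\<^bsub>base.P\<^esub>" for n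
    using \<pi>_incl[OF o1 one_closed[OF o1]] base.incl_one[OF o1] by (simp add: \<zeta>_def)
  have \<pi>_\<sigma>: "\<pi> (\<sigma> w) = base.R `` {w}" if "w \<in> base.W" for w
    using that
  proof (induction w)
    case Nil
    then show ?case by (simp add: \<sigma>_simps base.one_P)
  next
    case (Cons l w)
    obtain i g where l: "l = (i, g)" by (cases l)
    have ig: "i \<in> I" "g \<in> carrier (G i)" "w \<in> base.W" using Cons.prems l by simp_all
    have "lift.\<iota> i (g, 0) \<in> carrier lift.P" using lift.incl_closed ig by simp
    then show ?case using Cons.IH ig l \<pi>_incl \<sigma>_closed
      by (simp add: \<sigma>_simps base.class_Cons)
  qed
  show ?thesis
  proof (rule that[OF hom \<pi>_incl _ _ \<pi>_\<zeta>])
    show "carrier base.P \<subseteq> \<pi> ` carrier lift.P"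
      using \<pi>_\<sigma> \<sigma>_closed by (force simp: base.carrier_P)
  next
    fix x assume x: "x \<in> carrier lift.P" "\<pi> x = \<one>\<^bsub>base.P\<^esub>"
    obtain w k where w: "w \<in> base.W" "x = \<zeta> k \<star> \<sigma> w" using \<sigma>_surj[OF x(1)] by blast
    have "base.R `` {w} = base.R `` {[]}"
      using x(2) w \<pi>_\<sigma>[OF w(1)] \<pi>_\<zeta> \<sigma>_closed[OF w(1)] \<zeta>_closed
        \<pi>.hom_closed[OF \<sigma>_closed[OF w(1)]] by (simp add: base.one_P[symmetric])
    then have "base.eqv w []" using base.class_eq[OF w(1), of "[]"] by simp
    then obtain l where "\<sigma> w = \<zeta> l \<star> \<one>\<^bsub>lift.P\<^esub>" using \<sigma>_eqv[of w "[]"] unfolding \<sigma>_simps(1) by blast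
    then have "x = \<zeta> (k + l)" using w(2) \<zeta>_closed by (simp add: \<zeta>_add)
    then show "x \<in> range \<zeta>" by blast
  qed
qed

text \<open>It remains to see that the circular order obtained from the amalgam of the \<open>E i\<close> restricts
  to \<open>c i\<close>. The elements \<open>(a, 0)\<close> of \<open>E i\<close> lie in \<open>fund\<close>, and their order is that of \<open>G i\<close> cut
  open at \<open>\<one>\<close>: for \<open>a \<noteq> b\<close>, \<open>a\<close> is below \<open>b\<close> iff \<open>a = \<one>\<close> or \<open>\<one>\<close>, \<open>a\<close>, \<open>b\<close> are positively ordered
  by \<open>c i\<close>.\<close>
theorem circ_order_amalgam:
  "\<exists>C \<in> circ_orders base.P. \<forall>i \<in> I. pullback (G i) (base.\<iota> i) C = c i"
proof -
  obtain C where C: "positive_cone lift.P C"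
    and CQ: "\<And>i g. i \<in> I \<Longrightarrow> g \<in> carrier (E i) \<Longrightarrow> lift.\<iota> i g \<in> C \<longleftrightarrow> g \<in> Q i"
    using lift.amalgam_positive_cone by blast
  obtain \<pi> where hom: "\<pi> \<in> hom lift.P base.P"
    and \<pi>_incl: "\<And>i a n. i \<in> I \<Longrightarrow> a \<in> carrier (G i) \<Longrightarrow> \<pi> (lift.\<iota> i (a, n)) = base.\<iota> i a"
    and surj: "carrier base.P \<subseteq> \<pi> ` carrier lift.P"
    and ker: "\<And>x. x \<in> carrier lift.P \<Longrightarrow> \<pi> x = \<one>\<^bsub>base.P\<^esub> \<Longrightarrow> x \<in> range \<zeta>"
      "\<And>n. \<pi> (\<zeta> n) = \<one>\<^bsub>base.P\<^esub>"
    by (rule projection) (rule that)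
  interpret LP: group lift.P by (rule lift.group_P)
  interpret Z: cofinal_center lift.P C \<zeta> using C CQ by (rule cofinal_center)
  obtain D where D: "D \<in> circ_orders base.P"
    and D_eq: "\<And>x y z. x \<in> Z.fund \<Longrightarrow> y \<in> Z.fund \<Longrightarrow> z \<in> Z.fund \<Longrightarrow>
      D (\<pi> x, \<pi> y, \<pi> z) = sg Z.lt y z - sg Z.lt x z + sg Z.lt x y"
    using Z.circ_order_quotient[OF base.group_P hom surj ker] by blast
  have "pullback (G i) (base.\<iota> i) D = c i" if i: "i \<in> I" for i
  proof -
    interpret Gi: normalized_cocycle "G i" "f i" using i by (rule cocycle_G)
    have ci: "c i \<in> circ_orders (G i)" using c_circ i by blast
    let ?s = "\<lambda>a. lift.\<iota> i (a, 0)"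
    have less: "Z.lt (lift.\<iota> i x) (lift.\<iota> i y) \<longleftrightarrow> inv\<^bsub>E i\<^esub> x \<otimes>\<^bsub>E i\<^esub> y \<in> Q i"
      if x: "x \<in> carrier (E i)" and y: "y \<in> carrier (E i)" for x y
    proof -
      interpret Ei: group "E i" by (rule Gi.group_E)
      have "inv\<^bsub>lift.P\<^esub> lift.\<iota> i x = lift.\<iota> i (inv\<^bsub>E i\<^esub> x)"
      proof (rule LP.inv_equality)
        show "lift.\<iota> i (inv\<^bsub>E i\<^esub> x) \<star> lift.\<iota> i x = \<one>\<^bsub>lift.P\<^esub>"
          using lift.incl_mult[OF i Ei.inv_closed[OF x] x] Ei.l_inv[OF x] lift.incl_one[OF i] by simp
      qed (use lift.incl_closed[OF i] x Ei.inv_closed in blast)+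
      then have "inv\<^bsub>lift.P\<^esub> lift.\<iota> i x \<star> lift.\<iota> i y = lift.\<iota> i (inv\<^bsub>E i\<^esub> x \<otimes>\<^bsub>E i\<^esub> y)"
        using lift.incl_mult[OF i Ei.inv_closed[OF x] y] by simp
      then show ?thesis
        using CQ[OF i Ei.m_closed[OF Ei.inv_closed[OF x] y]] by (simp add: cone_less_def)
    qed
    have less_s: "Z.lt (?s a) (?s b) \<longleftrightarrow> a \<noteq> b \<and> (a = \<one>\<^bsub>G i\<^esub> \<or> c i (\<one>\<^bsub>G i\<^esub>, a, b) = 1)"
      if a: "a \<in> carrier (G i)" and b: "b \<in> carrier (G i)" for a b
    proof -
      let ?d = "inv\<^bsub>G i\<^esub> a \<otimes>\<^bsub>G i\<^esub> b"
      have d: "?d \<in> carrier (G i)" and ad: "a \<otimes>\<^bsub>G i\<^esub> ?d = b"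
        using a b by (simp_all add: Gi.m_assoc[symmetric])
      have d1: "?d = \<one>\<^bsub>G i\<^esub> \<longleftrightarrow> a = b"
        using ad a b by (metis Gi.l_inv Gi.r_one)
      have "f i (inv\<^bsub>G i\<^esub> a, b) - f i (a, inv\<^bsub>G i\<^esub> a) = - f i (a, ?d)"
        using Gi.f_cocycle[of a "inv\<^bsub>G i\<^esub> a" b] Gi.f_one b a by simp
      then have "inv\<^bsub>E i\<^esub> (a, 0) \<otimes>\<^bsub>E i\<^esub> (b, 0) = (?d, - f i (a, ?d))"
        using a by (simp add: Gi.inv_E)
      then have "Z.lt (?s a) (?s b) \<longleftrightarrow> (?d, - f i (a, ?d)) \<in> Q i" using less a b by simp
      also have "\<dots> \<longleftrightarrow> f i (a, ?d) = 0 \<and> a \<noteq> b"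
        using euler_cocycle_bounds[OF Gi.is_group ci a d] d d1
        by (auto simp: Q_def lifted_cone_def f_def)
      also have "\<dots> \<longleftrightarrow> a \<noteq> b \<and> (a = \<one>\<^bsub>G i\<^esub> \<or> c i (\<one>\<^bsub>G i\<^esub>, a, b) = 1)"
        using euler_cocycle_cases[OF Gi.is_group ci a d] ad d1 by (auto simp: f_def)
      finally show ?thesis .
    qed
    have fund: "?s a \<in> Z.fund" if a: "a \<in> carrier (G i)" for a
    proof -
      have s1: "?s \<one>\<^bsub>G i\<^esub> = \<one>\<^bsub>lift.P\<^esub>" using lift.incl_one[OF i] by simp
      have "\<not> Z.lt (?s a) \<one>\<^bsub>lift.P\<^esub>"
        using less_s[OF a Gi.one_closed] circ_order_zero[OF ci Gi.one_closed a Gi.one_closed] s1 by simp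
      moreover have "Z.lt (?s a) (\<zeta> 1)"
      proof -
        have "inv\<^bsub>E i\<^esub> (a, 0) \<otimes>\<^bsub>E i\<^esub> (\<one>\<^bsub>G i\<^esub>, 1) = (inv\<^bsub>G i\<^esub> a, 1 - f i (a, inv\<^bsub>G i\<^esub> a))"
          using a by (simp add: Gi.inv_E Gi.f_one)
        moreover have "(inv\<^bsub>G i\<^esub> a, 1 - f i (a, inv\<^bsub>G i\<^esub> a)) \<in> Q i"
          using euler_cocycle_bounds(2)[OF Gi.is_group ci a Gi.inv_closed[OF a]] a Gi.f_one(1)[of "\<one>\<^bsub>G i\<^esub>"]
          by (auto simp: Q_def lifted_cone_def f_def)
        ultimately show ?thesis using less[of "(a, 0)" "(\<one>\<^bsub>G i\<^esub>, 1)"] a by (simp add: \<zeta>_eq[OF i])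
      qed
      ultimately show ?thesis using lift.incl_closed[OF i] a by (simp add: Z.fund_def)
    qed
    have sg_s: "sg Z.lt (?s a) (?s b) =
        (if a = b then 0 else if a = \<one>\<^bsub>G i\<^esub> then 1 else if b = \<one>\<^bsub>G i\<^esub> then -1 else c i (\<one>\<^bsub>G i\<^esub>, a, b))"
      if a: "a \<in> carrier (G i)" and b: "b \<in> carrier (G i)" for a b
      using circ_order_values[OF ci Gi.one_closed a b] circ_order_zero[OF ci Gi.one_closed a b]
        circ_order_swap[OF ci Gi.one_closed a b]
      by (auto simp: sg_def less_s a b)
    have D_s: "D (base.\<iota> i x, base.\<iota> i y, base.\<iota> i z) = c i (x, y, z)"
      if x: "x \<in> carrier (G i)" and y: "y \<in> carrier (G i)" and z: "z \<in> carrier (G i)" for x y z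
    proof -
      have "D (base.\<iota> i x, base.\<iota> i y, base.\<iota> i z) =
          sg Z.lt (?s y) (?s z) - sg Z.lt (?s x) (?s z) + sg Z.lt (?s x) (?s y)"
        using D_eq[OF fund[OF x] fund[OF y] fund[OF z]] \<pi>_incl[OF i] x y z by simp
      also have "\<dots> = c i (x, y, z)"
      proof (cases "x = y \<or> x = z \<or> y = z")
        case True
        then show ?thesis
          using sg_s x y z circ_order_zero[OF ci x y z] circ_order_zero[OF ci Gi.one_closed y x]
            circ_order_swap[OF ci Gi.one_closed x y] by auto
      next
        case False
        have rot: "c i (a, b, \<one>\<^bsub>G i\<^esub>) = c i (\<one>\<^bsub>G i\<^esub>, a, b)" if "a \<in> carrier (G i)" "b \<in> carrier (G i)" for a b
          using circ_order_cocycle[OF ci Gi.one_closed that Gi.one_closed]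
            circ_order_zero[OF ci Gi.one_closed that(2) Gi.one_closed]
            circ_order_zero[OF ci Gi.one_closed that(1) Gi.one_closed] by simp
        show ?thesis
          using False circ_order_cocycle[OF ci Gi.one_closed x y z] sg_s x y z
            rot[OF x y] circ_order_swap[OF ci x Gi.one_closed z] rot[OF x z]
          by auto
      qed
      finally show ?thesis .
    qed
    have "c i \<in> extensional (carrier (G i) \<times> carrier (G i) \<times> carrier (G i))"
      using ci unfolding circ_orders_def by (auto simp: PiE_def)
    then show ?thesis
      using D_s by (intro extensionalityI[of _ "carrier (G i) \<times> carrier (G i) \<times> carrier (G i)"])
        (auto simp: pullback_def)
  qed
  then show ?thesis using D by blast
qed

end

theorem proposition4p9:
  fixes I :: "'i set"
    and G :: "'i \<Rightarrow> ('a, 'm) monoid_scheme"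
    and H :: "('h, 'n) monoid_scheme"
    and \<phi> :: "'i \<Rightarrow> 'h \<Rightarrow> 'a"
    and c :: "'i \<Rightarrow> 'a \<times> 'a \<times> 'a \<Rightarrow> int"
  assumes "I \<noteq> {}"
    and "\<And>i. i \<in> I \<Longrightarrow> group (G i)"
    and "\<And>i. i \<in> I \<Longrightarrow> c i \<in> circ_orders (G i)"
    and "group H"
    and "\<And>i. i \<in> I \<Longrightarrow> \<phi> i \<in> mon H (G i)"
    and "\<And>i. i \<in> I \<Longrightarrow> H1_map H (\<phi> i) ` H1 (G i) = H1 H"
    and "\<exists>R. (\<forall>i \<in> I. normal_family (G i) (R i) \<and> cohom_constant (G i) (R i) \<and> c i \<in> R i)
           \<and> compatible_orders I H \<phi> c \<and> compatible_families I H \<phi> R"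
  shows "\<exists>C \<in> circ_orders (amalg_product I G H \<phi>).
           \<forall>i \<in> I. pullback (G i) (amalg_incl I G H \<phi> i) C = c i"
proof -
  obtain N where N: "\<forall>i \<in> I. normal_family (G i) (N i) \<and> cohom_constant (G i) (N i) \<and> c i \<in> N i"
    "compatible_orders I H \<phi> c" "compatible_families I H \<phi> N"
    using assms(7) by blast
  obtain o1 where "o1 \<in> I" using assms(1) by blast
  then have "circ_amalgam I G H \<phi> c N o1"
    using assms(2,4,5,6) N
    by (intro circ_amalgam.intro amalg_nf.intro circ_amalgam_axioms.intro) simp_all
  then show ?thesis by (rule circ_amalgam.circ_order_amalgam)
qed

end
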